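(* There is no finitely generated group quasi-isometric to the Diestel-Leader graph $DL(m,n)$ for $m\ne n$.
   Context: Diestel-Leader graphs: for positive integers $m,n$, let $T_1$ and $T_2$ be regular trees of valence $m+1$ and $n+1$. Choose an end of each tree; this orients the edges so that each vertex of $T_1$ (resp. $T_2$) has $m$ (resp. $n$) edges pointing away from it and one edge pointing toward it. Let $f_1,f_2$ be the Busemann (height) functions on $T_1,T_2$ for the chosen ends, integer valued on vertices and changing by exactly $1$ along each edge. $DL(m,n)$ is the subset of $T_1\times T_2$ defined by $f_1+f_2=0$; it is a graph with vertices the pairs of vertices $(v_1,v_2)$ with $f_1(v_1)+f_2(v_2)=0$, with $(v_1,v_2)$ and $(w_1,w_2)$ joined by an edge when $v_i,w_i$ are adjacent in $T_i$ for $i=1,2$. It carries the path metric with edges of length one. A map $f:X\to Y$ between metric spaces is a $(K,C)$-quasi-isometry ($K\ge 1$, $C\ge 0$) if $\frac1K d_X(x_1,x_2)-C\le d_Y(f(x_1),f(x_2))\le K d_X(x_1,x_2)+C$ for all $x_1,x_2\in X$, and the $C$-neighborhood of $f(X)$ is all of $Y$. Two spaces are quasi-isometric if there is a $(K,C)$-quasi-isometry between them for some $K,C$. A finitely generated group carries the word metric of any finite generating set.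
   Formalization: The formal theorem assumes m, n ≥ 2 instead of positive integers; for m = 1 and n ≥ 2 (or vice versa) the claim is false, since DL(1,n) is the (n+1)-regular tree, a Cayley graph of a free product of n+1 copies of Z/2. *)

theory Defs
  imports
    Complex_Main
    "HOL-Algebra.Generated_Groups"
    "Graph_Theory.Pair_Digraph"
    "Graph_Theory.Digraph_Component"
    "Graph_Theory.Shortest_Path"
begin

section \<open>Quasi-isometries\<close>

definition quasi_isometry ::
  "real \<Rightarrow> real \<Rightarrow> 'a set \<Rightarrow> ('a \<Rightarrow> 'a \<Rightarrow> real) \<Rightarrow> 'b set \<Rightarrow> ('b \<Rightarrow> 'b \<Rightarrow> real) \<Rightarrow> ('a \<Rightarrow> 'b) \<Rightarrow> bool"
  where
  "quasi_isometry K C X dX Y dY f \<longleftrightarrow>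
     K \<ge> 1 \<and> C \<ge> 0 \<and> f ` X \<subseteq> Y \<and>
     (\<forall>x1\<in>X. \<forall>x2\<in>X. dX x1 x2 / K - C \<le> dY (f x1) (f x2) \<and> dY (f x1) (f x2) \<le> K * dX x1 x2 + C) \<and>
     (\<forall>y\<in>Y. \<exists>x\<in>X. dY (f x) y \<le> C)"

definition quasi_isometric ::
  "'a set \<Rightarrow> ('a \<Rightarrow> 'a \<Rightarrow> real) \<Rightarrow> 'b set \<Rightarrow> ('b \<Rightarrow> 'b \<Rightarrow> real) \<Rightarrow> bool"
  where
  "quasi_isometric X dX Y dY \<longleftrightarrow> (\<exists>K C f. quasi_isometry K C X dX Y dY f)"


section \<open>Word metrics\<close>

definition finite_generating_set :: "('g, 'r) monoid_scheme \<Rightarrow> 'g set \<Rightarrow> bool" where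
  "finite_generating_set G S \<longleftrightarrow> finite S \<and> S \<subseteq> carrier G \<and> generate G S = carrier G"

definition word_length :: "('g, 'r) monoid_scheme \<Rightarrow> 'g set \<Rightarrow> 'g \<Rightarrow> nat" where
  "word_length G S g =
     (LEAST k. \<exists>w. length w = k \<and> set w \<subseteq> S \<union> m_inv G ` S \<and> foldr (\<otimes>\<^bsub>G\<^esub>) w \<one>\<^bsub>G\<^esub> = g)"

definition word_dist :: "('g, 'r) monoid_scheme \<Rightarrow> 'g set \<Rightarrow> 'g \<Rightarrow> 'g \<Rightarrow> real" where
  "word_dist G S g h = real (word_length G S (inv\<^bsub>G\<^esub> g \<otimes>\<^bsub>G\<^esub> h))"


section \<open>Regular trees, ends and Busemann functions\<close>

text \<open>Undirected simple graphs, possibly infinite, are loopfree digraphs without parallel arcs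
  whose arc set is symmetric (\<^locale>\<open>pair_bidirected_digraph\<close>): every edge is a pair of opposite arcs.
  The path metric is taken on the vertex set, and is meaningful on connected graphs only.\<close>

definition path_dist :: "'a pair_pre_digraph \<Rightarrow> 'a \<Rightarrow> 'a \<Rightarrow> real" where
  "path_dist G u v = real_of_ereal (wf_digraph.\<mu> (with_proj G) (\<lambda>_. 1) u v)"

text \<open>The library predicate \<^const>\<open>tree\<close> does not apply to symmetric digraphs, since traversing an
  edge back and forth is a \<^const>\<open>pre_digraph.cycle\<close> of length 2. The cycles of the
  undirected graph are those of length at least 3.\<close>

definition regular_tree :: "nat \<Rightarrow> 'a pair_pre_digraph \<Rightarrow> bool" where
  "regular_tree d T \<longleftrightarrow>
     pair_bidirected_digraph T \<and>
     Digraph_Component.connected (with_proj T) \<and>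
     (\<nexists>p. pre_digraph.cycle (with_proj T) p \<and> length p \<ge> 3) \<and>
     (\<forall>v\<in>pverts T. finite (out_arcs (with_proj T) v) \<and> out_degree (with_proj T) v = d)"

definition ray :: "'a pair_pre_digraph \<Rightarrow> (nat \<Rightarrow> 'a) \<Rightarrow> bool" where
  "ray T r \<longleftrightarrow> inj r \<and> (\<forall>i. (r i, r (Suc i)) \<in> parcs T)"

definition same_end :: "'a pair_pre_digraph \<Rightarrow> ((nat \<Rightarrow> 'a) \<times> (nat \<Rightarrow> 'a)) set" where
  "same_end T = {(r, s). ray T r \<and> ray T s \<and> (\<exists>i j. \<forall>k. r (i + k) = s (j + k))}"

definition tree_ends :: "'a pair_pre_digraph \<Rightarrow> (nat \<Rightarrow> 'a) set set" where
  "tree_ends T = {r. ray T r} // same_end T"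

text \<open>The sign is such that Busemann functions decrease by 1 at each step towards the end: edges
  are oriented away from the end, each vertex has exactly one neighbour of smaller height.
  Varying the ray in the end changes the function by an integer constant.\<close>

definition busemann_function ::
  "'a pair_pre_digraph \<Rightarrow> (nat \<Rightarrow> 'a) set \<Rightarrow> ('a \<Rightarrow> int) \<Rightarrow> bool"
  where
  "busemann_function T \<xi> f \<longleftrightarrow>
     (\<exists>r\<in>\<xi>. \<forall>v\<in>pverts T. (\<lambda>k. path_dist T v (r k) - real k) \<longlonglongrightarrow> real_of_int (f v))"


section \<open>Diestel-Leader graphs\<close>

definition diestel_leader ::
  "'a pair_pre_digraph \<Rightarrow> ('a \<Rightarrow> int) \<Rightarrow> 'b pair_pre_digraph \<Rightarrow> ('b \<Rightarrow> int) \<Rightarrow> ('a \<times> 'b) pair_pre_digraph"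
  where
  "diestel_leader T1 f1 T2 f2 =
     (let V = {(v1, v2). v1 \<in> pverts T1 \<and> v2 \<in> pverts T2 \<and> f1 v1 + f2 v2 = 0}
      in \<lparr> pverts = V,
           parcs = {((v1, v2), (w1, w2)). (v1, v2) \<in> V \<and> (w1, w2) \<in> V \<and>
                      (v1, w1) \<in> parcs T1 \<and> (v2, w2) \<in> parcs T2} \<rparr>)"

text \<open>\<open>is_DL m n D\<close>: \<open>D\<close> is \<open>DL(m,n)\<close>, for some choice of trees, ends and Busemann functions.
  If \<open>m = 1\<close>, the first tree is a line and \<open>DL(1,n)\<close> is just the \<open>(n+1)\<close>-regular tree,
  which is quasi-isometric to a finitely generated virtually free group; likewise if \<open>n = 1\<close>.\<close>

definition is_DL :: "nat \<Rightarrow> nat \<Rightarrow> ('a \<times> 'b) pair_pre_digraph \<Rightarrow> bool" where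
  "is_DL m n D \<longleftrightarrow>
     (\<exists>T1 T2 \<xi>1 \<xi>2 f1 f2.
        regular_tree (m + 1) T1 \<and> \<xi>1 \<in> tree_ends T1 \<and> busemann_function T1 \<xi>1 f1 \<and>
        regular_tree (n + 1) T2 \<and> \<xi>2 \<in> tree_ends T2 \<and> busemann_function T2 \<xi>2 f2 \<and>
        D = diestel_leader T1 f1 T2 f2)"

end

theory Submission
  imports Defs
begin

text \<open>Let \<open>n < m\<close>, and weight the points of \<open>DL(m,n)\<close> by \<open>(n/m)\<close> to the power of the height in the
  \<open>m\<close>-branching tree. Each level of a large box then has the same total weight, so boxes are
  Folner sets for the weight. Consider the points \<open>T\<close> levels below a point \<open>y\<close> on a vertical path:
  their images under a quasi-isometry of \<open>DL(m,n)\<close> have, for large \<open>T\<close>, an average weight of more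
  than twice that of the image of \<open>y\<close>, uniformly in the quasi-isometry. This is
  where coarse differentiation enters: most vertical segments are mapped close to vertical segments
  at some scale, and turning them upside down is impossible for most of them, since \<open>m\<close> and \<open>n\<close>
  differ. If a group were quasi-isometric to \<open>DL(m,n)\<close>, its left translations would provide
  quasi-isometries with uniform constants moving any point to any other, and averaging the weight
  over a fixed finite set of right translations would double it everywhere. But right
  translations by a finite set move a box into a slightly larger one, of almost the same weight.\<close>

section \<open>Trees with a distinguished end\<close>

text \<open>The number of points of a box grows by \<open>m / n\<close> per level, so the top levels
  carry most of it and boxes are Folner only for the weight, which acts as the modular function of
  the isometry group. For the identity map the doubling is clear: \<open>T\<close> levels lower the
  weight is \<open>(m / n) ^ T\<close> times larger. The obstacle is uniformity. One finite set of
  right translations must serve all left translations, so \<open>T\<close> may depend on the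
  quasi-isometry constant only, while the scale at which a map looks vertical depends on the map;
  hence lengths are made divisible by every scale of a fixed finite list. Moreover, statements about
  boxes control averages over pairs (bottom point, top point), whereas doubling concerns the points
  below one fixed \<open>y\<close>. The bridge is another top point that sees most bottom points
  upright: a bottom point whose image rises above that of \<open>y\<close> is then pinned to one
  vertical line, and such points are too few. Distances are measured by the sum of the two tree
  distances, because the excess of a chain then splits into one excess per tree.\<close>

locale horo_tree =
  fixes V :: "'a set" and par :: "'a \<Rightarrow> 'a" and ht :: "'a \<Rightarrow> int" and b :: nat
  assumes V_ne: "V \<noteq> {}"
    and par_in [simp]: "x \<in> V \<Longrightarrow> par x \<in> V"
    and ht_par [simp]: "x \<in> V \<Longrightarrow> ht (par x) = ht x - 1"
    and b_pos: "b \<ge> 2"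
    and children: "x \<in> V \<Longrightarrow> card {c \<in> V. par c = x} = b"
    and common_anc: "x \<in> V \<Longrightarrow> y \<in> V \<Longrightarrow> \<exists>i j. (par ^^ i) x = (par ^^ j) y"
begin

lemma finite_children: "x \<in> V \<Longrightarrow> finite {c \<in> V. par c = x}"
  using children[of x] b_pos by (metis card.infinite not_numeral_le_zero)

lemma funpow_par_in: "x \<in> V \<Longrightarrow> (par ^^ k) x \<in> V"
  by (induction k) auto

lemma ht_funpow_par: "x \<in> V \<Longrightarrow> ht ((par ^^ k) x) = ht x - int k"
  by (induction k) (auto simp: funpow_par_in)

text \<open>\<open>nat\<close> truncates: for \<open>c\<close> above \<open>ht x\<close> the value
  is \<open>x\<close> itself, which is why most facts below assume
  \<open>c \<le> ht x\<close>.\<close>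

definition anc :: "int \<Rightarrow> 'a \<Rightarrow> 'a" where
  "anc c x = (par ^^ nat (ht x - c)) x"

lemma anc_in [simp]: "x \<in> V \<Longrightarrow> anc c x \<in> V"
  by (simp add: anc_def funpow_par_in)

lemma ht_anc [simp]: "x \<in> V \<Longrightarrow> c \<le> ht x \<Longrightarrow> ht (anc c x) = c"
  by (simp add: anc_def ht_funpow_par)

lemma anc_self [simp]: "anc (ht x) x = x"
  by (simp add: anc_def)

lemma anc_anc: "x \<in> V \<Longrightarrow> c \<le> c' \<Longrightarrow> c' \<le> ht x \<Longrightarrow> anc c (anc c' x) = anc c x"
proof -
  assume a: "x \<in> V" "c \<le> c'" "c' \<le> ht x"
  have "anc c (anc c' x) = (par ^^ nat (c' - c)) ((par ^^ nat (ht x - c')) x)"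
    using a by (simp add: anc_def[of c "anc c' x"]) (simp add: anc_def)
  also have "\<dots> = (par ^^ (nat (c' - c) + nat (ht x - c'))) x"
    by (simp add: funpow_add)
  also have "nat (c' - c) + nat (ht x - c') = nat (ht x - c)"
    using a by simp
  finally show ?thesis by (simp add: anc_def)
qed

lemma par_anc: "x \<in> V \<Longrightarrow> c \<le> ht x \<Longrightarrow> par (anc c x) = anc (c - 1) x"
proof -
  assume a: "x \<in> V" "c \<le> ht x"
  then have "nat (ht x - (c - 1)) = Suc (nat (ht x - c))" by simp
  then show ?thesis by (simp add: anc_def)
qed

lemma anc_mono_eq:
  assumes "x \<in> V" "y \<in> V" "c \<le> c'" "c' \<le> ht x" "c' \<le> ht y" "anc c' x = anc c' y"
  shows "anc c x = anc c y"
  by (metis anc_anc assms)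

lemma ex_common_anc:
  assumes "x \<in> V" "y \<in> V"
  shows "\<exists>c. c \<le> ht x \<and> c \<le> ht y \<and> anc c x = anc c y"
proof -
  obtain i j where ij: "(par ^^ i) x = (par ^^ j) y" using common_anc assms by blast
  then have h: "ht x - int i = ht y - int j"
    using ht_funpow_par assms by metis
  then have "anc (ht x - int i) x = anc (ht x - int i) y"
    unfolding anc_def using ij h by (metis add_diff_cancel_left' diff_add_cancel diff_diff_eq2 nat_int)
  then show ?thesis using h by (intro exI[of _ "ht x - int i"]) auto
qed

text \<open>The height at which the branches of \<open>x\<close> and \<open>y\<close> towards the
  end merge, a Gromov product based at the end. The search for the least descent starts at
  \<open>x\<close>; later arguments go through \<open>le_mt_iff\<close>, which is symmetric.\<close>

definition mt :: "'a \<Rightarrow> 'a \<Rightarrow> int" where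
  "mt x y = ht x - int (LEAST k. ht x - int k \<le> ht y \<and> anc (ht x - int k) x = anc (ht x - int k) y)"

text \<open>Two branches that have merged stay together (\<open>anc_mono_eq\<close>), so the heights
  of common ancestors form a down-set, and \<open>mt x y\<close> is its maximum.\<close>

lemma le_mt_iff:
  assumes "x \<in> V" "y \<in> V"
  shows "c \<le> mt x y \<longleftrightarrow> c \<le> ht x \<and> c \<le> ht y \<and> anc c x = anc c y"
proof -
  let ?P = "\<lambda>k. ht x - int k \<le> ht y \<and> anc (ht x - int k) x = anc (ht x - int k) y"
  obtain c0 where c0: "c0 \<le> ht x" "c0 \<le> ht y" "anc c0 x = anc c0 y"
    using ex_common_anc assms by blast
  have "?P (nat (ht x - c0))" using c0 by simp
  then have L: "?P (Least ?P)" by (rule LeastI)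
  show ?thesis
  proof
    assume "c \<le> mt x y"
    then have le: "c \<le> ht x - int (Least ?P)" by (simp add: mt_def)
    then have "c \<le> ht x" "c \<le> ht y" using L by linarith+
    moreover have "anc c x = anc c y"
      using anc_mono_eq[OF assms le] L by simp
    ultimately show "c \<le> ht x \<and> c \<le> ht y \<and> anc c x = anc c y" by simp
  next
    assume a: "c \<le> ht x \<and> c \<le> ht y \<and> anc c x = anc c y"
    then have "?P (nat (ht x - c))" by simp
    then have "Least ?P \<le> nat (ht x - c)" by (rule Least_le)
    then have "int (Least ?P) \<le> ht x - c" using a by (simp add: le_nat_iff)
    then show "c \<le> mt x y" unfolding mt_def by linarith
  qed
qed

lemma mt_le1: "x \<in> V \<Longrightarrow> y \<in> V \<Longrightarrow> mt x y \<le> ht x"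
  and mt_le2: "x \<in> V \<Longrightarrow> y \<in> V \<Longrightarrow> mt x y \<le> ht y"
  and anc_mt: "x \<in> V \<Longrightarrow> y \<in> V \<Longrightarrow> anc (mt x y) x = anc (mt x y) y"
  using le_mt_iff[of x y "mt x y"] by auto

lemma mt_commute: "x \<in> V \<Longrightarrow> y \<in> V \<Longrightarrow> mt x y = mt y x"
  by (rule antisym) (auto simp: le_mt_iff mt_le1 mt_le2 anc_mt[symmetric] anc_mt)

lemma mt_self [simp]: "x \<in> V \<Longrightarrow> mt x x = ht x"
  by (rule antisym) (auto simp: le_mt_iff mt_le1)

text \<open>The ultrametric inequality of a tree seen from an end. All hyperbolicity used later is
  this inequality, applied in each tree separately.\<close>

lemma mt_ultra: "x \<in> V \<Longrightarrow> y \<in> V \<Longrightarrow> z \<in> V \<Longrightarrow> c \<le> mt x y \<Longrightarrow> c \<le> mt y z \<Longrightarrow> c \<le> mt x z"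
  by (simp add: le_mt_iff)

definition td :: "'a \<Rightarrow> 'a \<Rightarrow> int" where
  "td x y = ht x + ht y - 2 * mt x y"

lemma td_commute: "x \<in> V \<Longrightarrow> y \<in> V \<Longrightarrow> td x y = td y x"
  by (simp add: td_def mt_commute)

lemma td_self [simp]: "x \<in> V \<Longrightarrow> td x x = 0"
  by (simp add: td_def)

lemma td_ge: "x \<in> V \<Longrightarrow> y \<in> V \<Longrightarrow> \<bar>ht x - ht y\<bar> \<le> td x y"
  using mt_le1[of x y] mt_le2[of x y] by (auto simp: td_def)

lemma td_nonneg: "x \<in> V \<Longrightarrow> y \<in> V \<Longrightarrow> 0 \<le> td x y"
  using td_ge by fastforce

lemma td_triangle:
  assumes "x \<in> V" "y \<in> V" "z \<in> V" shows "td x z \<le> td x y + td y z"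
proof -
  have "min (mt x y) (mt y z) \<le> mt x z" by (rule mt_ultra[OF assms]) auto
  then show ?thesis
    using mt_le1[OF assms(2,3)] mt_le2[OF assms(1,2)] unfolding td_def by linarith
qed

lemma td_anc: "x \<in> V \<Longrightarrow> c \<le> ht x \<Longrightarrow> td x (anc c x) = ht x - c"
proof -
  assume a: "x \<in> V" "c \<le> ht x"
  have "mt x (anc c x) = c"
  proof (rule antisym)
    show "mt x (anc c x) \<le> c" using mt_le2[of x "anc c x"] a by simp
    show "c \<le> mt x (anc c x)" using a by (simp add: le_mt_iff anc_anc)
  qed
  then show ?thesis using a by (simp add: td_def)
qed

section \<open>Descendants and the growth of balls\<close>

definition desc :: "nat \<Rightarrow> 'a \<Rightarrow> 'a set" where
  "desc k x = {y \<in> V. ht y = ht x + int k \<and> anc (ht x) y = x}"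

lemma descD: "y \<in> desc k x \<Longrightarrow> y \<in> V" "y \<in> desc k x \<Longrightarrow> ht y = ht x + int k"
  "y \<in> desc k x \<Longrightarrow> anc (ht x) y = x"
  by (auto simp: desc_def)

lemma desc_0: "x \<in> V \<Longrightarrow> desc 0 x = {x}"
  by (auto simp: desc_def) (metis anc_self)

lemma desc_Suc: "x \<in> V \<Longrightarrow> desc (Suc k) x = (\<Union>z\<in>desc k x. {c \<in> V. par c = z})"
proof (intro equalityI subsetI)
  fix y assume x: "x \<in> V" and y: "y \<in> desc (Suc k) x"
  have yV: "y \<in> V" and hy: "ht y = ht x + int (Suc k)" and an: "anc (ht x) y = x"
    using descD[OF y] by auto
  have "par y = anc (ht x + int k) y"
    using par_anc[OF yV order_refl] unfolding anc_self unfolding hy by simp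
  then have "anc (ht x) (par y) = x" using anc_anc[OF yV, of "ht x" "ht x + int k"] hy an by simp
  then have "par y \<in> desc k x" using yV hy by (simp add: desc_def)
  then show "y \<in> (\<Union>z\<in>desc k x. {c \<in> V. par c = z})" using yV by auto
next
  fix y assume x: "x \<in> V" and "y \<in> (\<Union>z\<in>desc k x. {c \<in> V. par c = z})"
  then have y: "y \<in> V" "par y \<in> desc k x" by auto
  then have h: "ht y = ht x + int (Suc k)" using descD(2)[OF y(2)] by simp
  have "par y = anc (ht x + int k) y"
    using par_anc[OF y(1) order_refl] unfolding anc_self unfolding h by simp
  then have "anc (ht x) y = x"
    using anc_anc[OF y(1), of "ht x" "ht x + int k"] descD(3)[OF y(2)] h by simp
  then show "y \<in> desc (Suc k) x" using y h by (simp add: desc_def)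
qed

lemma finite_card_desc: "x \<in> V \<Longrightarrow> finite (desc k x) \<and> card (desc k x) = b ^ k"
proof (induction k)
  case 0 then show ?case by (simp add: desc_0)
next
  case (Suc k)
  then have fin: "finite (desc k x)" and c: "card (desc k x) = b ^ k" by auto
  have sub: "desc k x \<subseteq> V" by (auto simp: desc_def)
  have "card (\<Union>z\<in>desc k x. {c \<in> V. par c = z}) = (\<Sum>z\<in>desc k x. card {c \<in> V. par c = z})"
    using fin sub finite_children by (intro card_UN_disjoint) auto
  also have "\<dots> = (\<Sum>z\<in>desc k x. b)"
    using sub children by (intro sum.cong) auto
  finally show ?case using Suc fin c sub finite_children by (auto simp: desc_Suc)
qed

lemma finite_desc [simp]: "x \<in> V \<Longrightarrow> finite (desc k x)"
  and card_desc [simp]: "x \<in> V \<Longrightarrow> card (desc k x) = b ^ k"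
  using finite_card_desc by auto

lemma desc_ne: "x \<in> V \<Longrightarrow> desc k x \<noteq> {}"
  using card_desc[of x k] b_pos by (metis card.empty not_numeral_le_zero power_eq_0_iff)

lemma anc_desc: "y \<in> desc k x \<Longrightarrow> c \<le> ht x \<Longrightarrow> anc c y = anc c x"
  using anc_anc[of y c "ht x"] descD[of y k x] by simp

lemma anc_mem_desc:
  assumes "y \<in> desc k x" "j \<le> k" shows "anc (ht x + int j) y \<in> desc j x"
  using descD[OF assms(1)] assms(2) by (auto simp: desc_def anc_anc)

lemma mem_desc_anc:
  assumes "y \<in> V" "j \<le> k" shows "y \<in> desc j (anc (ht y - int j) y)"
  using assms by (simp add: desc_def)

lemma mem_desc_anc':
  assumes "y \<in> V" "c \<le> ht y" shows "y \<in> desc (nat (ht y - c)) (anc c y)"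
  using assms by (simp add: desc_def)

lemma desc_desc:
  assumes "y \<in> desc k x" "z \<in> desc j y" shows "z \<in> desc (k + j) x"
  using descD[OF assms(1)] descD[OF assms(2)] anc_desc[OF assms(2), of "ht x"]
  by (simp add: desc_def)

lemma td_le_mem_desc:
  assumes "x \<in> V" "y \<in> V" "td x y \<le> int k"
  shows "\<exists>i\<le>k. \<exists>j\<le>k. y \<in> desc j (anc (ht x - int i) x)"
proof (intro exI conjI)
  have m: "mt x y \<le> ht x" "mt x y \<le> ht y" "anc (mt x y) x = anc (mt x y) y"
    using mt_le1 mt_le2 anc_mt assms by auto
  show "nat (ht x - mt x y) \<le> k" "nat (ht y - mt x y) \<le> k"
    using assms m by (auto simp: td_def)
  show "y \<in> desc (nat (ht y - mt x y)) (anc (ht x - int (nat (ht x - mt x y))) x)"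
    using m assms mem_desc_anc'[of y "mt x y"] by simp
qed

text \<open>A point of the ball is reached by \<open>i \<le> k\<close> steps to ancestors and
  \<open>j \<le> k\<close> steps to descendants, which gives \<open>(k + 1)^2 * b ^ k\<close>. The
  polynomial factor is absorbed into \<open>4 ^ k\<close>, since a pure power is easier to combine
  later.\<close>

lemma finite_card_td_ball:
  assumes "x \<in> V"
  shows "finite {y \<in> V. td x y \<le> int k}" "card {y \<in> V. td x y \<le> int k} \<le> (4 * b) ^ k"
proof -
  let ?U = "(\<lambda>(i, j). desc j (anc (ht x - int i) x))"
  let ?I = "{..k} \<times> {..k}"
  have sub: "{y \<in> V. td x y \<le> int k} \<subseteq> (\<Union>p\<in>?I. ?U p)"
    using td_le_mem_desc[OF assms] by fastforce
  have fin: "finite (\<Union>p\<in>?I. ?U p)" using assms by auto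
  show "finite {y \<in> V. td x y \<le> int k}" using sub fin finite_subset by blast
  have "card {y \<in> V. td x y \<le> int k} \<le> card (\<Union>p\<in>?I. ?U p)"
    using sub fin by (rule card_mono[rotated])
  also have "\<dots> \<le> (\<Sum>p\<in>?I. card (?U p))" by (rule card_UN_le) auto
  also have "\<dots> \<le> (\<Sum>p\<in>?I. b ^ k)"
    using assms b_pos by (intro sum_mono) (auto intro!: power_increasing)
  also have "\<dots> = Suc k * Suc k * b ^ k" by simp
  also have "\<dots> \<le> 2 ^ k * 2 ^ k * b ^ k"
    by (intro mult_mono) (auto simp: Suc_leI less_exp)
  also have "\<dots> = (4 * b) ^ k" by (simp add: power_mult_distrib flip: power_add mult_2)
     (simp add: power_mult)
  finally show "card {y \<in> V. td x y \<le> int k} \<le> (4 * b) ^ k" .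
qed

end

section \<open>Horocyclic products\<close>

text \<open>At most one interior index remains. The first and the last step are given away because
  later only steps with both ends in the interior of the chain are controlled.\<close>

lemma card_le_3_of_gap:
  assumes "\<And>j k. 0 < j \<Longrightarrow> j < k \<Longrightarrow> Suc k < R \<Longrightarrow> Q j \<Longrightarrow> Q k \<Longrightarrow> False"
  shows "card {j. j < R \<and> Q j} \<le> 3"
proof -
  let ?C = "{j. 0 < j \<and> Suc j < R \<and> Q j}"
  have finC: "finite ?C" by (rule finite_subset[of _ "{..<R}"]) auto
  have "j = k" if "j \<in> ?C" "k \<in> ?C" for j k
    using assms[of j k] assms[of k j] that by (cases j k rule: linorder_cases) auto
  then have C1: "card ?C \<le> 1" using card_le_Suc0_iff_eq[OF finC] by simp
  have "{j. j < R \<and> Q j} \<subseteq> {0, R - 1} \<union> ?C" by auto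
  then have "card {j. j < R \<and> Q j} \<le> card ({0, R - 1} \<union> ?C)"
    using finC by (intro card_mono) simp_all
  also have "\<dots> \<le> card {0, R - 1} + card ?C" by (rule card_Un_le)
  also have "card {0, R - 1} \<le> 2" by (simp add: card_insert_if)
  finally show ?thesis using C1 by linarith
qed

locale dl_space =
  T1: horo_tree V1 par1 ht1 m + T2: horo_tree V2 par2 ht2 n
  for V1 :: "'a set" and par1 ht1 m and V2 :: "'b set" and par2 ht2 n +
  assumes n_less_m: "n < m"
begin

definition X :: "('a \<times> 'b) set" where
  "X = {p. fst p \<in> V1 \<and> snd p \<in> V2 \<and> ht1 (fst p) + ht2 (snd p) = 0}"

definition h :: "'a \<times> 'b \<Rightarrow> int" where "h p = ht1 (fst p)"

text \<open>Not the path metric of the graph but comparable to it. On \<open>X\<close> the heights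
  cancel, so \<open>rho\<close> is minus twice the sum of the two meeting heights; a vertical step
  has length 2.\<close>

definition rho :: "'a \<times> 'b \<Rightarrow> 'a \<times> 'b \<Rightarrow> int" where
  "rho p q = T1.td (fst p) (fst q) + T2.td (snd p) (snd q)"

text \<open>Each tree distance is at least the height difference, so \<open>e\<close> bounds the
  excess over a vertical geodesic. Whether \<open>q\<close> lies above or below \<open>p\<close> is
  left open.\<close>

definition vert :: "int \<Rightarrow> 'a \<times> 'b \<Rightarrow> 'a \<times> 'b \<Rightarrow> bool" where
  "vert e p q \<longleftrightarrow> T1.td (fst p) (fst q) \<le> \<bar>h p - h q\<bar> + e \<and> T2.td (snd p) (snd q) \<le> \<bar>h p - h q\<bar> + e"

lemma XD: "p \<in> X \<Longrightarrow> fst p \<in> V1" "p \<in> X \<Longrightarrow> snd p \<in> V2" "p \<in> X \<Longrightarrow> ht1 (fst p) = h p"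
    "p \<in> X \<Longrightarrow> ht2 (snd p) = - h p"
  by (auto simp: X_def h_def)

lemma n_pos: "2 \<le> n" and m_pos: "2 \<le> m" using T1.b_pos T2.b_pos by auto

lemma rho_commute: "p \<in> X \<Longrightarrow> q \<in> X \<Longrightarrow> rho p q = rho q p"
  by (simp add: rho_def T1.td_commute T2.td_commute XD)

lemma rho_self [simp]: "p \<in> X \<Longrightarrow> rho p p = 0"
  by (simp add: rho_def XD)

lemma rho_triangle: "p \<in> X \<Longrightarrow> q \<in> X \<Longrightarrow> r \<in> X \<Longrightarrow> rho p r \<le> rho p q + rho q r"
  using T1.td_triangle[of "fst p" "fst q" "fst r"] T2.td_triangle[of "snd p" "snd q" "snd r"]
  by (simp add: rho_def XD)

lemma td1_ge_h: "p \<in> X \<Longrightarrow> q \<in> X \<Longrightarrow> \<bar>h p - h q\<bar> \<le> T1.td (fst p) (fst q)"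
  using T1.td_ge[of "fst p" "fst q"] by (simp add: XD)

lemma td2_ge_h: "p \<in> X \<Longrightarrow> q \<in> X \<Longrightarrow> \<bar>h p - h q\<bar> \<le> T2.td (snd p) (snd q)"
  using T2.td_ge[of "snd p" "snd q"] by (simp add: XD)

lemma rho_ge_h: "p \<in> X \<Longrightarrow> q \<in> X \<Longrightarrow> 2 * \<bar>h p - h q\<bar> \<le> rho p q"
  using td1_ge_h[of p q] td2_ge_h[of p q] by (simp add: rho_def)

lemma rho_nonneg: "p \<in> X \<Longrightarrow> q \<in> X \<Longrightarrow> 0 \<le> rho p q"
  by (rule order_trans[OF _ rho_ge_h]) simp_all

lemma vert_rho: "vert e p q \<Longrightarrow> rho p q \<le> 2 * \<bar>h p - h q\<bar> + 2 * e"
  by (simp add: vert_def rho_def)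

text \<open>Growth rate of balls in \<open>X\<close>: the product of the bases \<open>4 * m\<close>
  and \<open>4 * n\<close> from the two trees.\<close>

definition gam :: nat where "gam = 16 * m * n"

lemma finite_card_ball:
  assumes "p \<in> X"
  shows "finite {q \<in> X. rho p q \<le> int k}" "card {q \<in> X. rho p q \<le> int k} \<le> gam ^ k"
proof -
  let ?B1 = "{x \<in> V1. T1.td (fst p) x \<le> int k}" and ?B2 = "{x \<in> V2. T2.td (snd p) x \<le> int k}"
  have p: "fst p \<in> V1" "snd p \<in> V2" using assms XD by auto
  have sub: "{q \<in> X. rho p q \<le> int k} \<subseteq> ?B1 \<times> ?B2"
  proof
    fix q assume "q \<in> {q \<in> X. rho p q \<le> int k}"
    then have q: "q \<in> X" "rho p q \<le> int k" by auto
    then show "q \<in> ?B1 \<times> ?B2"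
      using T1.td_nonneg[of "fst p" "fst q"] T2.td_nonneg[of "snd p" "snd q"] p XD[OF q(1)]
      by (cases q) (auto simp: rho_def)
  qed
  have fin: "finite (?B1 \<times> ?B2)" using T1.finite_card_td_ball T2.finite_card_td_ball p by simp
  show "finite {q \<in> X. rho p q \<le> int k}" using sub fin finite_subset by blast
  have "card {q \<in> X. rho p q \<le> int k} \<le> card (?B1 \<times> ?B2)" by (rule card_mono[OF fin sub])
  also have "\<dots> \<le> (4 * m) ^ k * (4 * n) ^ k"
    unfolding card_cartesian_product using T1.finite_card_td_ball T2.finite_card_td_ball p by (intro mult_mono) auto
  also have "\<dots> = ((4 * m) * (4 * n)) ^ k" by (rule power_mult_distrib[symmetric])
  also have "(4 * m) * (4 * n) = gam" by (simp add: gam_def)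
  finally show "card {q \<in> X. rho p q \<le> int k} \<le> gam ^ k" .
qed

text \<open>The vertical geodesic through the pair of branches ending at \<open>u\<close> (top) and \<open>v\<close> (bottom).\<close>

definition line :: "'a \<Rightarrow> 'b \<Rightarrow> int \<Rightarrow> 'a \<times> 'b" where
  "line u v c = (T1.anc c u, T2.anc (- c) v)"

lemma line_in: "u \<in> V1 \<Longrightarrow> v \<in> V2 \<Longrightarrow> c \<le> ht1 u \<Longrightarrow> - ht2 v \<le> c \<Longrightarrow> line u v c \<in> X"
  by (simp add: line_def X_def)

lemma h_line: "u \<in> V1 \<Longrightarrow> c \<le> ht1 u \<Longrightarrow> h (line u v c) = c"
  by (simp add: line_def h_def)

lemma rho_line_aux:
  assumes "u \<in> V1" "v \<in> V2" "c \<le> c'" "c' \<le> ht1 u" "- ht2 v \<le> c"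
  shows "rho (line u v c) (line u v c') = 2 * (c' - c)"
proof -
  have "T1.td (T1.anc c' u) (T1.anc c (T1.anc c' u)) = c' - c"
    using assms T1.td_anc[of "T1.anc c' u" c] by simp
  moreover have "T2.td (T2.anc (- c) v) (T2.anc (- c') (T2.anc (- c) v)) = c' - c"
    using assms T2.td_anc[of "T2.anc (- c) v" "- c'"] by simp
  ultimately show ?thesis
    using assms by (simp add: rho_def line_def T1.anc_anc T2.anc_anc T1.td_commute)
qed

lemma rho_line:
  assumes "u \<in> V1" "v \<in> V2" "c \<le> ht1 u" "- ht2 v \<le> c" "c' \<le> ht1 u" "- ht2 v \<le> c'"
  shows "rho (line u v c) (line u v c') = 2 * \<bar>c' - c\<bar>"
proof (cases "c \<le> c'")
  case True then show ?thesis using rho_line_aux assms by simp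
next
  case False
  then show ?thesis
    using rho_line_aux[of u v c' c] assms rho_commute line_in by simp
qed

text \<open>The coarse inverse is carried along and \<open>K\<close> serves as multiplicative and
  additive constant. The notion is symmetric in the two maps, so paths can also be pulled back by
  \<open>\<psi>\<close>.\<close>

definition qi :: "int \<Rightarrow> ('a \<times> 'b \<Rightarrow> 'a \<times> 'b) \<Rightarrow> ('a \<times> 'b \<Rightarrow> 'a \<times> 'b) \<Rightarrow> bool" where
  "qi K \<phi> \<psi> \<longleftrightarrow> 1 \<le> K \<and> \<phi> ` X \<subseteq> X \<and> \<psi> ` X \<subseteq> X \<and>
     (\<forall>p\<in>X. \<forall>q\<in>X. rho (\<phi> p) (\<phi> q) \<le> K * (rho p q + 1) \<and> rho (\<psi> p) (\<psi> q) \<le> K * (rho p q + 1)) \<and>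
     (\<forall>p\<in>X. rho (\<phi> (\<psi> p)) p \<le> K \<and> rho (\<psi> (\<phi> p)) p \<le> K)"

lemma qiD:
  assumes "qi K \<phi> \<psi>"
  shows "1 \<le> K" "p \<in> X \<Longrightarrow> \<phi> p \<in> X" "p \<in> X \<Longrightarrow> \<psi> p \<in> X"
    "p \<in> X \<Longrightarrow> q \<in> X \<Longrightarrow> rho (\<phi> p) (\<phi> q) \<le> K * (rho p q + 1)"
    "p \<in> X \<Longrightarrow> q \<in> X \<Longrightarrow> rho (\<psi> p) (\<psi> q) \<le> K * (rho p q + 1)"
    "p \<in> X \<Longrightarrow> rho (\<phi> (\<psi> p)) p \<le> K" "p \<in> X \<Longrightarrow> rho (\<psi> (\<phi> p)) p \<le> K"
  using assms unfolding qi_def by auto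

text \<open>Go to the images, apply \<open>\<psi>\<close> and return: the Lipschitz bound of
  \<open>\<psi>\<close> adds \<open>K\<close>, and so does each of the two returns, whence the
  3.\<close>

lemma qi_lower:
  assumes q: "qi K \<phi> \<psi>" and "p \<in> X" "q \<in> X"
  shows "rho p q \<le> K * (rho (\<phi> p) (\<phi> q) + 3)"
proof -
  note [simp] = qiD(2,3)[OF q] assms(2,3)
  have "rho p q \<le> rho p (\<psi> (\<phi> p)) + (rho (\<psi> (\<phi> p)) (\<psi> (\<phi> q)) + rho (\<psi> (\<phi> q)) q)"
    using rho_triangle[of p "\<psi> (\<phi> p)" q] rho_triangle[of "\<psi> (\<phi> p)" "\<psi> (\<phi> q)" q] by simp
  moreover have "rho p (\<psi> (\<phi> p)) \<le> K" using qiD(7)[OF q, of p] rho_commute[of p "\<psi> (\<phi> p)"] by simp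
  moreover have "rho (\<psi> (\<phi> p)) (\<psi> (\<phi> q)) \<le> K * (rho (\<phi> p) (\<phi> q) + 1)"
    using qiD(5)[OF q] by simp
  moreover have "rho (\<psi> (\<phi> q)) q \<le> K" using qiD(7)[OF q] by simp
  ultimately show ?thesis by (simp add: algebra_simps)
qed

lemma qi_fibre:
  assumes q: "qi K \<phi> \<psi>" and z: "z \<in> X"
  shows "finite {p \<in> X. rho (\<phi> p) z \<le> int s}"
    "card {p \<in> X. rho (\<phi> p) z \<le> int s} \<le> gam ^ (nat K * (2 * s + 3))"
proof -
  let ?F = "{p \<in> X. rho (\<phi> p) z \<le> int s}"
  have K: "1 \<le> K" using qiD(1)[OF q] .
  have "finite ?F \<and> card ?F \<le> gam ^ (nat K * (2 * s + 3))"
  proof (cases "?F = {}")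
    case True then show ?thesis by (simp only: True) simp
  next
    case False
    then obtain p0 where p0: "p0 \<in> X" "rho (\<phi> p0) z \<le> int s" by auto
    let ?B = "{p \<in> X. rho p0 p \<le> int (nat K * (2 * s + 3))}"
    have "?F \<subseteq> ?B"
    proof
      fix p assume "p \<in> ?F"
      then have p: "p \<in> X" "rho (\<phi> p) z \<le> int s" by auto
      have "rho (\<phi> p0) (\<phi> p) \<le> rho (\<phi> p0) z + rho z (\<phi> p)"
        using rho_triangle z p0 p qiD[OF q] by simp
      also have "rho z (\<phi> p) = rho (\<phi> p) z" using rho_commute z p qiD[OF q] by simp
      finally have "rho (\<phi> p0) (\<phi> p) \<le> 2 * int s" using p p0 by simp
      then have "K * (rho (\<phi> p0) (\<phi> p) + 3) \<le> K * (2 * int s + 3)"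
        using K by (intro mult_left_mono) auto
      then have "rho p0 p \<le> K * (2 * int s + 3)"
        using qi_lower[OF q p0(1) p(1)] by simp
      then show "p \<in> ?B" using p K by simp
    qed
    then show ?thesis using finite_card_ball[OF p0(1), of "nat K * (2 * s + 3)"]
      by (meson card_mono finite_subset le_trans)
  qed
  then show "finite ?F" "card ?F \<le> gam ^ (nat K * (2 * s + 3))" by auto
qed

text \<open>A chain of points is efficient when its total length exceeds the distance of its endpoints
  by little. In each tree, every point of an efficient chain is then almost an ancestor of one of
  the two endpoints; if in both trees this were the same endpoint, the point would be close to it.
  So the chain stays near one of two vertical lines, and it changes line at most once.\<close>

lemma efficient_chain_nonvert:
  assumes pX: "\<And>j. j \<le> R \<Longrightarrow> p j \<in> X"
    and eff: "(\<Sum>j<R. rho (p j) (p (Suc j))) - rho (p 0) (p R) \<le> d"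
    and sep: "\<And>i j. i < j \<Longrightarrow> j \<le> R \<Longrightarrow> 4 * d < rho (p i) (p j)"
    and d: "0 \<le> d"
  shows "card {j. j < R \<and> \<not> vert (4 * d) (p j) (p (Suc j))} \<le> 3"
proof -
  have part: "rho (p i) (p k) \<le> (\<Sum>j\<in>{i..<k}. rho (p j) (p (Suc j)))" if "i \<le> k" "k \<le> R" for i k
    using that
  proof (induction k)
    case 0 then show ?case using pX by simp
  next
    case (Suc k)
    show ?case
    proof (cases "i = Suc k")
      case True then show ?thesis using pX Suc by simp
    next
      case False
      then have "rho (p i) (p (Suc k)) \<le> rho (p i) (p k) + rho (p k) (p (Suc k))"
        using Suc pX by (intro rho_triangle) auto
      then show ?thesis using Suc False by (simp add: sum.atLeastLessThan_Suc)
    qed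
  qed
  \<comment> \<open>Excess over the distance of the endpoints only grows when a chain is extended or
    refined, so every triple of the chain inherits the bound \<open>d\<close>.\<close>
  have triple: "rho (p i) (p j) + rho (p j) (p k) - rho (p i) (p k) \<le> d"
    if "i \<le> j" "j \<le> k" "k \<le> R" for i j k
  proof -
    let ?S = "\<lambda>a b. \<Sum>j\<in>{a..<b}. rho (p j) (p (Suc j))"
    have "?S 0 i + ?S i j = ?S 0 j" "?S 0 j + ?S j k = ?S 0 k" "?S 0 k + ?S k R = ?S 0 R"
      using that by (auto intro: sum.atLeastLessThan_concat)
    moreover have "(\<Sum>j<R. rho (p j) (p (Suc j))) = ?S 0 R" by (simp add: lessThan_atLeast0)
    ultimately have "(\<Sum>j<R. rho (p j) (p (Suc j))) = ?S 0 i + ?S i j + ?S j k + ?S k R" by linarith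
    then have "rho (p 0) (p i) + rho (p i) (p j) + rho (p j) (p k) + rho (p k) (p R) - rho (p 0) (p R) \<le> d"
      using part[of 0 i] part[of i j] part[of j k] part[of k R] that eff by linarith
    moreover have "rho (p 0) (p R) \<le> rho (p 0) (p i) + (rho (p i) (p k) + rho (p k) (p R))"
      using rho_triangle[of "p 0" "p i" "p R"] rho_triangle[of "p i" "p k" "p R"] pX that by simp
    ultimately show ?thesis by linarith
  qed
  define M where "M i j = T1.mt (fst (p i)) (fst (p j))" for i j
  define N where "N i j = T2.mt (snd (p i)) (snd (p j))" for i j
  define H where "H i = h (p i)" for i
  have f: "fst (p j) \<in> V1" "snd (p j) \<in> V2" "ht1 (fst (p j)) = H j" "ht2 (snd (p j)) = - H j" if "j \<le> R" for j
    using XD[OF pX[OF that]] by (auto simp: H_def)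
  have td: "T1.td (fst (p i)) (fst (p j)) = H i + H j - 2 * M i j"
           "T2.td (snd (p i)) (snd (p j)) = - H i - H j - 2 * N i j" if "i \<le> R" "j \<le> R" for i j
    using f that by (auto simp: T1.td_def T2.td_def M_def N_def)
  have rho': "rho (p i) (p j) = - 2 * M i j - 2 * N i j" if "i \<le> R" "j \<le> R" for i j
    using td[OF that] by (simp add: rho_def)
  have Mle: "M i j \<le> H i" "M i j \<le> H j" "N i j \<le> - H i" "N i j \<le> - H j" if "i \<le> R" "j \<le> R" for i j
    using f that T1.mt_le1[of "fst (p i)" "fst (p j)"] T1.mt_le2[of "fst (p i)" "fst (p j)"]
      T2.mt_le1[of "snd (p i)" "snd (p j)"] T2.mt_le2[of "snd (p i)" "snd (p j)"]
    by (auto simp: M_def N_def)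
  have Mu: "c \<le> M i k" if "c \<le> M i j" "c \<le> M j k" "i \<le> R" "j \<le> R" "k \<le> R" for c i j k
    using T1.mt_ultra f that unfolding M_def by blast
  have Nu: "c \<le> N i k" if "c \<le> N i j" "c \<le> N j k" "i \<le> R" "j \<le> R" "k \<le> R" for c i j k
    using T2.mt_ultra f that unfolding N_def by blast
  have Mc: "M i j = M j i" "N i j = N j i" if "i \<le> R" "j \<le> R" for i j
    using f that T1.mt_commute T2.mt_commute unfolding M_def N_def by auto
  \<comment> \<open>The excess of a triple is the sum of one non-negative excess per tree, so each
    of them is at most \<open>d\<close>. By the ultrametric inequality \<open>p j\<close> is then,
    up to \<open>d\<close>, an ancestor of \<open>p i\<close> or of \<open>p k\<close> in that
    tree.\<close>
  have tri1: "H j - d \<le> M i j \<or> H j - d \<le> M j k" and tri2: "- H j - d \<le> N i j \<or> - H j - d \<le> N j k"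
    if "i \<le> j" "j \<le> k" "k \<le> R" for i j k
  proof -
    have le: "i \<le> R" "j \<le> R" "k \<le> R" using that by auto
    have a: "- M i j - N i j - M j k - N j k + M i k + N i k \<le> d"
      using triple[OF that] rho' le d by simp
    have b1: "min (M i j) (M j k) \<le> M i k" using Mu[of _ i j k] le by simp
    have b2: "min (N i j) (N j k) \<le> N i k" using Nu[of _ i j k] le by simp
    show "H j - d \<le> M i j \<or> H j - d \<le> M j k"
      using a b1 b2 Mle[of i j] Mle[of j k] le by linarith
    show "- H j - d \<le> N i j \<or> - H j - d \<le> N j k"
      using a b1 b2 Mle[of i j] Mle[of j k] le by linarith
  qed
  \<comment> \<open>Type \<open>I\<close>: near the vertical line with first coordinate from
    \<open>p 0\<close> and second coordinate from \<open>p R\<close>. Type \<open>J\<close>: near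
    the line with these roles exchanged.\<close>
  define I where "I e j \<longleftrightarrow> H j - e \<le> M 0 j \<and> - H j - e \<le> N j R" for e j
  define J where "J e j \<longleftrightarrow> H j - e \<le> M j R \<and> - H j - e \<le> N 0 j" for e j
  have excl: "\<not> (H j - d \<le> M i j \<and> - H j - d \<le> N i j)" if "i \<le> R" "j \<le> R" "i \<noteq> j" for i j
  proof
    assume "H j - d \<le> M i j \<and> - H j - d \<le> N i j"
    then have "rho (p i) (p j) \<le> 4 * d" using rho'[OF that(1,2)] by simp
    moreover have "rho (p i) (p j) = rho (p j) (p i)" using rho_commute pX that by simp
    ultimately show False using sep[of i j] sep[of j i] that by (cases "i < j") auto
  qed
  have IJ: "I d j \<or> J d j" if "0 < j" "j < R" for j
  proof -
    have t: "H j - d \<le> M 0 j \<or> H j - d \<le> M j R" "- H j - d \<le> N 0 j \<or> - H j - d \<le> N j R"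
      using that by (intro tri1 tri2; simp)+
    have e1: "\<not> (H j - d \<le> M 0 j \<and> - H j - d \<le> N 0 j)" using that by (intro excl) simp_all
    have "\<not> (H j - d \<le> M R j \<and> - H j - d \<le> N R j)" using that by (intro excl) simp_all
    then have e2: "\<not> (H j - d \<le> M j R \<and> - H j - d \<le> N j R)" using Mc[of j R] that by simp
    show ?thesis using t e1 e2 unfolding I_def J_def by blast
  qed
  have I_mono: "I e j \<Longrightarrow> e \<le> e' \<Longrightarrow> I e' j" and J_mono: "J e j \<Longrightarrow> e \<le> e' \<Longrightarrow> J e' j" for e e' j
    by (auto simp: I_def J_def)
  have vI: "vert (4 * d) (p i) (p j)" if "I (2 * d) i" "I (2 * d) j" "i \<le> R" "j \<le> R" for i j
  proof -
    have a: "H i - 2 * d \<le> M i 0" "H j - 2 * d \<le> M 0 j" "- H i - 2 * d \<le> N i R" "- H j - 2 * d \<le> N R j"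
      using that Mc[of 0 i] Mc[of j R] unfolding I_def by auto
    have "min (H i - 2 * d) (H j - 2 * d) \<le> M i j"
      using a that by (intro Mu[of _ i 0 j]) (simp_all add: min_le_iff_disj)
    moreover have "min (- H i - 2 * d) (- H j - 2 * d) \<le> N i j"
      using a that by (intro Nu[of _ i R j]) (simp_all add: min_le_iff_disj)
    ultimately show ?thesis using td[OF that(3,4)] unfolding vert_def H_def by linarith
  qed
  have vJ: "vert (4 * d) (p i) (p j)" if "J (2 * d) i" "J (2 * d) j" "i \<le> R" "j \<le> R" for i j
  proof -
    have a: "H i - 2 * d \<le> M i R" "H j - 2 * d \<le> M R j" "- H i - 2 * d \<le> N i 0" "- H j - 2 * d \<le> N 0 j"
      using that Mc[of 0 i] Mc[of j R] unfolding J_def by auto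
    have "min (H i - 2 * d) (H j - 2 * d) \<le> M i j"
      using a that by (intro Mu[of _ i R j]) (simp_all add: min_le_iff_disj)
    moreover have "min (- H i - 2 * d) (- H j - 2 * d) \<le> N i j"
      using a that by (intro Nu[of _ i 0 j]) (simp_all add: min_le_iff_disj)
    ultimately show ?thesis using td[OF that(3,4)] unfolding vert_def H_def by linarith
  qed
  have between: "(H j - d \<le> M i j \<and> - H j - d \<le> N j k) \<or> (H j - d \<le> M j k \<and> - H j - d \<le> N i j)"
    if "i < j" "j < k" "k \<le> R" for i j k
  proof -
    have t: "H j - d \<le> M i j \<or> H j - d \<le> M j k" "- H j - d \<le> N i j \<or> - H j - d \<le> N j k"
      using that by (intro tri1 tri2; simp)+
    have e1: "\<not> (H j - d \<le> M i j \<and> - H j - d \<le> N i j)" using that by (intro excl) simp_all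
    have "\<not> (H j - d \<le> M k j \<and> - H j - d \<le> N k j)" using that by (intro excl) simp_all
    then have e2: "\<not> (H j - d \<le> M j k \<and> - H j - d \<le> N j k)" using Mc[of j k] that by simp
    show ?thesis using t e1 e2 by blast
  qed
  \<comment> \<open>Indices of one type form an interval, at the price of doubling the
    tolerance.\<close>
  have I_hull: "I (2 * d) j" if ik: "I d i" "I d k" and "i < j" "j < k" "k \<le> R" for i j k
  proof -
    have le: "i \<le> R" "j \<le> R" "k \<le> R" using that by auto
    have "H j - 2 * d \<le> M 0 j"
      using between[OF that(3-5)]
    proof
      assume a: "H j - d \<le> M i j \<and> - H j - d \<le> N j k"
      then show ?thesis using ik Mle(1)[OF le(1,2)] d le by (intro Mu[of _ 0 i j]) (auto simp: I_def)
    next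
      assume a: "H j - d \<le> M j k \<and> - H j - d \<le> N i j"
      then show ?thesis using ik Mle(2)[OF le(2,3)] d le Mc[of j k] by (intro Mu[of _ 0 k j]) (auto simp: I_def)
    qed
    moreover have "- H j - 2 * d \<le> N j R"
      using between[OF that(3-5)]
    proof
      assume a: "H j - d \<le> M i j \<and> - H j - d \<le> N j k"
      then show ?thesis using ik Mle(4)[OF le(2,3)] d le by (intro Nu[of _ j k R]) (auto simp: I_def)
    next
      assume a: "H j - d \<le> M j k \<and> - H j - d \<le> N i j"
      then show ?thesis using ik Mle(3)[OF le(1,2)] d le Mc[of i j] by (intro Nu[of _ j i R]) (auto simp: I_def)
    qed
    ultimately show ?thesis by (simp add: I_def)
  qed
  have J_hull: "J (2 * d) j" if ik: "J d i" "J d k" and "i < j" "j < k" "k \<le> R" for i j k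
  proof -
    have le: "i \<le> R" "j \<le> R" "k \<le> R" using that by auto
    have "H j - 2 * d \<le> M j R"
      using between[OF that(3-5)]
    proof
      assume a: "H j - d \<le> M i j \<and> - H j - d \<le> N j k"
      then show ?thesis using ik Mle(1)[OF le(1,2)] d le Mc[of i j] by (intro Mu[of _ j i R]) (auto simp: J_def)
    next
      assume a: "H j - d \<le> M j k \<and> - H j - d \<le> N i j"
      then show ?thesis using ik Mle(2)[OF le(2,3)] d le by (intro Mu[of _ j k R]) (auto simp: J_def)
    qed
    moreover have "- H j - 2 * d \<le> N 0 j"
      using between[OF that(3-5)]
    proof
      assume a: "H j - d \<le> M i j \<and> - H j - d \<le> N j k"
      then show ?thesis using ik Mle(4)[OF le(2,3)] d le Mc[of j k] by (intro Nu[of _ 0 k j]) (auto simp: J_def)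
    next
      assume a: "H j - d \<le> M j k \<and> - H j - d \<le> N i j"
      then show ?thesis using ik Mle(3)[OF le(1,2)] d le by (intro Nu[of _ 0 i j]) (auto simp: J_def)
    qed
    ultimately show ?thesis by (simp add: J_def)
  qed
  show ?thesis
  proof (rule card_le_3_of_gap)
    fix j k assume le: "0 < j" "j < k" "Suc k < R"
      and nv: "\<not> vert (4 * d) (p j) (p (Suc j))" "\<not> vert (4 * d) (p k) (p (Suc k))"
    have d2: "d \<le> 2 * d" using d by simp
    have nI1: "\<not> (I d j \<and> I (2*d) (Suc j))"
      using nv(1) vI[OF I_mono[OF _ d2], of j "Suc j"] le by (meson Suc_lessD less_imp_le less_trans_Suc Suc_leI)
    have nI2: "\<not> (I (2*d) k \<and> I d (Suc k))"
      using nv(2) vI[OF _ I_mono[OF _ d2], of k "Suc k"] le by linarith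
    have nI3: "\<not> (J d j \<and> J (2*d) (Suc j))"
      using nv(1) vJ[OF J_mono[OF _ d2], of j "Suc j"] le by (meson Suc_lessD less_imp_le less_trans_Suc Suc_leI)
    have nI4: "\<not> (J (2*d) k \<and> J d (Suc k))"
      using nv(2) vJ[OF _ J_mono[OF _ d2], of k "Suc k"] le by linarith
    note nI = nI1 nI2 nI3 nI4
    have nI': "\<not> (I d j \<and> I d (Suc j))" "\<not> (I d k \<and> I d (Suc k))"
       "\<not> (J d j \<and> J d (Suc j))" "\<not> (J d k \<and> J d (Suc k))"
      using nI I_mono[OF _ d2] J_mono[OF _ d2] by blast+
    have or: "I d j \<or> J d j" "I d (Suc j) \<or> J d (Suc j)" "I d k \<or> J d k" "I d (Suc k) \<or> J d (Suc k)"
      using le by (intro IJ; linarith)+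
    have hI: "I d j \<Longrightarrow> I d k \<Longrightarrow> Suc j < k \<Longrightarrow> I (2*d) (Suc j)" by (rule I_hull[of j k]) (use le in linarith)+
    have hJ: "J d j \<Longrightarrow> J d k \<Longrightarrow> Suc j < k \<Longrightarrow> J (2*d) (Suc j)" by (rule J_hull[of j k]) (use le in linarith)+
    have hI': "I d j \<Longrightarrow> I d (Suc k) \<Longrightarrow> I (2*d) k" by (rule I_hull[of j "Suc k"]) (use le in linarith)+
    have hJ': "J d j \<Longrightarrow> J d (Suc k) \<Longrightarrow> J (2*d) k" by (rule J_hull[of j "Suc k"]) (use le in linarith)+
    \<comment> \<open>A step that is not vertical switches between the types. With two such steps,
      the hull of one type reaches the far end of step \<open>j\<close> or the near end of step
      \<open>k\<close>, and makes that step vertical after all.\<close>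
    show False
    proof (cases "I d j")
      case True
      then have *: "\<not> I d (Suc j)" using nI'(1) by blast
      show False
      proof (cases "I d k")
        case True2: True
        then have "Suc j \<noteq> k" using * by auto
        then have "I (2 * d) (Suc j)" using hI True True2 le by simp
        then show False using nI1 True by blast
      next
        case False
        then have "I d (Suc k)" using nI'(4) or by blast
        then show False using hI'[OF True] nI2 by blast
      qed
    next
      case False
      then have J: "J d j" using or by blast
      then have *: "\<not> J d (Suc j)" using nI'(3) by blast
      show False
      proof (cases "J d k")
        case True2: True
        then have "Suc j \<noteq> k" using * by auto
        then have "J (2 * d) (Suc j)" using hJ J True2 le by simp
        then show False using nI3 J by blast
      next
        case False
        then have "J d (Suc k)" using nI'(2) or by blast
        then show False using hJ'[OF J] nI4 by blast
      qed
    qed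
  qed
qed

end

section \<open>Coarse differentiation\<close>

lemma card_filter_lessThan: "card {j. j < (n::nat) \<and> Q j} = (\<Sum>j<n. of_bool (Q j))"
proof -
  have "{j. j < n \<and> Q j} = {..<n} \<inter> {j. Q j}" by auto
  then show ?thesis by (simp add: sum.If_cases of_bool_def)
qed

lemma sum_group_shift:
  fixes g :: "nat \<Rightarrow> 'x :: comm_monoid_add"
  shows "(\<Sum>j<N * R. g j) = (\<Sum>J<N. \<Sum>l<R. g (J * R + l))"
proof -
  have "sum g {J * R..<J * R + R} = (\<Sum>l<R. g (J * R + l))" for J
    using sum.shift_bounds_nat_ivl[of g 0 "J * R" R] by (simp add: lessThan_atLeast0 add.commute)
  then show ?thesis using sum.nat_group[of g R N] by simp
qed

lemma card_filter_group:
  "card {j. j < (N::nat) * R \<and> Q j} = (\<Sum>J<N. card {l. l < R \<and> Q (J * R + l)})"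
  unfolding card_filter_lessThan by (rule sum_group_shift)

context dl_space begin

lemma rho_chain:
  assumes "\<And>j. j \<le> N \<Longrightarrow> p j \<in> X"
  shows "rho (p 0) (p N) \<le> (\<Sum>j<N. rho (p j) (p (Suc j)))"
  using assms
proof (induction N)
  case (Suc N)
  then have "rho (p 0) (p (Suc N)) \<le> rho (p 0) (p N) + rho (p N) (p (Suc N))"
    by (intro rho_triangle) auto
  then show ?case using Suc by simp
qed simp

text \<open>Pigeonhole over the scales \<open>r1 * R ^ k\<close>: the total length of the image of a family of vertical
  geodesics, measured in steps of one scale, decreases in the scale, so between some pair of
  consecutive scales it hardly decreases and most image chains are efficient.\<close>

lemma coarse_differentiation:
  fixes K :: int and R M E r1 L :: nat and \<theta> :: real and \<gamma> :: "'i \<Rightarrow> nat \<Rightarrow> 'a \<times> 'b"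
  assumes q: "qi K \<phi> \<psi>"
    and R: "6 \<le> \<theta> * R" and M: "6 * real_of_int K * real R * real E \<le> \<theta> * M" and E: "4 * K \<le> int E"
    and r1: "3 * K < int r1" and \<theta>: "0 < \<theta>"
    and P: "finite P"
    and gX: "\<And>i t. i \<in> P \<Longrightarrow> t \<le> L \<Longrightarrow> \<gamma> i t \<in> X"
    and geo: "\<And>i s t. i \<in> P \<Longrightarrow> s \<le> L \<Longrightarrow> t \<le> L \<Longrightarrow> rho (\<gamma> i s) (\<gamma> i t) = 2 * \<bar>int s - int t\<bar>"
    and L: "r1 * R ^ M dvd L"
  shows "\<exists>k<M. let r = r1 * R ^ k in
    real (\<Sum>i\<in>P. card {j. j < L div r \<and> \<not> vert (4 * int (r div E)) (\<phi> (\<gamma> i (j * r))) (\<phi> (\<gamma> i (Suc j * r)))})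
      \<le> \<theta> * card P * (L div r)"
proof -
  have K: "1 \<le> K" using qiD(1)[OF q] .
  have Rpos: "0 < R" using R by (cases "R = 0") auto
  have Epos: "0 < E" using E K by (cases "E = 0") auto
  have Mpos: "0 < M"
  proof -
    have "0 < 6 * real_of_int K * real R * real E" using K Rpos Epos by simp
    then have "0 < \<theta> * M" using M by linarith
    then show ?thesis using \<theta> by (simp add: zero_less_mult_iff)
  qed
  have r1pos: "0 < r1" using r1 K by linarith
  define r where "r k = r1 * R ^ k" for k
  have rpos: "0 < r k" for k using r1pos Rpos by (simp add: r_def)
  have rge: "r1 \<le> r k" for k using Rpos by (simp add: r_def)
  have rSuc: "r (Suc k) = r k * R" for k by (simp add: r_def)
  define N where "N k = L div r k" for k
  have Ndiv: "N k * r k = L" if "k \<le> M" for k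
  proof -
    have "r k dvd r M" using that by (simp add: r_def le_imp_power_dvd)
    also have "\<dots> dvd L" using L by (simp add: r_def)
    finally have "r k dvd L" .
    then show ?thesis by (simp add: N_def)
  qed
  have NSuc: "N k = N (Suc k) * R" if "k < M" for k
  proof -
    have "N k * r k = (N (Suc k) * R) * r k"
      using Ndiv[of k] Ndiv[of "Suc k"] that by (simp add: rSuc mult_ac)
    then show ?thesis using rpos[of k] by simp
  qed
  define a where "a k i j = \<phi> (\<gamma> i (j * r k))" for k i j
  have jr: "j * r k \<le> L" if "k \<le> M" "j \<le> N k" for j k
    using mult_le_mono1[OF that(2), of "r k"] Ndiv[OF that(1)] by simp
  have aX: "a k i j \<in> X" if "k \<le> M" "i \<in> P" "j \<le> N k" for k i j
    using gX[OF that(2) jr[OF that(1,3)]] qiD(2)[OF q] by (simp add: a_def)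
  define S where "S k = (\<Sum>i\<in>P. \<Sum>j<N k. rho (a k i j) (a k i (Suc j)))" for k
  have S_nonneg: "0 \<le> S k" if "k \<le> M" for k
    unfolding S_def using aX that by (intro sum_nonneg rho_nonneg) auto
  have a_Suc: "a (Suc k) i J = a k i (J * R)" for k i J
    by (simp add: a_def rSuc mult_ac)
  \<comment> \<open>The defect of one block: the length lost when its \<open>R\<close> steps are
    replaced by a single step of the next scale.\<close>
  define def where "def k i J = (\<Sum>l<R. rho (a k i (J * R + l)) (a k i (J * R + Suc l)))
      - rho (a k i (J * R)) (a k i (J * R + R))" for k i J
  have S_diff: "S k - S (Suc k) = (\<Sum>i\<in>P. \<Sum>J<N (Suc k). def k i J)" if "k < M" for k
  proof -
    have "S k = (\<Sum>i\<in>P. \<Sum>J<N (Suc k). \<Sum>l<R. rho (a k i (J * R + l)) (a k i (J * R + Suc l)))"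
      unfolding S_def NSuc[OF that] by (subst sum_group_shift) simp
    moreover have "S (Suc k) = (\<Sum>i\<in>P. \<Sum>J<N (Suc k). rho (a k i (J * R)) (a k i (J * R + R)))"
      unfolding S_def a_Suc by (simp add: add.commute)
    ultimately show ?thesis by (simp add: def_def sum_subtractf)
  qed
  have JR: "J * R + l \<le> N k" if "k < M" "J < N (Suc k)" "l \<le> R" for J k l
  proof -
    have "J * R + l \<le> Suc J * R" using that by simp
    also have "\<dots> \<le> N (Suc k) * R" using that by (intro mult_le_mono1) simp
    finally show ?thesis using NSuc[OF that(1)] by simp
  qed
  have def_nonneg: "0 \<le> def k i J" if "k < M" "i \<in> P" "J < N (Suc k)" for k i J
    using rho_chain[of R "\<lambda>l. a k i (J * R + l)"] aX JR that by (simp add: def_def)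
  \<comment> \<open>The drops from scale to scale telescope to at most \<open>S 0\<close>, so one of
    the \<open>M\<close> drops is at most the average.\<close>
  have "\<exists>k<M. M * (S k - S (Suc k)) \<le> S 0"
  proof (rule ccontr)
    assume "\<not> ?thesis"
    then have "S 0 < M * (S k - S (Suc k))" if "k < M" for k using that by auto
    then have "(\<Sum>k<M. S 0) < (\<Sum>k<M. M * (S k - S (Suc k)))"
      using Mpos by (intro sum_strict_mono) auto
    also have "\<dots> = M * (S 0 - S M)"
      using sum_lessThan_telescope'[of S M] by (simp add: sum_distrib_left[symmetric])
    also have "\<dots> \<le> M * S 0" using S_nonneg[of M] by (intro mult_left_mono) auto
    finally show False by simp
  qed
  then obtain k where k: "k < M" "M * (S k - S (Suc k)) \<le> S 0" by blast
  have S0: "S 0 \<le> 3 * K * card P * L"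
  proof -
    have "rho (a 0 i j) (a 0 i (Suc j)) \<le> 3 * K * r 0" if "i \<in> P" "j < N 0" for i j
    proof -
      have "rho (a 0 i j) (a 0 i (Suc j)) \<le> K * (rho (\<gamma> i (j * r 0)) (\<gamma> i (Suc j * r 0)) + 1)"
        unfolding a_def using jr[of 0 j] jr[of 0 "Suc j"] that
        by (intro qiD(4)[OF q] gX) auto
      also have "rho (\<gamma> i (j * r 0)) (\<gamma> i (Suc j * r 0)) = 2 * r 0"
        using jr[of 0 j] jr[of 0 "Suc j"] that by (subst geo) auto
      also have "K * (int (2 * r 0) + 1) \<le> K * (3 * r 0)"
        using K rpos[of 0] by (intro mult_left_mono) auto
      finally show ?thesis by simp
    qed
    then have "S 0 \<le> (\<Sum>i\<in>P. \<Sum>j<N 0. 3 * K * r 0)"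
      unfolding S_def by (intro sum_mono) auto
    also have "\<dots> = 3 * K * card P * int (N 0 * r 0)" by simp
    finally show ?thesis using Ndiv[of 0] by simp
  qed
  let ?r = "r k"
  let ?d = "int (?r div E)"
  let ?Q = "\<lambda>i j. \<not> vert (4 * ?d) (a k i j) (a k i (Suc j))"
  have dE: "real ?r \<le> E * (?d + 1)"
  proof -
    have "?r < E * Suc (?r div E)" using Epos dividend_less_div_times[of E ?r] by (simp add: algebra_simps)
    then have "real ?r < real (E * Suc (?r div E))" by (simp only: of_nat_less_iff)
    then show ?thesis by (simp add: algebra_simps)
  qed
  \<comment> \<open>An efficient block has at most 3 steps that are not vertical. A block of larger
    defect may have \<open>R\<close> of them, but then \<open>E * def / r\<close> is at least 1 and
    pays for all.\<close>
  have piece: "real (card {l. l < R \<and> ?Q i (J * R + l)}) \<le> 3 + R * E * def k i J / ?r"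
    if i: "i \<in> P" and J: "J < N (Suc k)" for i J
  proof (cases "def k i J \<le> ?d")
    case True
    have "card {l. l < R \<and> \<not> vert (4 * ?d) (a k i (J * R + l)) (a k i (J * R + Suc l))} \<le> 3"
    proof (rule efficient_chain_nonvert)
      show "a k i (J * R + j) \<in> X" if "j \<le> R" for j using aX JR k i J that by simp
      show "(\<Sum>j<R. rho (a k i (J * R + j)) (a k i (J * R + Suc j))) - rho (a k i (J * R + 0)) (a k i (J * R + R)) \<le> ?d"
        using True by (simp add: def_def)
      show "4 * ?d < rho (a k i (J * R + u)) (a k i (J * R + v))" if uv: "u < v" "v \<le> R" for u v
      proof -
        let ?u = "(J * R + u) * ?r" and ?v = "(J * R + v) * ?r"
        have le: "?u \<le> L" "?v \<le> L" using jr JR k J uv by auto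
        have "rho (\<gamma> i ?u) (\<gamma> i ?v) \<le> K * (rho (a k i (J * R + u)) (a k i (J * R + v)) + 3)"
          unfolding a_def using le i by (intro qi_lower[OF q] gX) auto
        moreover have "?v = ?u + (v - u) * ?r" using uv by (simp flip: distrib_right)
        then have "int ?u - int ?v = - (int (v - u) * ?r)" by (simp only: of_nat_add of_nat_mult)
        then have "rho (\<gamma> i ?u) (\<gamma> i ?v) = 2 * (int (v - u) * ?r)"
          unfolding geo[OF i le] by simp
        moreover have "?r \<le> (v - u) * ?r" using uv by (simp add: Suc_le_eq)
        then have "int ?r \<le> int (v - u) * ?r" by (simp only: of_nat_le_iff flip: of_nat_mult)
        ultimately have A: "2 * int ?r \<le> K * (rho (a k i (J * R + u)) (a k i (J * R + v)) + 3)" by linarith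
        have "K * (4 * ?d) \<le> int E * ?d" using mult_right_mono[OF E, of ?d] by (simp add: mult_ac)
        also have "\<dots> = int (E * (?r div E))" by (simp only: of_nat_mult)
        also have "\<dots> \<le> int ?r" by (simp only: of_nat_le_iff times_div_less_eq_dividend)
        \<comment> \<open>The bounds \<open>r1 > 3 * K\<close> and \<open>E \<ge> 4 * K\<close> are
          made for this: images of distinct points of a block are more than \<open>4 * d\<close>
          apart, as the chain lemma demands.\<close>
        finally have "K * (4 * ?d + 3) < 2 * int ?r" using r1 rge[of k] K by (simp add: algebra_simps)
        then have "K * (4 * ?d + 3) < K * (rho (a k i (J * R + u)) (a k i (J * R + v)) + 3)" using A by linarith
        then show ?thesis using K by simp
      qed
    qed simp
    moreover have "0 \<le> R * E * def k i J / ?r" using def_nonneg[OF k(1) i J] by simp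
    ultimately show ?thesis by simp
  next
    case False
    then have "?d + 1 \<le> def k i J" by simp
    then have "real_of_int (?d + 1) \<le> real_of_int (def k i J)" by (simp only: of_int_le_iff)
    then have "E * real_of_int (?d + 1) \<le> E * real_of_int (def k i J)" by (intro mult_left_mono) simp_all
    then have "real ?r \<le> real E * real_of_int (def k i J)" using dE by simp
    then have "1 \<le> real E * real_of_int (def k i J) / ?r" using rpos[of k] by simp
    then have "real R * 1 \<le> real R * (real E * real_of_int (def k i J) / ?r)" by (intro mult_left_mono) simp_all
    moreover have "card {l. l < R \<and> ?Q i (J * R + l)} \<le> card {..<R}" by (intro card_mono) auto
    ultimately show ?thesis by simp
  qed
  have "real (\<Sum>i\<in>P. card {j. j < N k \<and> ?Q i j}) = (\<Sum>i\<in>P. \<Sum>J<N (Suc k). real (card {l. l < R \<and> ?Q i (J * R + l)}))"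
    unfolding NSuc[OF k(1)] card_filter_group by simp
  also have "\<dots> \<le> (\<Sum>i\<in>P. \<Sum>J<N (Suc k). 3 + R * E * def k i J / ?r)"
    using piece by (intro sum_mono) auto
  also have "\<dots> = 3 * card P * N (Suc k) + R * E / ?r * (S k - S (Suc k))"
    unfolding S_diff[OF k(1)]
    by (simp add: sum.distrib sum_distrib_left mult_ac)
  also have "\<dots> \<le> \<theta> * card P * N k"
  proof -
    \<comment> \<open>Half of \<open>\<theta>\<close> pays for the 3 exceptional steps of each
      block, the other half for the blocks of large defect.\<close>
    have a: "3 * real (card P) * N (Suc k) \<le> \<theta> / 2 * card P * N k"
    proof -
      have "3 * real (N (Suc k)) \<le> (\<theta> * R / 2) * N (Suc k)" using R by (intro mult_right_mono) auto
      also have "\<dots> = \<theta> / 2 * N k" using NSuc[OF k(1)] by simp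
      finally have "card P * (3 * real (N (Suc k))) \<le> card P * (\<theta> / 2 * N k)"
        by (intro mult_left_mono) simp_all
      then show ?thesis by (simp add: mult_ac)
    qed
    have "M * (S k - S (Suc k)) \<le> 3 * K * card P * (N k * ?r)" using k(2) S0 Ndiv[of k] k(1) by simp
    then have "real_of_int (M * (S k - S (Suc k))) \<le> real_of_int (3 * K * card P * (N k * ?r))"
      by (simp only: of_int_le_iff)
    then have b: "M * real_of_int (S k - S (Suc k)) \<le> 3 * K * card P * N k * ?r" by simp
    have "M * (R * E / ?r * real_of_int (S k - S (Suc k))) = R * E / ?r * (M * real_of_int (S k - S (Suc k)))"
      by simp
    also have "\<dots> \<le> R * E / ?r * (3 * K * card P * N k * ?r)" using b by (intro mult_left_mono) auto
    also have "\<dots> = (6 * real_of_int K * real R * real E) * (card P * N k) / 2" using rpos[of k] by simp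
    also have "\<dots> \<le> (\<theta> * M) * (card P * N k) / 2" using M by (intro divide_right_mono mult_right_mono) auto
    also have "\<dots> = M * (\<theta> / 2 * card P * N k)" by simp
    finally have "R * E / ?r * real_of_int (S k - S (Suc k)) \<le> \<theta> / 2 * card P * N k"
      using Mpos by (simp only: mult_le_cancel_left_pos of_nat_0_less_iff)
    then show ?thesis using a unfolding of_nat_mult of_nat_numeral by linarith
  qed
  finally have "real (\<Sum>i\<in>P. card {j. j < N k \<and> ?Q i j}) \<le> \<theta> * card P * N k" .
  then show ?thesis using k(1) unfolding N_def a_def r_def Let_def by blast
qed

end

section \<open>Quasi-isometries preserve the orientation of most vertical segments\<close>

text \<open>A geometric series of ratio \<open>n / m < 1\<close>, kept in the natural numbers. The
  induction needs the stronger bound with \<open>m * n ^ H\<close> added on the left.\<close>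

lemma geometric_mix_le:
  fixes n m :: nat assumes "n < m"
  shows "(\<Sum>k<H. n ^ k * m ^ (H - k)) \<le> m * m ^ H"
proof -
  have "(\<Sum>k<H. n ^ k * m ^ (H - k)) + m * n ^ H \<le> m * m ^ H"
  proof (induction H)
    case (Suc H)
    have "(\<Sum>k<Suc H. n ^ k * m ^ (Suc H - k)) = m * (\<Sum>k<H. n ^ k * m ^ (H - k)) + m * n ^ H"
      by (simp add: sum_distrib_left Suc_diff_le mult_ac)
    moreover have "m * n ^ H + m * n ^ Suc H = m * n ^ H * (1 + n)" by (simp add: algebra_simps)
    moreover have "m * n ^ H * (1 + n) \<le> m * n ^ H * m" using assms by (intro mult_left_mono) auto
    ultimately have "(\<Sum>k<Suc H. n ^ k * m ^ (Suc H - k)) + m * n ^ Suc H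
        \<le> m * ((\<Sum>k<H. n ^ k * m ^ (H - k)) + m * n ^ H)"
      by (simp add: algebra_simps)
    also have "\<dots> \<le> m * (m * m ^ H)" using Suc by (intro mult_left_mono) auto
    finally show ?case by simp
  qed simp
  then show ?thesis by linarith
qed

lemma ex_exit_step: "P 0 \<Longrightarrow> \<not> P N \<Longrightarrow> \<exists>k<N. P k \<and> \<not> P (Suc k)" for N :: nat
proof (induction N)
  case (Suc N) then show ?case using less_SucI by (cases "P N") blast+
qed simp

lemma card_UN_le_const:
  assumes "finite I" "\<And>i. i \<in> I \<Longrightarrow> card (A i) \<le> k" "card I \<le> c"
  shows "card (\<Union>i\<in>I. A i) \<le> c * k"
proof -
  have "card (\<Union>i\<in>I. A i) \<le> (\<Sum>i\<in>I. card (A i))" by (rule card_UN_le[OF assms(1)])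
  also have "\<dots> \<le> (\<Sum>i\<in>I. k)" using assms(2) by (intro sum_mono) auto
  also have "\<dots> \<le> c * k" using assms(3) by simp
  finally show ?thesis .
qed

section \<open>Counting flipped segments\<close>

context dl_space begin

lemma qi_sym: "qi K \<phi> \<psi> \<Longrightarrow> qi K \<psi> \<phi>"
  unfolding qi_def by blast

text \<open>A move of length \<open>rho p q\<close> cannot leave the cone over an ancestor that lies
  at least that far below \<open>p\<close>; \<open>mt2_ge\<close> is the same in the second
  tree.\<close>

lemma mt1_ge: "p \<in> X \<Longrightarrow> q \<in> X \<Longrightarrow> h p - rho p q \<le> T1.mt (fst p) (fst q)"
  using T1.mt_le2[of "fst p" "fst q"] T2.td_nonneg[of "snd p" "snd q"] XD(3)[of p]
  by (simp add: rho_def T1.td_def XD)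

lemma mt2_ge: "p \<in> X \<Longrightarrow> q \<in> X \<Longrightarrow> - h p - rho p q \<le> T2.mt (snd p) (snd q)"
  using T2.mt_le2[of "snd p" "snd q"] T1.td_nonneg[of "fst p" "fst q"] XD(4)[of p]
  by (simp add: rho_def T2.td_def XD)

text \<open>To be read with \<open>p\<close> the image of the lower end of a vertical segment and
  \<open>q\<close> the image of the upper end.\<close>

definition flip :: "int \<Rightarrow> 'a \<times> 'b \<Rightarrow> 'a \<times> 'b \<Rightarrow> bool" where
  "flip e p q \<longleftrightarrow> vert e p q \<and> h q \<le> h p"

lemma flip_mt:
  assumes "p \<in> X" "q \<in> X" "flip e p q" "0 \<le> e"
  shows "h q - e \<le> T1.mt (fst p) (fst q)" "- h p - e \<le> T2.mt (snd p) (snd q)"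
  using assms XD(3,4)[OF assms(1)] XD(3,4)[OF assms(2)]
  by (auto simp: flip_def vert_def T1.td_def T2.td_def)

text \<open>If the top point \<open>b\<close> of a box is sent below the bottom point \<open>a\<close>, then many top points have
  images on a common fibre of the first tree. Upward paths from these images can be given a common
  endpoint, and pulled back by \<open>\<psi>\<close> all but few of them must leave the cone above the ancestor of
  \<open>b\<close> at depth \<open>D\<close>, through the few points at that level. A random upward path visits each point
  from boundedly many starting points in total, because \<open>n < m\<close>.\<close>

lemma card_flipped_le:
  fixes K e e0 r s L D :: nat and x0 :: 'a and y0 :: 'b and A :: "'a \<Rightarrow> 'b \<Rightarrow> 'b"
    and \<phi> \<psi> :: "'a \<times> 'b \<Rightarrow> 'a \<times> 'b"
  defines "Hm \<equiv> K * (2 * r + 1) + e0 + 2 * e"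
  defines "\<beta> \<equiv> ht1 x0"
  defines "av \<equiv> \<lambda>b. (T1.anc (\<beta> + int s) (fst b), A (T1.anc (\<beta> + int s) (fst b)) (snd b))"
  defines "F \<equiv> {b \<in> T1.desc (s + r) x0 \<times> T2.desc (L - (s + r)) y0. flip (int e) (\<phi> (av b)) (\<phi> b)}"
  assumes q: "qi (int K) \<phi> \<psi>" and x0: "x0 \<in> V1" and y0: "y0 \<in> V2"
    and lev: "ht2 y0 = - (ht1 x0 + int L)"
    and L: "s + r + K * (2 * (e0 + e) + 2) + 3 * K * Hm \<le> L"
    and D: "D \<le> r" "K * (2 * (e0 + e) + 2) < D" and e0: "0 < e0"
    and A: "\<And>x y. x \<in> T1.desc s x0 \<Longrightarrow> y \<in> T2.desc (L - (s + r)) y0 \<Longrightarrow> A x y \<in> T2.desc r y"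
  shows "card F \<le> (K * (2 * r + 1) div e0 + 1) * (m ^ s * n ^ (L - (s + r))) * m ^ D
    + 3 * K * m ^ (3 * K) * (m ^ (s + r - D) * n ^ (L - (s + r) + D)) * gam ^ (3 * K) * gam ^ (K * (4 * (e0 + e) + 3)) * m"
proof -
  note qs = qi_sym[OF q]
  have K1: "1 \<le> K" using qiD(1)[OF q] by simp
  define nb where "nb = K * (2 * r + 1) div e0 + 1"
  \<comment> \<open>The cone of \<open>b\<close> consists of the points whose first coordinate
    descends from the ancestor of \<open>b\<close> at height \<open>l\<close>, that is
    \<open>D\<close> levels below \<open>b\<close>.\<close>
  define l where "l = \<beta> + int (s + r) - int D"
  have Ls: "s + r \<le> L" using L by simp
  let ?Y = "T2.desc (L - (s + r)) y0"
  define I where "I = T1.desc s x0 \<times> ?Y"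
  have finI: "finite I" and cardI: "card I = m ^ s * n ^ (L - (s + r))"
    using x0 y0 by (auto simp: I_def card_cartesian_product)
  have YX: "y \<in> V2" "ht2 y = - (\<beta> + int (s + r))" if "y \<in> ?Y" for y
    using T2.descD(1,2)[OF that] lev Ls by (auto simp: \<beta>_def of_nat_diff)
  have finF: "finite F"
    unfolding F_def by (rule finite_subset[of _ "T1.desc (s + r) x0 \<times> ?Y"]) (use x0 y0 in auto)
  have bX: "b \<in> X" "h b = \<beta> + int (s + r)" "fst b \<in> V1" "snd b \<in> ?Y" "fst b \<in> T1.desc (s + r) x0" if "b \<in> F" for b
    using that YX T1.descD(1,2)[of "fst b" "s + r" x0] unfolding F_def
    by (auto simp: X_def h_def \<beta>_def)
  define qq where "qq b = (T1.anc (\<beta> + int s) (fst b), snd b)" for b :: "'a \<times> 'b"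
  have qI: "qq b \<in> I" if "b \<in> F" for b
    using T1.anc_mem_desc[OF bX(5)[OF that], of s] bX(4)[OF that] by (auto simp: qq_def I_def \<beta>_def)
  have av: "av b = (fst (qq b), A (fst (qq b)) (snd (qq b)))" for b
    by (simp add: av_def qq_def)
  define ap where "ap p = (fst p, A (fst p) (snd p))" for p :: "'a \<times> 'b"
  have av_ap: "av b = ap (qq b)" for b by (simp add: av ap_def)
  have apX: "ap p \<in> X" "h (ap p) = \<beta> + int s" if "p \<in> I" for p
  proof -
    have p: "fst p \<in> T1.desc s x0" "snd p \<in> ?Y" using that by (auto simp: I_def)
    have "A (fst p) (snd p) \<in> T2.desc r (snd p)" using A p by blast
    from T2.descD(1,2)[OF this] T1.descD(1,2)[OF p(1)] YX[OF p(2)]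
    show "ap p \<in> X" "h (ap p) = \<beta> + int s" by (auto simp: ap_def X_def h_def \<beta>_def)
  qed
  have rho_av: "rho (ap (qq b)) b = 2 * int r" if b: "b \<in> F" for b
  proof -
    have a2: "A (fst (qq b)) (snd (qq b)) \<in> T2.desc r (snd b)"
      using A qI[OF b] by (auto simp: I_def qq_def)
    have "T2.td (A (fst (qq b)) (snd b)) (snd b) = int r"
      using T2.td_anc[of "A (fst (qq b)) (snd b)" "ht2 (snd b)"] T2.descD[OF a2] by (simp add: qq_def)
    moreover have "T1.td (fst b) (T1.anc (\<beta> + int s) (fst b)) = int r"
      using T1.td_anc[of "fst b" "\<beta> + int s"] bX[OF b] T1.descD(2)[OF bX(5)[OF b]] by (simp add: \<beta>_def)
    ultimately show ?thesis
      using bX(3)[OF b] by (simp add: rho_def ap_def qq_def T1.td_commute)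
  qed
  have phX: "\<phi> b \<in> X" "\<phi> (ap (qq b)) \<in> X" if "b \<in> F" for b
    using that bX(1) apX(1) qI qiD(2)[OF q] by auto
  define del where "del b = h (\<phi> (ap (qq b))) - h (\<phi> b)" for b
  have fl: "flip (int e) (\<phi> (ap (qq b))) (\<phi> b)" if "b \<in> F" for b
    using that by (simp add: F_def av_ap)
  have del: "0 \<le> del b" "del b \<le> int (K * (2 * r + 1))" if b: "b \<in> F" for b
  proof -
    show "0 \<le> del b" using fl[OF b] by (simp add: del_def flip_def)
    have "2 * \<bar>del b\<bar> \<le> rho (\<phi> (ap (qq b))) (\<phi> b)"
      unfolding del_def by (rule rho_ge_h) (use phX b in auto)
    also have "\<dots> \<le> int K * (rho (ap (qq b)) b + 1)"
      using bX(1) apX(1) qI b by (intro qiD(4)[OF q]) auto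
    finally have "2 * \<bar>del b\<bar> \<le> int (K * (2 * r + 1))"
      using rho_av[OF b] by (simp add: algebra_simps)
    then show "del b \<le> int (K * (2 * r + 1))" by linarith
  qed
  \<comment> \<open>The drop \<open>del b\<close> is rounded to a multiple of \<open>e0\<close>,
    with fewer than \<open>nb\<close> classes in use. From here on everything common to many
    \<open>b\<close> depends on \<open>b\<close> only through \<open>qq b\<close> and
    \<open>ka b\<close>.\<close>
  define ka where "ka b = nat (del b) div e0" for b
  have ka_lt: "ka b < nb" if "b \<in> F" for b
    using del[OF that] unfolding ka_def nb_def by (simp add: div_le_mono nat_le_iff less_Suc_eq_le)
  have ka_b: "int (ka b) * int e0 \<le> del b" "del b < (int (ka b) + 1) * int e0" if "b \<in> F" for b
  proof -
    have d: "int (nat (del b)) = del b" using del that by simp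
    have "ka b * e0 \<le> nat (del b)" by (simp add: ka_def)
    then have "int (ka b * e0) \<le> int (nat (del b))" by (simp only: of_nat_le_iff)
    then show "int (ka b) * int e0 \<le> del b" using d by simp
    have "nat (del b) < (ka b + 1) * e0"
      unfolding ka_def using e0 dividend_less_div_times[of e0 "nat (del b)"] by (simp add: algebra_simps)
    then have "int (nat (del b)) < int ((ka b + 1) * e0)" by (simp only: of_nat_less_iff)
    then show "del b < (int (ka b) + 1) * int e0" using d by (simp add: algebra_simps)
  qed
  \<comment> \<open>This height is at least \<open>e\<close> and at most \<open>e0 + e\<close> below
    the image of \<open>b\<close>. Because the segment is flipped, the first coordinates of the
    images of \<open>b\<close> and of \<open>ap (qq b)\<close> have the same ancestor there, namely
    \<open>xs\<close>.\<close>
  define vv where "vv p k = h (\<phi> (ap p)) - (int k + 1) * int e0 - int e" for p k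
  define xs where "xs p k = T1.anc (vv p k) (fst (\<phi> (ap p)))" for p k
  \<comment> \<open>\<open>Hm\<close> levels higher one is at least \<open>e\<close> above the image
    of \<open>ap p\<close>, where the second coordinates have merged as well. So an upward path ends
    at \<open>(x, ys p k)\<close>, whichever \<open>b\<close> of the class it started from.\<close>
  define ys where "ys p k = T2.anc (- (vv p k + int Hm)) (snd (\<phi> (ap p)))" for p k
  define v where "v b = vv (qq b) (ka b)" for b
  have v: "v b \<le> h (\<phi> b) - int e" "h (\<phi> b) - v b \<le> int (e0 + e)" "h (\<phi> (ap (qq b))) + int e \<le> v b + int Hm"
    if b: "b \<in> F" for b
  proof -
    have "v b = h (\<phi> b) + del b - (int (ka b) + 1) * int e0 - int e"
      by (simp add: v_def vv_def del_def)
    then show "v b \<le> h (\<phi> b) - int e" "h (\<phi> b) - v b \<le> int (e0 + e)"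
      using ka_b[OF b] by (auto simp: algebra_simps)
    have "(int (ka b) + 1) * int e0 \<le> int (K * (2 * r + 1)) + int e0"
      using ka_b(1)[OF b] del(2)[OF b] by (simp add: algebra_simps)
    then show "h (\<phi> (ap (qq b))) + int e \<le> v b + int Hm"
      unfolding v_def vv_def Hm_def by simp
  qed
  have xs_eq: "T1.anc (v b) (fst (\<phi> b)) = xs (qq b) (ka b)"
    and xs_in: "xs (qq b) (ka b) \<in> V1" "ht1 (xs (qq b) (ka b)) = v b" if b: "b \<in> F" for b
  proof -
    note P = phX[OF b]
    have "v b \<le> T1.mt (fst (\<phi> (ap (qq b)))) (fst (\<phi> b))"
      using flip_mt(1)[OF P(2,1) fl[OF b]] v(1)[OF b] by simp
    then have "v b \<le> ht1 (fst (\<phi> (ap (qq b))))" "T1.anc (v b) (fst (\<phi> (ap (qq b)))) = T1.anc (v b) (fst (\<phi> b))"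
      using T1.le_mt_iff XD(1) P by auto
    then show "T1.anc (v b) (fst (\<phi> b)) = xs (qq b) (ka b)" "ht1 (xs (qq b) (ka b)) = v b"
      using T1.ht_anc[OF XD(1)[OF P(2)], of "v b"] by (simp_all add: xs_def v_def)
    show "xs (qq b) (ka b) \<in> V1" unfolding xs_def by (rule T1.anc_in[OF XD(1)[OF P(2)]])
  qed
  define y2 where "y2 b = (SOME y. y \<in> T2.desc (nat (h (\<phi> b) - v b)) (snd (\<phi> b)))" for b
  have y2: "y2 b \<in> V2" "ht2 (y2 b) = - v b" "c \<le> - h (\<phi> b) \<Longrightarrow> T2.anc c (y2 b) = T2.anc c (snd (\<phi> b))"
    if b: "b \<in> F" for b c
  proof -
    have "y2 b \<in> T2.desc (nat (h (\<phi> b) - v b)) (snd (\<phi> b))"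
      unfolding y2_def using T2.desc_ne[OF XD(2)[OF phX(1)[OF b]]] by (simp add: some_in_eq)
    from T2.descD[OF this] T2.anc_desc[OF this] XD(4)[OF phX(1)[OF b]] v(1)[OF b]
    show "y2 b \<in> V2" "ht2 (y2 b) = - v b" "c \<le> - h (\<phi> b) \<Longrightarrow> T2.anc c (y2 b) = T2.anc c (snd (\<phi> b))"
      by auto
  qed
  have ys_eq: "T2.anc (- (v b + int Hm)) (y2 b) = ys (qq b) (ka b)" if b: "b \<in> F" for b
  proof -
    note P = phX[OF b]
    have "- (v b + int Hm) \<le> T2.mt (snd (\<phi> (ap (qq b)))) (snd (\<phi> b))"
      using flip_mt(2)[OF P(2,1) fl[OF b]] v(3)[OF b] by simp
    then have "- (v b + int Hm) \<le> ht2 (snd (\<phi> b))"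
      "T2.anc (- (v b + int Hm)) (snd (\<phi> (ap (qq b)))) = T2.anc (- (v b + int Hm)) (snd (\<phi> b))"
      using T2.le_mt_iff XD(2) P by auto
    then show ?thesis using y2(3)[OF b] XD(4)[OF P(1)] by (simp add: ys_def v_def)
  qed
  \<comment> \<open>A point near \<open>\<phi> b\<close> whose first coordinate is exactly
    \<open>xs\<close>; it is the start of all upward paths belonging to \<open>b\<close>.\<close>
  define b2 where "b2 b = (xs (qq b) (ka b), y2 b)" for b
  have b2X: "b2 b \<in> X" "h (b2 b) = v b" if "b \<in> F" for b
    using xs_in[OF that] y2[OF that] by (auto simp: b2_def X_def h_def)
  have rho_b2: "rho (\<phi> b) (b2 b) \<le> 2 * int (e0 + e)" if b: "b \<in> F" for b
  proof -
    have le: "v b \<le> ht1 (fst (\<phi> b))" using v(1)[OF b] XD(3)[OF phX(1)[OF b]] by simp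
    have t1: "T1.td (fst (\<phi> b)) (fst (b2 b)) = h (\<phi> b) - v b"
      using T1.td_anc[OF XD(1)[OF phX(1)[OF b]] le] XD(3)[OF phX(1)[OF b]] xs_eq[OF b]
      by (simp add: b2_def)
    have "T2.anc (- h (\<phi> b)) (y2 b) = snd (\<phi> b)"
      using y2(3)[OF b order_refl] XD(4)[OF phX(1)[OF b]] T2.anc_self by metis
    moreover have "T2.td (y2 b) (T2.anc (- h (\<phi> b)) (y2 b)) = ht2 (y2 b) + h (\<phi> b)"
      using T2.td_anc[OF y2(1)[OF b], of "- h (\<phi> b)"] y2(2)[OF b] v(1)[OF b] by simp
    ultimately have "T2.td (y2 b) (snd (\<phi> b)) = h (\<phi> b) - v b" using y2(2)[OF b] by simp
    then have "T2.td (snd (\<phi> b)) (snd (b2 b)) = h (\<phi> b) - v b"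
      using T2.td_commute[OF y2(1)[OF b] XD(2)[OF phX(1)[OF b]]] by (simp add: b2_def)
    then show ?thesis using t1 v(2)[OF b] by (simp add: rho_def)
  qed
  define tau where "tau b x k = line x (y2 b) (v b + int k)" for b x k
  have xD: "x \<in> V1" "ht1 x = v b + int Hm" "T1.anc (v b) x = xs (qq b) (ka b)"
    if "b \<in> F" "x \<in> T1.desc Hm (xs (qq b) (ka b))" for b x
    using T1.descD[OF that(2)] xs_in[OF that(1)] by auto
  have tauX: "tau b x k \<in> X" "h (tau b x k) = v b + int k" if "b \<in> F" "x \<in> T1.desc Hm (xs (qq b) (ka b))" "k \<le> Hm" for b x k
    using xD[OF that(1,2)] y2[OF that(1)] that(3) unfolding tau_def
    by (auto intro!: line_in simp: h_line)
  have rho_tau: "rho (tau b x k) (tau b x k') = 2 * \<bar>int k' - int k\<bar>"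
    if "b \<in> F" "x \<in> T1.desc Hm (xs (qq b) (ka b))" "k \<le> Hm" "k' \<le> Hm" for b x k k'
    unfolding tau_def using xD[OF that(1,2)] y2[OF that(1)] that(3,4) by (subst rho_line) auto
  have tau0: "tau b x 0 = b2 b" if "b \<in> F" "x \<in> T1.desc Hm (xs (qq b) (ka b))" for b x
    using xD[OF that] T2.anc_self[of "y2 b"] y2(2)[OF that(1)] by (simp add: tau_def line_def b2_def)
  have tauH: "tau b x Hm = (x, ys (qq b) (ka b))" if "b \<in> F" "x \<in> T1.desc Hm (xs (qq b) (ka b))" for b x
    using xD[OF that] T1.anc_self[of x] ys_eq[OF that(1)] by (simp add: tau_def line_def)
  define All where "All = (SIGMA b:F. T1.desc Hm (xs (qq b) (ka b)))"
  have finAll: "finite All" and cardAll: "card All = card F * m ^ Hm"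
    using finF xs_in(1) by (auto simp: All_def)
  \<comment> \<open>Paths whose pulled-back endpoint is still in the cone of \<open>b\<close>. Since
    this endpoint is determined by \<open>p\<close>, \<open>k\<close> and \<open>x\<close>, it is
    compatible with at most \<open>m ^ D\<close> points \<open>b\<close> over
    \<open>p\<close>.\<close>
  define NE where "NE = {p \<in> All. l \<le> T1.mt (fst (fst p)) (fst (\<psi> (snd p, ys (qq (fst p)) (ka (fst p)))))}"
  have endX: "(x, ys (qq b) (ka b)) \<in> X" if "b \<in> F" "x \<in> T1.desc Hm (xs (qq b) (ka b))" for b x
    using tauX(1)[OF that order_refl] tauH[OF that] by simp
  have cardNE: "card NE \<le> card I * (nb * (m ^ Hm * m ^ D))"
  proof -
    let ?W = "\<lambda>p k x. (T1.desc D (T1.anc l (fst (\<psi> (x, ys p k)))) \<times> {snd p}) \<times> {x}"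
    define G where "G p k = (if xs p k \<in> V1 then {x \<in> T1.desc Hm (xs p k). fst (\<psi> (x, ys p k)) \<in> V1} else {})" for p k
    have finG: "finite (G p k)" and cardG: "card (G p k) \<le> m ^ Hm" for p k
    proof -
      have "G p k \<subseteq> T1.desc Hm (xs p k)" by (auto simp: G_def)
      then have "xs p k \<in> V1 \<Longrightarrow> finite (G p k) \<and> card (G p k) \<le> m ^ Hm"
        using T1.card_desc[of "xs p k" Hm] T1.finite_desc[of "xs p k" Hm] by (metis card_mono finite_subset)
      then show "finite (G p k)" "card (G p k) \<le> m ^ Hm" by (auto simp: G_def)
    qed
    have sub: "NE \<subseteq> (\<Union>p\<in>I. \<Union>k\<in>{..<nb}. \<Union>x\<in>G p k. ?W p k x)"
    proof
      fix t assume t: "t \<in> NE"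
      obtain b x where tb: "t = (b, x)" by fastforce
      have b: "b \<in> F" and x: "x \<in> T1.desc Hm (xs (qq b) (ka b))"
        and le: "l \<le> T1.mt (fst b) (fst (\<psi> (x, ys (qq b) (ka b))))"
        using t tb by (auto simp: NE_def All_def)
      let ?u = "\<psi> (x, ys (qq b) (ka b))"
      have uX: "?u \<in> X" using qiD(3)[OF q] endX[OF b x] by blast
      have "T1.anc l (fst b) = T1.anc l (fst ?u)"
        using le T1.le_mt_iff[OF bX(3)[OF b] XD(1)[OF uX]] by blast
      moreover have "fst b \<in> T1.desc D (T1.anc (ht1 (fst b) - int D) (fst b))"
        using T1.mem_desc_anc[OF bX(3)[OF b], of D D] by simp
      moreover have "ht1 (fst b) - int D = l"
        using T1.descD(2)[OF bX(5)[OF b]] by (simp add: l_def \<beta>_def)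
      ultimately have "fst b \<in> T1.desc D (T1.anc l (fst ?u))" by simp
      moreover have "x \<in> G (qq b) (ka b)" using x xs_in[OF b] XD(1)[OF uX] by (simp add: G_def)
      ultimately show "t \<in> (\<Union>p\<in>I. \<Union>k\<in>{..<nb}. \<Union>x\<in>G p k. ?W p k x)"
        using qI[OF b] ka_lt[OF b] tb
        by (intro UN_I[of "qq b"] UN_I[of "ka b"] UN_I[of x]) (auto simp: qq_def mem_Times_iff)
    qed
    have fW: "finite (?W p k x)" and cW: "card (?W p k x) \<le> m ^ D" if "x \<in> G p k" for p k x
      using that by (auto simp: G_def card_cartesian_product split: if_splits)
    have "card (\<Union>p\<in>I. \<Union>k\<in>{..<nb}. \<Union>x\<in>G p k. ?W p k x) \<le> card I * (nb * (m ^ Hm * m ^ D))"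
      using finI finG cardG cW by (intro card_UN_le_const) auto
    moreover have "finite (\<Union>p\<in>I. \<Union>k\<in>{..<nb}. \<Union>x\<in>G p k. ?W p k x)"
      using finI finG fW by (intro finite_UN_I) auto
    ultimately show ?thesis using sub by (meson card_mono le_trans)
  qed
  \<comment> \<open>The possible exit points. A pulled-back step has length at most
    \<open>3 * K\<close>, so the exit happens within \<open>3 * K\<close> levels above
    \<open>l\<close>. Up to a constant these levels are smaller than the level of \<open>b\<close>
    by the factor \<open>(n / m) ^ D\<close>.\<close>
  define U where "U = (\<Union>c\<in>{..<3 * K}. T1.desc (s + r - D + c) x0 \<times> T2.desc (L - (s + r - D + c)) y0)"
  have finU: "finite U" using x0 y0 by (auto simp: U_def)
  have cardU: "card U \<le> 3 * K * (m ^ (3 * K) * (m ^ (s + r - D) * n ^ (L - (s + r) + D)))"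
    unfolding U_def
  proof (rule card_UN_le_const)
    fix c assume c: "c \<in> {..<3 * K}"
    have "card (T1.desc (s + r - D + c) x0 \<times> T2.desc (L - (s + r - D + c)) y0)
        = m ^ c * (m ^ (s + r - D) * n ^ (L - (s + r - D + c)))"
      using x0 y0 by (simp add: card_cartesian_product power_add mult_ac)
    also have "\<dots> \<le> m ^ (3 * K) * (m ^ (s + r - D) * n ^ (L - (s + r) + D))"
      using c m_pos n_pos D Ls by (intro mult_mono power_increasing) auto
    finally show "card (T1.desc (s + r - D + c) x0 \<times> T2.desc (L - (s + r - D + c)) y0)
        \<le> m ^ (3 * K) * (m ^ (s + r - D) * n ^ (L - (s + r) + D))" .
  qed auto
  define T where "T = (\<Union>u\<in>U \<inter> X. {t \<in> X. rho (\<psi> t) u \<le> int 0})"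
  have cardU': "card (U \<inter> X) \<le> card U" using finU by (intro card_mono) auto
  have finT: "finite T" unfolding T_def
  proof (intro finite_UN_I)
    show "finite {t \<in> X. rho (\<psi> t) u \<le> int 0}" if "u \<in> U \<inter> X" for u
      using qi_fibre(1)[OF qs] that by blast
  qed (use finU in simp)
  have cardT: "card T \<le> card U * gam ^ (3 * K)"
    unfolding T_def
  proof (rule card_UN_le_const[OF _ _ cardU'])
    fix u assume "u \<in> U \<inter> X"
    then show "card {t \<in> X. rho (\<psi> t) u \<le> int 0} \<le> gam ^ (3 * K)"
      using qi_fibre(2)[OF qs, of u 0] by (simp add: mult.commute)
  qed (use finU in auto)
  let ?G = "gam ^ (K * (4 * (e0 + e) + 3))"
  let ?Fib = "\<lambda>p. {b \<in> X. rho (\<phi> b) p \<le> int (2 * (e0 + e))}"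
  define Ex where "Ex = All - NE"
  have exit: "\<exists>k<Hm. tau b x k \<in> T" if b: "b \<in> F" and x: "x \<in> T1.desc Hm (xs (qq b) (ka b))"
    and ne: "\<not> l \<le> T1.mt (fst b) (fst (\<psi> (x, ys (qq b) (ka b))))" for b x
  proof -
    define u where "u k = \<psi> (tau b x k)" for k
    have uX: "u k \<in> X" if "k \<le> Hm" for k
      using tauX(1)[OF b x that] qiD(3)[OF q] by (simp add: u_def)
    have ustep: "rho (u k) (u k') \<le> int K * (2 * \<bar>int k' - int k\<bar> + 1)" if "k \<le> Hm" "k' \<le> Hm" for k k'
      unfolding u_def using qiD(5)[OF q tauX(1)[OF b x that(1)] tauX(1)[OF b x that(2)]] rho_tau[OF b x that] by simp
    have bu0: "rho b (u 0) \<le> int (K * (2 * (e0 + e) + 2))"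
    proof -
      have P: "\<psi> (\<phi> b) \<in> X" using phX(1)[OF b] qiD(3)[OF q] by blast
      have "rho b (u 0) \<le> rho b (\<psi> (\<phi> b)) + rho (\<psi> (\<phi> b)) (u 0)"
        using bX(1)[OF b] P uX[of 0] by (intro rho_triangle) auto
      also have "rho b (\<psi> (\<phi> b)) \<le> int K"
        using qiD(7)[OF q bX(1)[OF b]] rho_commute[OF bX(1)[OF b] P] by simp
      also have "rho (\<psi> (\<phi> b)) (u 0) \<le> int K * (rho (\<phi> b) (b2 b) + 1)"
        unfolding u_def tau0[OF b x] using phX(1)[OF b] b2X(1)[OF b] by (intro qiD(5)[OF q])
      also have "\<dots> \<le> int K * (2 * int (e0 + e) + 1)"
        using rho_b2[OF b] by (intro mult_left_mono) auto
      finally show ?thesis by (simp add: algebra_simps)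
    qed
    let ?in = "\<lambda>k. l \<le> T1.mt (fst b) (fst (u k))"
    have hb: "h b - int D = l" using bX(2)[OF b] by (simp add: l_def)
    have in0: "?in 0"
      using mt1_ge[OF bX(1)[OF b] uX[of 0]] bu0 D(2) hb by linarith
    have nin: "\<not> ?in Hm" using ne by (simp add: u_def tauH[OF b x])
    obtain k where k: "k < Hm" "?in k" "\<not> ?in (Suc k)"
      using ex_exit_step[of ?in, OF in0 nin] by (elim exE conjE) assumption
    have kl: "k \<le> Hm" "Suc k \<le> Hm" using k by auto
    have f: "fst b \<in> V1" "fst (u k) \<in> V1" "fst (u (Suc k)) \<in> V1"
      using bX(3)[OF b] XD(1) uX kl by auto
    have lk: "T1.mt (fst (u k)) (fst (u (Suc k))) < l"
      using T1.mt_ultra[OF f] k by (meson not_le)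
    have "h (u k) - 3 * int K \<le> T1.mt (fst (u k)) (fst (u (Suc k)))"
      using mt1_ge[OF uX[OF kl(1)] uX[OF kl(2)]] ustep[OF kl] by simp
    then have hu1: "h (u k) < l + int (3 * K)" using lk by simp
    have lu: "l \<le> ht1 (fst (u k))" "T1.anc l (fst b) = T1.anc l (fst (u k))"
      using k(2) T1.le_mt_iff[OF f(1,2)] by auto
    have hu2: "l \<le> h (u k)" using lu(1) XD(3)[OF uX[OF kl(1)]] by simp
    have lb: "\<beta> \<le> l" using D(1) by (simp add: l_def)
    define c where "c = nat (h (u k) - l)"
    have c: "c < 3 * K" "h (u k) = l + int c" using hu1 hu2 by (auto simp: c_def)
    have "T1.anc \<beta> (fst (u k)) = T1.anc \<beta> (fst b)"
      using T1.anc_mono_eq[OF f(1,2) lb _ lu(1)] lu(2) hb bX(2)[OF b] XD(3)[OF bX(1)[OF b]] by simp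
    also have "\<dots> = x0" using T1.descD(3)[OF bX(5)[OF b]] by (simp add: \<beta>_def)
    finally have m1: "fst (u k) \<in> T1.desc (s + r - D + c) x0"
      using f(2) c(2) XD(3)[OF uX[OF kl(1)]] D(1) by (simp add: T1.desc_def \<beta>_def l_def of_nat_diff)
    have "rho b (u k) \<le> rho b (u 0) + rho (u 0) (u k)"
      using bX(1)[OF b] uX kl by (intro rho_triangle) auto
    also have "rho (u 0) (u k) \<le> int K * (2 * int k + 1)" using ustep[of 0 k] kl by simp
    also have "\<dots> \<le> int K * (3 * int Hm)" using k(1) by (intro mult_left_mono) auto
    finally have rb: "rho b (u k) \<le> int (K * (2 * (e0 + e) + 2) + 3 * K * Hm)" using bu0 by simp
    \<comment> \<open>The hypothesis on \<open>L\<close> leaves so much room above \<open>b\<close>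
      that the pulled-back path stays in the cone of \<open>y0\<close> in the second tree.\<close>
    have "- (\<beta> + int L) \<le> T2.mt (snd b) (snd (u k))"
      using mt2_ge[OF bX(1)[OF b] uX[OF kl(1)]] rb bX(2)[OF b] L by linarith
    then have "- (\<beta> + int L) \<le> ht2 (snd (u k))" "T2.anc (- (\<beta> + int L)) (snd b) = T2.anc (- (\<beta> + int L)) (snd (u k))"
      using T2.le_mt_iff XD(2) bX(1)[OF b] uX[OF kl(1)] by auto
    moreover have "T2.anc (- (\<beta> + int L)) (snd b) = y0"
      using T2.descD(3)[OF bX(4)[OF b]] lev by (simp add: \<beta>_def)
    moreover have "ht2 (snd (u k)) = - (\<beta> + int (s + r - D + c))"
      using XD(4)[OF uX[OF kl(1)]] c(2) D(1) by (simp add: l_def of_nat_diff)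
    ultimately have m2: "snd (u k) \<in> T2.desc (L - (s + r - D + c)) y0"
      using XD(2)[OF uX[OF kl(1)]] lev by (simp add: T2.desc_def \<beta>_def of_nat_diff)
    have "u k \<in> U" unfolding U_def using m1 m2 c(1) by (auto simp: mem_Times_iff intro!: bexI[of _ c])
    then have "tau b x k \<in> T" unfolding T_def
      using uX[OF kl(1)] tauX(1)[OF b x kl(1)] by (intro UN_I[of "u k"]) (auto simp: u_def)
    then show ?thesis using k(1) by blast
  qed
  \<comment> \<open>A path that is at \<open>t\<close> at time \<open>k\<close> is recovered from
    \<open>k\<close> backward steps, with \<open>n ^ k\<close> choices \<open>y\<close> in the
    second tree, a point \<open>b\<close> in one bounded fibre of \<open>\<phi>\<close>, and
    \<open>Hm - k\<close> forward steps, with \<open>m ^ (Hm - k)\<close> choices in the first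
    tree.\<close>
  let ?P = "\<lambda>k t y. (T1.anc (h t - int k) (fst t), y)"
  let ?E = "\<lambda>k t y. ?Fib (?P k t y) \<times> T1.desc (Hm - k) (fst t)"
  have PX: "?P k t y \<in> X" if "t \<in> T" "y \<in> T2.desc k (snd t)" for k t y
  proof -
    have tX: "t \<in> X" using that(1) by (auto simp: T_def)
    then show ?thesis using T2.descD(1,2)[OF that(2)] XD[OF tX] by (auto simp: X_def)
  qed
  have TX: "t \<in> X" if "t \<in> T" for t using that by (auto simp: T_def)
  have subE: "Ex \<subseteq> (\<Union>k\<in>{..<Hm}. \<Union>t\<in>T. \<Union>y\<in>T2.desc k (snd t). ?E k t y)"
  proof
    fix w assume w: "w \<in> Ex"
    obtain b x where wb: "w = (b, x)" by fastforce
    have b: "b \<in> F" and x: "x \<in> T1.desc Hm (xs (qq b) (ka b))"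
      and ne: "\<not> l \<le> T1.mt (fst b) (fst (\<psi> (x, ys (qq b) (ka b))))"
      using w wb by (auto simp: Ex_def NE_def All_def)
    obtain k where k: "k < Hm" "tau b x k \<in> T" using exit[OF b x ne] by blast
    have kl: "k \<le> Hm" using k by simp
    let ?t = "tau b x k"
    have x1: "x \<in> T1.desc (Hm - k) (fst ?t)"
      using T1.mem_desc_anc'[OF xD(1)[OF b x], of "v b + int k"] xD(2)[OF b x] kl
      by (simp add: tau_def line_def nat_diff_distrib' of_nat_diff)
    have y1: "y2 b \<in> T2.desc k (snd ?t)"
    proof -
      have "ht2 (y2 b) - int k = - (v b + int k)" using y2(2)[OF b] by simp
      then show ?thesis using T2.mem_desc_anc[OF y2(1)[OF b] order_refl, of k]
        by (simp only: tau_def line_def snd_conv)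
    qed
    have "T1.anc (h ?t - int k) (fst ?t) = xs (qq b) (ka b)"
      using tauX(2)[OF b x kl] xD[OF b x] kl T1.anc_anc[OF xD(1)[OF b x], of "v b" "v b + int k"]
      by (simp add: tau_def line_def)
    then have "?P k ?t (y2 b) = b2 b" by (simp add: b2_def)
    then have "b \<in> ?Fib (?P k ?t (y2 b))" using rho_b2[OF b] bX(1)[OF b] by simp
    then have "w \<in> ?E k ?t (y2 b)" using wb x1 by blast
    then show "w \<in> (\<Union>k\<in>{..<Hm}. \<Union>t\<in>T. \<Union>y\<in>T2.desc k (snd t). ?E k t y)"
      using k y1 by blast
  qed
  have finE: "finite (?E k t y)" and cardE: "card (?E k t y) \<le> ?G * m ^ (Hm - k)"
    if "t \<in> T" "y \<in> T2.desc k (snd t)" for k t y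
  proof -
    have f: "finite (?Fib (?P k t y))" by (rule qi_fibre(1)[OF q PX[OF that]])
    have c: "card (?Fib (?P k t y)) \<le> ?G"
      using qi_fibre(2)[OF q PX[OF that], of "2 * (e0 + e)"] by simp
    show "finite (?E k t y)" using f XD(1)[OF TX[OF that(1)]] by simp
    show "card (?E k t y) \<le> ?G * m ^ (Hm - k)"
      unfolding card_cartesian_product using c XD(1)[OF TX[OF that(1)]] by (intro mult_mono) auto
  qed
  have "card Ex \<le> card (\<Union>k\<in>{..<Hm}. \<Union>t\<in>T. \<Union>y\<in>T2.desc k (snd t). ?E k t y)"
    using subE finT finE XD(2)[OF TX] by (intro card_mono finite_UN_I) auto
  also have "\<dots> \<le> (\<Sum>k<Hm. card (\<Union>t\<in>T. \<Union>y\<in>T2.desc k (snd t). ?E k t y))"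
    by (rule card_UN_le) simp
  also have "\<dots> \<le> (\<Sum>k<Hm. card T * (n ^ k * (?G * m ^ (Hm - k))))"
    using finT cardE XD(2)[OF TX] by (intro sum_mono card_UN_le_const) auto
  also have "\<dots> = card T * ?G * (\<Sum>k<Hm. n ^ k * m ^ (Hm - k))"
    unfolding sum_distrib_left by (intro sum.cong refl) (simp only: mult_ac)
  \<comment> \<open>The decisive use of \<open>n < m\<close>: summing over all times
    \<open>k\<close> costs only a factor \<open>m\<close> against the \<open>m ^ Hm\<close> paths
    that start at one \<open>b\<close>.\<close>
  also have "\<dots> \<le> card T * ?G * (m * m ^ Hm)"
    using geometric_mix_le[OF n_less_m] by (intro mult_left_mono) auto
  finally have cardEx: "card Ex \<le> card T * ?G * (m * m ^ Hm)" .
  have "card All = card Ex + card NE"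
    unfolding Ex_def using finAll by (subst card_Diff_subset) (auto simp: NE_def card_mono finite_subset)
  then have "card F * m ^ Hm \<le> card T * ?G * (m * m ^ Hm) + card I * (nb * (m ^ Hm * m ^ D))"
    using cardEx cardNE cardAll by linarith
  also have "\<dots> = (card T * ?G * m + card I * nb * m ^ D) * m ^ Hm" by (simp add: algebra_simps)
  finally have "card F \<le> card T * ?G * m + card I * nb * m ^ D" using m_pos by simp
  also have "\<dots> \<le> (3 * K * (m ^ (3 * K) * (m ^ (s + r - D) * n ^ (L - (s + r) + D)))) * gam ^ (3 * K) * ?G * m + card I * nb * m ^ D"
    using cardT cardU by (intro add_mono mult_mono order_refl order_trans[OF cardT]) auto
  finally show ?thesis unfolding cardI nb_def by (simp add: mult_ac add.commute)
qed

end

section \<open>Flipped pieces among all vertical lines of a box\<close>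

lemma card_le_fibre:
  assumes "finite B" "\<And>x. x \<in> A \<Longrightarrow> f x \<in> B" "\<And>y. y \<in> B \<Longrightarrow> finite {x \<in> A. f x = y} \<and> card {x \<in> A. f x = y} \<le> c"
  shows "card A \<le> card B * c"
proof -
  have "A = (\<Union>y\<in>B. {x \<in> A. f x = y})" using assms(2) by auto
  then have "card A = card (\<Union>y\<in>B. {x \<in> A. f x = y})" by simp
  also have "\<dots> \<le> card B * c" using assms by (intro card_UN_le_const) auto
  finally show ?thesis .
qed

context dl_space begin

lemma ratio: "0 < real n / real m" "real n / real m < 1"
  using n_less_m n_pos by auto

text \<open>The hypothesis on \<open>c\<close> concerns one choice \<open>A\<close> of a lower point
  for each pair \<open>(x, y)\<close>. The choice with the most bad upper points dominates each of
  the \<open>n ^ r\<close> lower points. The other factor counts the lines of the box through a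
  given piece: \<open>n ^ s\<close> extensions downward, \<open>m ^ (L - (s + r))\<close>
  upward.\<close>

lemma flipped_paths_le:
  fixes s r L :: nat and x0 :: 'a and y0 :: 'b
  defines "\<beta> \<equiv> ht1 x0"
  assumes x0: "x0 \<in> V1" and y0: "y0 \<in> V2" and lev: "ht2 y0 = - (ht1 x0 + int L)" and sr: "s + r \<le> L"
    and A_ex: "\<And>A. (\<And>x y. x \<in> T1.desc s x0 \<Longrightarrow> y \<in> T2.desc (L - (s + r)) y0 \<Longrightarrow> A x y \<in> T2.desc r y) \<Longrightarrow>
      card {b \<in> T1.desc (s + r) x0 \<times> T2.desc (L - (s + r)) y0.
        Q (T1.anc (\<beta> + int s) (fst b), A (T1.anc (\<beta> + int s) (fst b)) (snd b)) b} \<le> c"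
  shows "card {p \<in> T2.desc L y0 \<times> T1.desc L x0.
      Q (line (snd p) (fst p) (\<beta> + int s)) (line (snd p) (fst p) (\<beta> + int s + int r))}
    \<le> c * n ^ r * (n ^ s * m ^ (L - (s + r)))"
proof -
  let ?Y = "T2.desc (L - (s + r)) y0"
  define cnt where "cnt x y a = card {b \<in> T1.desc r x. Q (x, a) (b, y)}" for x y a
  define A where "A x y = (SOME a. a \<in> T2.desc r y \<and> (\<forall>a'\<in>T2.desc r y. cnt x y a' \<le> cnt x y a))" for x y
  have A: "A x y \<in> T2.desc r y" "\<And>a'. a' \<in> T2.desc r y \<Longrightarrow> cnt x y a' \<le> cnt x y (A x y)" if "y \<in> V2" for x y
  proof -
    have "\<exists>a. a \<in> T2.desc r y \<and> (\<forall>a'\<in>T2.desc r y. cnt x y a' \<le> cnt x y a)"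
    proof -
      let ?M = "Max (cnt x y ` T2.desc r y)"
      have f: "finite (cnt x y ` T2.desc r y)" "cnt x y ` T2.desc r y \<noteq> {}"
        using that T2.desc_ne by auto
      then have "?M \<in> cnt x y ` T2.desc r y" by (rule Max_in)
      then obtain a where "a \<in> T2.desc r y" "?M = cnt x y a" by blast
      then show ?thesis using f Max_ge by (metis imageI)
    qed
    then have "A x y \<in> T2.desc r y \<and> (\<forall>a'\<in>T2.desc r y. cnt x y a' \<le> cnt x y (A x y))"
      unfolding A_def by (rule someI_ex)
    then show "A x y \<in> T2.desc r y" "\<And>a'. a' \<in> T2.desc r y \<Longrightarrow> cnt x y a' \<le> cnt x y (A x y)" by auto
  qed
  define F where "F = {b \<in> T1.desc (s + r) x0 \<times> ?Y.
        Q (T1.anc (\<beta> + int s) (fst b), A (T1.anc (\<beta> + int s) (fst b)) (snd b)) b}"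
  have finF: "finite F" unfolding F_def
    by (rule finite_subset[of _ "T1.desc (s + r) x0 \<times> ?Y"]) (use x0 y0 in auto)
  have cF: "card F \<le> c" unfolding F_def
    by (rule A_ex) (use A(1) T2.descD(1) in blast)
  define I where "I = T1.desc s x0 \<times> ?Y"
  have finI: "finite I" using x0 y0 by (auto simp: I_def)
  have IV: "fst p \<in> V1" "snd p \<in> V2" "ht1 (fst p) = \<beta> + int s" if "p \<in> I" for p
    using that T1.descD[of "fst p" s x0] T2.descD(1)[of "snd p" "L - (s + r)" y0] by (auto simp: I_def \<beta>_def)
  define N where "N = {w \<in> T1.desc (s + r) x0 \<times> T2.desc (L - s) y0.
     Q (T1.anc (\<beta> + int s) (fst w), snd w) (fst w, T2.anc (- (\<beta> + int s + int r)) (snd w))}"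
  have finN: "finite N" unfolding N_def
    by (rule finite_subset[of _ "T1.desc (s + r) x0 \<times> T2.desc (L - s) y0"]) (use x0 y0 in auto)
  have yhi: "- (\<beta> + int s + int r) = ht2 y0 + int (L - (s + r))" using lev sr by (simp add: \<beta>_def of_nat_diff)
  have "N \<subseteq> (\<Union>p\<in>I. \<Union>a\<in>T2.desc r (snd p). {b \<in> T1.desc r (fst p). Q (fst p, a) (b, snd p)} \<times> {a})"
  proof
    fix w assume "w \<in> N"
    then obtain b a where w: "w = (b, a)" and b: "b \<in> T1.desc (s + r) x0" and a: "a \<in> T2.desc (L - s) y0"
      and Qw: "Q (T1.anc (\<beta> + int s) b, a) (b, T2.anc (- (\<beta> + int s + int r)) a)"
      by (auto simp: N_def)
    let ?p = "(T1.anc (\<beta> + int s) b, T2.anc (- (\<beta> + int s + int r)) a)"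
    have "T2.anc (- (\<beta> + int s + int r)) a \<in> ?Y"
      unfolding yhi by (rule T2.anc_mem_desc[OF a]) simp
    then have p: "?p \<in> I" using T1.anc_mem_desc[OF b, of s] by (simp add: I_def \<beta>_def)
    have "a \<in> T2.desc r (T2.anc (ht2 a - int r) a)" by (rule T2.mem_desc_anc[OF T2.descD(1)[OF a] order_refl])
    moreover have "ht2 a - int r = - (\<beta> + int s + int r)" using T2.descD(2)[OF a] lev sr by (simp add: \<beta>_def of_nat_diff)
    ultimately have a': "a \<in> T2.desc r (snd ?p)" by simp
    have "b \<in> T1.desc r (T1.anc (ht1 b - int r) b)" by (rule T1.mem_desc_anc[OF T1.descD(1)[OF b] order_refl])
    moreover have "ht1 b - int r = \<beta> + int s" using T1.descD(2)[OF b] by (simp add: \<beta>_def)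
    ultimately have b': "b \<in> T1.desc r (fst ?p)" by simp
    have "w \<in> {b \<in> T1.desc r (fst ?p). Q (fst ?p, a) (b, snd ?p)} \<times> {a}" using w b' Qw by simp
    then show "w \<in> (\<Union>p\<in>I. \<Union>a\<in>T2.desc r (snd p). {b \<in> T1.desc r (fst p). Q (fst p, a) (b, snd p)} \<times> {a})"
      by (intro UN_I[OF p] UN_I[OF a'])
  qed
  then have "card N \<le> card (\<Union>p\<in>I. \<Union>a\<in>T2.desc r (snd p). {b \<in> T1.desc r (fst p). Q (fst p, a) (b, snd p)} \<times> {a})"
    using finI IV by (intro card_mono finite_UN_I) auto
  also have "\<dots> \<le> (\<Sum>p\<in>I. card (\<Union>a\<in>T2.desc r (snd p). {b \<in> T1.desc r (fst p). Q (fst p, a) (b, snd p)} \<times> {a}))"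
    by (rule card_UN_le[OF finI])
  also have "\<dots> \<le> (\<Sum>p\<in>I. n ^ r * cnt (fst p) (snd p) (A (fst p) (snd p)))"
  proof (intro sum_mono card_UN_le_const)
    fix p a assume "p \<in> I" "a \<in> T2.desc r (snd p)"
    then show "card ({b \<in> T1.desc r (fst p). Q (fst p, a) (b, snd p)} \<times> {a}) \<le> cnt (fst p) (snd p) (A (fst p) (snd p))"
      using A(2)[OF IV(2)] by (simp add: card_cartesian_product cnt_def[symmetric])
  qed (use IV in auto)
  also have "\<dots> = n ^ r * card (SIGMA p:I. {b \<in> T1.desc r (fst p). Q (fst p, A (fst p) (snd p)) (b, snd p)})"
    using finI IV by (subst card_SigmaI) (auto simp: sum_distrib_left cnt_def)
  also have "card (SIGMA p:I. {b \<in> T1.desc r (fst p). Q (fst p, A (fst p) (snd p)) (b, snd p)}) \<le> card F"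
  proof (rule card_inj_on_le[of "\<lambda>(p, b). (b, snd p)"])
    show "inj_on (\<lambda>(p, b). (b, snd p)) (SIGMA p:I. {b \<in> T1.desc r (fst p). Q (fst p, A (fst p) (snd p)) (b, snd p)})"
    proof (rule inj_onI, clarsimp)
      fix x y x' b assume "(x, y) \<in> I" "b \<in> T1.desc r x" "(x', y) \<in> I" "b \<in> T1.desc r x'"
      moreover from this have "ht1 x = \<beta> + int s" "ht1 x' = \<beta> + int s" using IV(3) by force+
      ultimately show "x = x'" using T1.descD(3)[of b r x] T1.descD(3)[of b r x'] by simp
    qed
    show "(\<lambda>(p, b). (b, snd p)) ` (SIGMA p:I. {b \<in> T1.desc r (fst p). Q (fst p, A (fst p) (snd p)) (b, snd p)}) \<subseteq> F"
    proof clarsimp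
      fix x y b assume p: "(x, y) \<in> I" and b: "b \<in> T1.desc r x" and Q: "Q (x, A x y) (b, y)"
      have "T1.anc (\<beta> + int s) b = x" using T1.descD(3)[OF b] IV(3)[OF p] by simp
      moreover have "b \<in> T1.desc (s + r) x0" using T1.desc_desc[OF _ b] p by (simp add: I_def)
      ultimately show "(b, y) \<in> F" using p Q by (simp add: F_def I_def)
    qed
  qed (rule finF)
  finally have cN: "card N \<le> c * n ^ r" using cF by (simp add: mult.commute order_trans)
  let ?S = "{p \<in> T2.desc L y0 \<times> T1.desc L x0.
      Q (line (snd p) (fst p) (\<beta> + int s)) (line (snd p) (fst p) (\<beta> + int s + int r))}"
  let ?f = "\<lambda>p. (T1.anc (\<beta> + int s + int r) (snd p), T2.anc (- (\<beta> + int s)) (fst p))"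
  have "card ?S \<le> card N * (n ^ s * m ^ (L - (s + r)))"
  proof (rule card_le_fibre[of _ _ ?f])
    fix p assume p: "p \<in> ?S"
    then have a: "fst p \<in> T2.desc L y0" and b: "snd p \<in> T1.desc L x0" by auto
    have 1: "T1.anc (\<beta> + int s + int r) (snd p) \<in> T1.desc (s + r) x0"
      using T1.anc_mem_desc[OF b sr] by (simp add: \<beta>_def add.assoc)
    have yh: "- (\<beta> + int s) = ht2 y0 + int (L - s)" using lev sr by (simp add: \<beta>_def of_nat_diff)
    have 2: "T2.anc (- (\<beta> + int s)) (fst p) \<in> T2.desc (L - s) y0"
      unfolding yh by (rule T2.anc_mem_desc[OF a]) simp
    have 3: "T1.anc (\<beta> + int s) (T1.anc (\<beta> + int s + int r) (snd p)) = T1.anc (\<beta> + int s) (snd p)"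
      using T1.descD[OF b] sr by (intro T1.anc_anc) (auto simp: \<beta>_def)
    have 4: "T2.anc (- (\<beta> + int s + int r)) (T2.anc (- (\<beta> + int s)) (fst p)) = T2.anc (- (\<beta> + int s + int r)) (fst p)"
      using T2.descD[OF a] sr lev by (intro T2.anc_anc) (auto simp: \<beta>_def)
    show "?f p \<in> N" using 1 2 3 4 p by (simp add: N_def line_def)
  next
    fix w assume w: "w \<in> N"
    have wV: "fst w \<in> V1" "snd w \<in> V2" using w T1.descD(1)[of "fst w"] T2.descD(1)[of "snd w"] by (auto simp: N_def mem_Times_iff)
    have sub: "{p \<in> ?S. ?f p = w} \<subseteq> T2.desc s (snd w) \<times> T1.desc (L - (s + r)) (fst w)"
    proof
      fix p assume p: "p \<in> {p \<in> ?S. ?f p = w}"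
      then have a: "fst p \<in> T2.desc L y0" and b: "snd p \<in> T1.desc L x0"
        and w: "fst w = T1.anc (\<beta> + int s + int r) (snd p)" "snd w = T2.anc (- (\<beta> + int s)) (fst p)" by auto
      have "fst p \<in> T2.desc s (snd w)"
        using T2.mem_desc_anc[OF T2.descD(1)[OF a] order_refl, of s] T2.descD(2)[OF a] lev w(2) by (simp add: \<beta>_def)
      moreover have "snd p \<in> T1.desc (L - (s + r)) (fst w)"
        using T1.mem_desc_anc[OF T1.descD(1)[OF b] order_refl, of "L - (s + r)"] T1.descD(2)[OF b] sr w(1)
        by (simp add: \<beta>_def of_nat_diff add.assoc)
      ultimately show "p \<in> T2.desc s (snd w) \<times> T1.desc (L - (s + r)) (fst w)" by (simp add: mem_Times_iff)
    qed
    have fin: "finite (T2.desc s (snd w) \<times> T1.desc (L - (s + r)) (fst w))"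
      "card (T2.desc s (snd w) \<times> T1.desc (L - (s + r)) (fst w)) = n ^ s * m ^ (L - (s + r))"
      using wV by (auto simp: card_cartesian_product)
    show "finite {p \<in> ?S. ?f p = w} \<and> card {p \<in> ?S. ?f p = w} \<le> n ^ s * m ^ (L - (s + r))"
      using finite_subset[OF sub fin(1)] card_mono[OF fin(1) sub] fin(2) by (simp only: simp_thms)
  qed (rule finN)
  also have "\<dots> \<le> c * n ^ r * (n ^ s * m ^ (L - (s + r)))" by (rule mult_right_mono[OF cN]) simp
  finally show ?thesis .
qed

text \<open>The tolerance \<open>16 * t\<close> is what coarse differentiation yields at scale
  \<open>r = 4 * E * t\<close>, namely \<open>4 * (r div E)\<close>. Fibres of \<open>\<phi>\<close>
  at this tolerance cost \<open>gam ^ (80 * K * t)\<close>, while leaving a cone of depth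
  \<open>2 * E * t\<close> gains \<open>(n / m) ^ (2 * E * t)\<close>; the second condition on
  \<open>E\<close> lets the gain win. The term with \<open>24 * K\<^sup>2\<close> is the room needed
  above the piece.\<close>

lemma flip_rare:
  fixes K E :: nat and \<theta> :: real
  assumes K: "1 \<le> K" and \<theta>: "0 < \<theta>" and E: "44 * K \<le> E" "real gam ^ (80 * K) * (real n / real m) ^ E \<le> 1"
  shows "\<exists>t0>0. \<forall>t\<ge>t0. \<forall>\<phi> \<psi> x0 y0 L s. qi (int K) \<phi> \<psi> \<longrightarrow> x0 \<in> V1 \<longrightarrow> y0 \<in> V2 \<longrightarrow>
     ht2 y0 = - (ht1 x0 + int L) \<longrightarrow> s + 4 * E * t + 24 * K\<^sup>2 * (4 * E * t) \<le> L \<longrightarrow>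
     real (card {p \<in> T2.desc L y0 \<times> T1.desc L x0.
       flip (int (16 * t)) (\<phi> (line (snd p) (fst p) (ht1 x0 + int s)))
         (\<phi> (line (snd p) (fst p) (ht1 x0 + int s + int (4 * E * t))))}) \<le> \<theta> * (real m ^ L * real n ^ L)"
proof -
  define q where "q = real n / real m"
  have q: "0 < q" "q < 1" using ratio by (auto simp: q_def)
  have Epos: "0 < E" using E(1) K by simp
  define C0 where "C0 = 3 * real K * real m ^ (3 * K) * real gam ^ (3 * K) * real gam ^ (7 * K) * real m"
  have C0: "0 \<le> C0" by (simp add: C0_def)
  have "(\<lambda>t. (2 * real K * E + 1 + C0) * (q ^ E) ^ t) \<longlonglongrightarrow> (2 * real K * E + 1 + C0) * 0"
    using q Epos by (intro tendsto_intros LIMSEQ_realpow_zero) (auto intro: power_Suc_less_one simp: power_less_one_iff)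
  then have "\<forall>\<^sub>F t in sequentially. (2 * real K * E + 1 + C0) * (q ^ E) ^ t < \<theta>"
    using \<theta> by (intro order_tendstoD(2)) auto
  then obtain t1 where t1: "\<And>t. t \<ge> t1 \<Longrightarrow> (2 * real K * E + 1 + C0) * (q ^ E) ^ t < \<theta>"
    by (auto simp: eventually_sequentially)
  show ?thesis
  proof (rule exI[of _ "Suc t1"], intro conjI allI impI)
    fix t \<phi> \<psi> x0 y0 and L s :: nat
    assume t: "Suc t1 \<le> t" and qi: "qi (int K) \<phi> \<psi>" and x0: "x0 \<in> V1" and y0: "y0 \<in> V2"
      and lev: "ht2 y0 = - (ht1 x0 + int L)" and Ls: "s + 4 * E * t + 24 * K\<^sup>2 * (4 * E * t) \<le> L"
    define r where "r = 4 * E * t"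
    \<comment> \<open>Half of \<open>r\<close>: the cone must be small against the
      \<open>m ^ r\<close> points above a lower point, yet deep against the tolerance.\<close>
    define D where "D = 2 * E * t"
    define e where "e = 16 * t"
    \<comment> \<open>The rounding step grows with \<open>t\<close>, so that the number
      \<open>nb\<close> of classes stays below a bound free of \<open>t\<close>.\<close>
    define e0 where "e0 = 4 * t + 1"
    have tpos: "1 \<le> t" using t by simp
    have sr: "s + r \<le> L" using Ls by (simp add: r_def)
    have E44: "44 \<le> E" using E(1) K by simp
    have Et: "44 * t \<le> E * t" using E44 by (intro mult_right_mono) auto
    have rD: "r = D + D" by (simp add: r_def D_def)
    have "r = 4 * (E * t)" by (simp add: r_def)
    then have "176 * t \<le> r" using Et by linarith
    then have er: "e0 + 2 * e \<le> r" "2 * (e0 + e) + 2 \<le> r" "1 \<le> r"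
      using tpos unfolding e_def e0_def by auto
    have big: "K * (2 * (e0 + e) + 2) + 3 * K * (K * (2 * r + 1) + e0 + 2 * e) \<le> 24 * K\<^sup>2 * r"
    proof -
      have KK: "K \<le> K\<^sup>2" using K by (simp add: power2_eq_square)
      have 1: "K * (2 * (e0 + e) + 2) \<le> K\<^sup>2 * r" using er(2) by (intro mult_mono KK) auto
      have "K * (2 * r + 1) \<le> K * (3 * r)" using er(3) by (intro mult_left_mono) auto
      moreover have "1 * r \<le> K * r" using K by (intro mult_right_mono) auto
      ultimately have "K * (2 * r + 1) + e0 + 2 * e \<le> K * (3 * r) + K * r" using er(1) by linarith
      then have 2: "3 * K * (K * (2 * r + 1) + e0 + 2 * e) \<le> 3 * K * (K * (3 * r) + K * r)"
        by (rule mult_left_mono) simp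
      have 3: "3 * K * (K * (3 * r) + K * r) = 12 * (K\<^sup>2 * r)" by (simp add: power2_eq_square algebra_simps)
      have 4: "24 * K\<^sup>2 * r = 24 * (K\<^sup>2 * r)" by (rule mult.assoc)
      show ?thesis using 1 2 unfolding 3 4 by linarith
    qed
    have Dlt: "K * (2 * (e0 + e) + 2) < D"
    proof -
      have "K * (2 * (e0 + e) + 2) \<le> K * (44 * t)" using tpos by (intro mult_left_mono) (auto simp: e0_def e_def)
      also have "\<dots> \<le> E * t" using mult_right_mono[OF E(1), of t] by (simp add: mult_ac)
      also have "\<dots> < D" using Epos tpos by (simp add: D_def)
      finally show ?thesis .
    qed
    define nb where "nb = K * (2 * r + 1) div e0 + 1"
    let ?c = "nb * (m ^ s * n ^ (L - (s + r))) * m ^ D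
      + 3 * K * m ^ (3 * K) * (m ^ (s + r - D) * n ^ (L - (s + r) + D)) * gam ^ (3 * K) * gam ^ (K * (4 * (e0 + e) + 3)) * m"
    let ?S = "{p \<in> T2.desc L y0 \<times> T1.desc L x0.
       flip (int e) (\<phi> (line (snd p) (fst p) (ht1 x0 + int s))) (\<phi> (line (snd p) (fst p) (ht1 x0 + int s + int r)))}"
    have "card ?S \<le> ?c * n ^ r * (n ^ s * m ^ (L - (s + r)))"
    proof (rule flipped_paths_le[OF x0 y0 lev sr, of "\<lambda>p q. flip (int e) (\<phi> p) (\<phi> q)"])
      fix A assume A: "\<And>x y. x \<in> T1.desc s x0 \<Longrightarrow> y \<in> T2.desc (L - (s + r)) y0 \<Longrightarrow> A x y \<in> T2.desc r y"
      show "card {b \<in> T1.desc (s + r) x0 \<times> T2.desc (L - (s + r)) y0.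
          flip (int e) (\<phi> (T1.anc (ht1 x0 + int s) (fst b), A (T1.anc (ht1 x0 + int s) (fst b)) (snd b))) (\<phi> b)} \<le> ?c"
        unfolding nb_def by (rule card_flipped_le[OF qi x0 y0 lev _ _ Dlt _ A]) (use Ls big rD in \<open>auto simp: e0_def r_def[symmetric]\<close>)
    qed
    then have "real (card ?S) \<le> real (?c * n ^ r * (n ^ s * m ^ (L - (s + r))))" by (simp only: of_nat_le_iff)
    also have "\<dots> \<le> ((2 * real K * E + 1) * (q ^ E) ^ t + C0 * (q ^ E) ^ t) * (real m ^ L * real n ^ L)"
    proof -
      have nb: "nb \<le> 2 * K * E + 1"
      proof -
        have "2 * r + 1 \<le> 2 * E * e0" using Epos by (simp add: r_def e0_def algebra_simps)
        then have "K * (2 * r + 1) \<le> K * (2 * E * e0)" by (rule mult_left_mono) simp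
        then have "K * (2 * r + 1) div e0 \<le> K * (2 * E * e0) div e0" by (rule div_le_mono)
        also have "K * (2 * E * e0) = 2 * K * E * e0" by simp
        also have "2 * K * E * e0 div e0 = 2 * K * E" by (rule nonzero_mult_div_cancel_right) (simp add: e0_def)
        finally show ?thesis by (simp add: nb_def)
      qed
      have qm: "real n = q * real m" using m_pos by (simp add: q_def)
      have mL: "real m ^ L = real m ^ s * real m ^ D * real m ^ D * real m ^ (L - (s + r))"
        using sr by (simp add: rD flip: power_add)
      have nL: "real n ^ L = real n ^ s * real n ^ D * real n ^ D * real n ^ (L - (s + r))"
        using sr by (simp add: rD flip: power_add)
      have nr: "real n ^ r = real n ^ D * real n ^ D" by (simp add: rD power_add)
      have nD: "real n ^ D = q ^ D * real m ^ D" by (simp add: qm power_mult_distrib)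
      have qD: "q ^ D = (q ^ E) ^ t * (q ^ E) ^ t"
      proof -
        have "D = E * t + E * t" by (simp add: D_def)
        then show ?thesis by (simp only: power_add power_mult)
      qed
      have t1': "real (nb * (m ^ s * n ^ (L - (s + r))) * m ^ D) * real n ^ r * (real n ^ s * real m ^ (L - (s + r)))
         \<le> (2 * real K * E + 1) * (q ^ E) ^ t * (real m ^ L * real n ^ L)"
      proof -
        have "1 \<le> q ^ D * real m ^ D" using n_pos by (simp flip: nD)
        have mD: "1 \<le> (q ^ E) ^ t * real m ^ D"
        proof -
          have "(q ^ E) ^ t * (q ^ E) ^ t \<le> (q ^ E) ^ t * 1"
            using q by (intro mult_left_mono power_le_one) auto
          then have "q ^ D * real m ^ D \<le> (q ^ E) ^ t * real m ^ D" unfolding qD by (intro mult_right_mono) auto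
          then show ?thesis using \<open>1 \<le> q ^ D * real m ^ D\<close> by linarith
        qed
        have "real nb \<le> real (2 * K * E + 1)" using nb by (simp only: of_nat_le_iff)
        then have "real nb * 1 \<le> (2 * real K * E + 1) * ((q ^ E) ^ t * real m ^ D)"
          using mD by (intro mult_mono) auto
        then have "real nb * (real m ^ s * real n ^ (L - (s + r)) * real m ^ D * real n ^ r * (real n ^ s * real m ^ (L - (s + r))))
          \<le> (2 * real K * E + 1) * ((q ^ E) ^ t * real m ^ D) * (real m ^ s * real n ^ (L - (s + r)) * real m ^ D * real n ^ r * (real n ^ s * real m ^ (L - (s + r))))"
          by (intro mult_right_mono) auto
        then show ?thesis unfolding mL nL nr of_nat_mult of_nat_power by (simp only: mult_ac)
      qed
      have g: "real gam ^ (K * (4 * (e0 + e) + 3)) = real gam ^ (7 * K) * (real gam ^ (80 * K)) ^ t"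
        by (simp add: e0_def e_def algebra_simps flip: power_add power_mult)
      have g2: "(real gam ^ (80 * K)) ^ t * q ^ D \<le> (q ^ E) ^ t"
      proof -
        have "(real gam ^ (80 * K) * q ^ E) ^ t \<le> 1" using E(2) q by (intro power_le_one) (auto simp: q_def)
        then have "(real gam ^ (80 * K) * q ^ E) ^ t * (q ^ E) ^ t \<le> 1 * (q ^ E) ^ t"
          using q by (intro mult_right_mono) auto
        then show ?thesis by (simp add: qD power_mult_distrib mult_ac)
      qed
      have t2': "real (3 * K * m ^ (3 * K) * (m ^ (s + r - D) * n ^ (L - (s + r) + D)) * gam ^ (3 * K) * gam ^ (K * (4 * (e0 + e) + 3)) * m) * real n ^ r * (real n ^ s * real m ^ (L - (s + r)))
         \<le> C0 * (q ^ E) ^ t * (real m ^ L * real n ^ L)"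
      proof -
        have srD: "real m ^ (s + r - D) = real m ^ s * real m ^ D" by (simp add: rD flip: power_add)
        let ?W = "real m ^ s * real m ^ D * real m ^ D * real m ^ (L - (s + r)) * (real n ^ s * real n ^ D * real n ^ D * real n ^ (L - (s + r)))"
        have "real (3 * K * m ^ (3 * K) * (m ^ (s + r - D) * n ^ (L - (s + r) + D)) * gam ^ (3 * K) * gam ^ (K * (4 * (e0 + e) + 3)) * m) * real n ^ r * (real n ^ s * real m ^ (L - (s + r)))
          = C0 * (real gam ^ (80 * K)) ^ t * (real m ^ s * real m ^ D * real n ^ D * real m ^ (L - (s + r)) * (real n ^ s * real n ^ D * real n ^ D * real n ^ (L - (s + r))))"
          unfolding of_nat_mult of_nat_power of_nat_numeral g srD nr C0_def power_add by (simp only: mult_ac)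
        also have "\<dots> = C0 * ((real gam ^ (80 * K)) ^ t * q ^ D) * ?W"
          unfolding nD by (simp only: mult_ac)
        also have "\<dots> \<le> C0 * (q ^ E) ^ t * ?W"
          using g2 C0 by (intro mult_right_mono mult_left_mono) auto
        finally show ?thesis unfolding mL nL .
      qed
      show ?thesis using add_mono[OF t1' t2'] by (simp add: algebra_simps)
    qed
    also have "\<dots> = ((2 * real K * E + 1 + C0) * (q ^ E) ^ t) * (real m ^ L * real n ^ L)" by (simp add: algebra_simps)
    also have "\<dots> \<le> \<theta> * (real m ^ L * real n ^ L)"
      using t1[of t] t by (intro mult_right_mono) auto
    finally show "real (card {p \<in> T2.desc L y0 \<times> T1.desc L x0.
       flip (int (16 * t)) (\<phi> (line (snd p) (fst p) (ht1 x0 + int s)))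
         (\<phi> (line (snd p) (fst p) (ht1 x0 + int s + int (4 * E * t))))}) \<le> \<theta> * (real m ^ L * real n ^ L)"
      by (simp only: e_def r_def)
  qed simp
qed

lemma ex_good_scale_ratio:
  fixes c :: real
  shows "\<exists>E. E0 \<le> E \<and> c * (real n / real m) ^ E \<le> 1"
proof -
  have "(\<lambda>E. c * (real n / real m) ^ E) \<longlonglongrightarrow> c * 0"
    using ratio by (intro tendsto_intros LIMSEQ_realpow_zero) auto
  then have "\<forall>\<^sub>F E in sequentially. c * (real n / real m) ^ E < 1"
    by (intro order_tendstoD(2)) auto
  then obtain N where "\<And>E. E \<ge> N \<Longrightarrow> c * (real n / real m) ^ E < 1" by (auto simp: eventually_sequentially)
  then show ?thesis by (intro exI[of _ "max E0 N"]) (auto intro: less_imp_le)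
qed

text \<open>As \<open>rho p q\<close> is at least \<open>2 * \<bar>h p - h q\<bar>\<close>, this
  bounds the excess over a vertical segment and, once \<open>rho p q\<close> exceeds
  \<open>e\<close>, forces \<open>q\<close> to lie above \<open>p\<close>. Such estimates can be
  added along a chain.\<close>

definition upright :: "real \<Rightarrow> 'a \<times> 'b \<Rightarrow> 'a \<times> 'b \<Rightarrow> bool" where
  "upright e p q \<longleftrightarrow> real_of_int (rho p q) \<le> 2 * real_of_int (h q - h p) + e"

text \<open>A pair \<open>p\<close> encodes a vertical line of the box: \<open>fst p\<close>, in the
  second tree, gives the bottom end and \<open>snd p\<close>, in the first tree, the top end. So
  there are \<open>m ^ L * n ^ L\<close> lines.\<close>

lemma box_lineD:
  assumes "x0 \<in> V1" "y0 \<in> V2" "ht2 y0 = - (ht1 x0 + int L)"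
    and p: "p \<in> T2.desc L y0 \<times> T1.desc L x0" and "t \<le> L" "t' \<le> L"
  shows "line (snd p) (fst p) (ht1 x0 + int t) \<in> X"
    "rho (line (snd p) (fst p) (ht1 x0 + int t)) (line (snd p) (fst p) (ht1 x0 + int t')) = 2 * \<bar>int t - int t'\<bar>"
    "line (snd p) (fst p) (ht1 x0) = (x0, fst p)" "line (snd p) (fst p) (ht1 x0 + int L) = (snd p, y0)"
proof -
  have a: "fst p \<in> V2" "ht2 (fst p) = - ht1 x0" "T2.anc (ht2 y0) (fst p) = y0"
    using p T2.descD[of "fst p" L y0] assms(3) by (auto simp: mem_Times_iff)
  have b: "snd p \<in> V1" "ht1 (snd p) = ht1 x0 + int L" "T1.anc (ht1 x0) (snd p) = x0"
    using p T1.descD[of "snd p" L x0] by (auto simp: mem_Times_iff)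
  show "line (snd p) (fst p) (ht1 x0 + int t) \<in> X" using a b assms by (intro line_in) auto
  show "rho (line (snd p) (fst p) (ht1 x0 + int t)) (line (snd p) (fst p) (ht1 x0 + int t')) = 2 * \<bar>int t - int t'\<bar>"
    using a b assms by (subst rho_line) auto
  have "T2.anc (- ht1 x0) (fst p) = fst p" using T2.anc_self[of "fst p"] a(2) by simp
  then show "line (snd p) (fst p) (ht1 x0) = (x0, fst p)" using b by (simp add: line_def)
  have "T1.anc (ht1 x0 + int L) (snd p) = snd p" using T1.anc_self[of "snd p"] b(2) by simp
  moreover have "T2.anc (- (ht1 x0 + int L)) (fst p) = y0" using a(3) assms(3) by simp
  ultimately show "line (snd p) (fst p) (ht1 x0 + int L) = (snd p, y0)" unfolding line_def by simp
qed

text \<open>At a good scale most pieces of a vertical geodesic have almost vertical images, and few of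
  those are flipped; the heights along the remaining pieces add up.\<close>

lemma upright_boxes:
  fixes K :: nat and \<eta> \<theta> :: real
  assumes K: "1 \<le> K" and \<eta>: "0 < \<eta>" and \<theta>: "0 < \<theta>"
  shows "\<exists>N0>0. \<forall>\<phi> \<psi> x0 y0 L. qi (int K) \<phi> \<psi> \<longrightarrow> x0 \<in> V1 \<longrightarrow> y0 \<in> V2 \<longrightarrow>
     ht2 y0 = - (ht1 x0 + int L) \<longrightarrow> 0 < L \<longrightarrow> N0 dvd L \<longrightarrow>
     real (card {p \<in> T2.desc L y0 \<times> T1.desc L x0. \<not> upright (\<eta> * L) (\<phi> (x0, fst p)) (\<phi> (snd p, y0))})
       \<le> \<theta> * (real m ^ L * real n ^ L)"
proof -
  \<comment> \<open>A bad piece costs at most \<open>6 * K * r\<close>, so a fraction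
    \<open>\<theta>2\<close> of bad pieces costs half of \<open>\<eta> * L\<close>; the other half
    covers the tolerances, by \<open>E \<ge> 16 / \<eta>\<close>. The division by 3 in
    \<open>\<theta>1\<close> is for the three kinds of exceptions: not vertical, flipped, too near
    the top of the box.\<close>
  define \<theta>2 where "\<theta>2 = \<eta> / (12 * K)"
  define \<theta>1 where "\<theta>1 = \<theta> * \<theta>2 / 3"
  have th: "0 < \<theta>2" "0 < \<theta>1" using K \<eta> \<theta> by (auto simp: \<theta>1_def \<theta>2_def)
  obtain E where E: "max (44 * K) (nat \<lceil>16 / \<eta>\<rceil>) \<le> E" "real gam ^ (80 * K) * (real n / real m) ^ E \<le> 1"
    using ex_good_scale_ratio by blast
  have E44: "44 * K \<le> E" and Eeta: "16 / \<eta> \<le> E" using E(1) by (auto simp: nat_le_iff ceiling_le_iff)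
  have Epos: "0 < E" using E44 K by simp
  from flip_rare[OF K th(2) E44 E(2)] obtain t0 where t0_pos: "0 < t0"
    and t0_all: "\<forall>t\<ge>t0. \<forall>\<phi> \<psi> x0 y0 L s. qi (int K) \<phi> \<psi> \<longrightarrow> x0 \<in> V1 \<longrightarrow> y0 \<in> V2 \<longrightarrow>
     ht2 y0 = - (ht1 x0 + int L) \<longrightarrow> s + 4 * E * t + 24 * K\<^sup>2 * (4 * E * t) \<le> L \<longrightarrow>
     real (card {p \<in> T2.desc L y0 \<times> T1.desc L x0.
       flip (int (16 * t)) (\<phi> (line (snd p) (fst p) (ht1 x0 + int s)))
         (\<phi> (line (snd p) (fst p) (ht1 x0 + int s + int (4 * E * t))))}) \<le> \<theta>1 * (real m ^ L * real n ^ L)"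
    by (elim exE conjE) assumption
  note t0 = t0_pos t0_all[rule_format]
  obtain R :: nat where R: "6 / \<theta>1 \<le> R" using real_arch_simple by blast
  obtain M :: nat where M: "6 * real K * R * E / \<theta>1 \<le> M" using real_arch_simple by blast
  \<comment> \<open>\<open>flip_rare\<close> does not reach the last \<open>24 * K\<^sup>2\<close>
    pieces of a line; with at least \<open>B\<close> pieces their share is at most
    \<open>\<theta>1\<close>.\<close>
  obtain B :: nat where B: "max 1 (24 * real (K\<^sup>2) / \<theta>1) \<le> B" using real_arch_simple by blast
  have Rpos: "0 < R" using R th by (cases "R = 0") (auto simp: field_simps)
  have Bpos: "0 < B" using B by (cases "B = 0") auto
  define r1 where "r1 = 4 * E * t0"
  \<comment> \<open>A multiple of every scale \<open>r1 * R ^ k\<close> with \<open>k < M\<close>: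
    which of them is good depends on the map, but the condition on \<open>L\<close> does
    not.\<close>
  define N0 where "N0 = r1 * R ^ M * B"
  show ?thesis
  proof (rule exI[of _ N0], intro conjI allI impI)
    show "0 < N0" using Epos t0(1) Rpos Bpos by (simp add: N0_def r1_def)
  next
    fix \<phi> \<psi> x0 y0 and L :: nat
    assume q: "qi (int K) \<phi> \<psi>" and x0: "x0 \<in> V1" and y0: "y0 \<in> V2"
      and lev: "ht2 y0 = - (ht1 x0 + int L)" and Lpos: "0 < L" and dv: "N0 dvd L"
    define P where "P = T2.desc L y0 \<times> T1.desc L x0"
    define \<gamma> where "\<gamma> p t = line (snd p) (fst p) (ht1 x0 + int t)" for p :: "'b \<times> 'a" and t :: nat
    have finP: "finite P" using x0 y0 by (simp add: P_def)
    have cP: "real (card P) = real m ^ L * real n ^ L" using x0 y0 by (simp add: P_def card_cartesian_product)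
    note bl = box_lineD[OF x0 y0 lev, folded P_def]
    have gX: "\<gamma> p t \<in> X" if "p \<in> P" "t \<le> L" for p t using bl(1)[OF that that(2)] by (simp add: \<gamma>_def)
    have geo: "rho (\<gamma> p s) (\<gamma> p t) = 2 * \<bar>int s - int t\<bar>" if "p \<in> P" "s \<le> L" "t \<le> L" for p s t
      using bl(2)[OF that] by (simp add: \<gamma>_def)
    have dv1: "r1 * R ^ M dvd L" using dv dvd_mult_left unfolding N0_def by blast
    have r1K: "3 * int K < int r1"
    proof -
      have "E * 1 \<le> E * t0" using t0(1) by (intro mult_left_mono) auto
      then have "3 * K < r1" using E44 K unfolding r1_def by linarith
      then show ?thesis by simp
    qed
    have "\<exists>k<M. let r = r1 * R ^ k in
      real (\<Sum>i\<in>P. card {j. j < L div r \<and> \<not> vert (4 * int (r div E)) (\<phi> (\<gamma> i (j * r))) (\<phi> (\<gamma> i (Suc j * r)))})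
      \<le> \<theta>1 * card P * (L div r)"
    proof (rule coarse_differentiation[OF q _ _ _ r1K th(2) finP gX geo dv1])
      show "6 \<le> \<theta>1 * real R" using R th by (simp add: field_simps)
      show "6 * real_of_int (int K) * real R * real E \<le> \<theta>1 * real M" using M th by (simp add: field_simps)
      show "4 * int K \<le> int E" using E44 by simp
    qed auto
    then obtain k where k: "k < M" "real (\<Sum>i\<in>P. card {j. j < L div (r1 * R ^ k) \<and> \<not> vert (4 * int ((r1 * R ^ k) div E)) (\<phi> (\<gamma> i (j * (r1 * R ^ k)))) (\<phi> (\<gamma> i (Suc j * (r1 * R ^ k))))})
      \<le> \<theta>1 * card P * (L div (r1 * R ^ k))" unfolding Let_def by blast
    define r where "r = r1 * R ^ k"
    define t where "t = t0 * R ^ k"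
    define N where "N = L div r"
    have rt: "r = 4 * E * t" by (simp add: r_def r1_def t_def)
    have tge: "t0 \<le> t" using Rpos by (simp add: t_def)
    have rdE: "4 * int (r div E) = int (16 * t)" using Epos by (simp add: rt)
    have rpos: "0 < r" using Epos t0(1) tge by (simp add: rt)
    have "R ^ k dvd R ^ M" using k(1) by (intro le_imp_power_dvd) simp
    then have rdv: "r * B dvd N0" unfolding r_def N0_def by (intro mult_dvd_mono) auto
    then have "r * B dvd L" using dv by (rule dvd_trans)
    then obtain c where c: "L = r * B * c" by (rule dvdE)
    have NL: "N * r = L" and BN: "B \<le> N" using c rpos Lpos by (auto simp: N_def)
    have Npos: "0 < N" using BN Bpos by simp
    define nv where "nv p j \<longleftrightarrow> \<not> vert (int (16 * t)) (\<phi> (\<gamma> p (j * r))) (\<phi> (\<gamma> p (Suc j * r)))" for p j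
    define fl where "fl p j \<longleftrightarrow> flip (int (16 * t)) (\<phi> (\<gamma> p (j * r))) (\<phi> (\<gamma> p (Suc j * r)))" for p j
    have nvs: "(\<Sum>p\<in>P. real (card {j. j < N \<and> nv p j})) \<le> \<theta>1 * card P * N"
      using k(2) unfolding r_def[symmetric] rdE nv_def N_def by simp
    have jr: "j * r \<le> L" if "j \<le> N" for j using mult_right_mono[OF that, of r] NL by simp
    have fl1: "real (card {p \<in> P. fl p j}) \<le> \<theta>1 * card P" if "j + 1 + 24 * K\<^sup>2 \<le> N" for j
    proof -
      have "(j + 1 + 24 * K\<^sup>2) * r \<le> L" using jr[OF that] .
      then have a: "j * r + 4 * E * t + 24 * K\<^sup>2 * (4 * E * t) \<le> L" unfolding rt[symmetric] by (simp add: algebra_simps)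
      have "int (Suc j * r) = int (j * r) + int (4 * E * t)" unfolding rt[symmetric] by simp
      then have "{p \<in> P. fl p j} = {p \<in> P. flip (int (16 * t)) (\<phi> (line (snd p) (fst p) (ht1 x0 + int (j * r))))
         (\<phi> (line (snd p) (fst p) (ht1 x0 + int (j * r) + int (4 * E * t))))}"
        unfolding fl_def \<gamma>_def by (simp only: add.assoc)
      then show ?thesis using t0(2)[OF tge q x0 y0 lev a] unfolding P_def[symmetric] cP by simp
    qed
    have "(\<Sum>p\<in>P. real (card {j. j < N \<and> fl p j})) = (\<Sum>j<N. real (card {p \<in> P. fl p j}))"
    proof -
      have "(\<Sum>p\<in>P. card {j. j < N \<and> fl p j}) = (\<Sum>p\<in>P. \<Sum>j<N. of_bool (fl p j))"
        by (simp only: card_filter_lessThan)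
      also have "\<dots> = (\<Sum>j<N. \<Sum>p\<in>P. of_bool (fl p j))" by (rule sum.swap)
      also have "\<dots> = (\<Sum>j<N. card {p \<in> P. fl p j})"
        using finP by (intro sum.cong) (auto simp: of_bool_def sum.If_cases Int_def)
      finally show ?thesis by (simp only: of_nat_sum[symmetric])
    qed
    also have "\<dots> \<le> (\<Sum>j<N. \<theta>1 * card P + (if j + 1 + 24 * K\<^sup>2 \<le> N then 0 else real (card P)))"
    proof (rule sum_mono)
      fix j assume "j \<in> {..<N}"
      have "card {p \<in> P. fl p j} \<le> card P" using finP by (intro card_mono) auto
      moreover have "0 \<le> \<theta>1 * card P" using th(2) by simp
      ultimately have "real (card {p \<in> P. fl p j}) \<le> \<theta>1 * card P + real (card P)" by linarith
      then show "real (card {p \<in> P. fl p j}) \<le> \<theta>1 * card P + (if j + 1 + 24 * K\<^sup>2 \<le> N then 0 else real (card P))"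
        using fl1[of j] by simp
    qed
    also have "\<dots> \<le> \<theta>1 * card P * N + 24 * K\<^sup>2 * card P"
    proof -
      let ?J = "{j \<in> {..<N}. \<not> j + 1 + 24 * K\<^sup>2 \<le> N}"
      have "(\<Sum>j<N. if j + 1 + 24 * K\<^sup>2 \<le> N then 0 else real (card P)) = (\<Sum>j<N. if \<not> j + 1 + 24 * K\<^sup>2 \<le> N then real (card P) else 0)"
        by (intro sum.cong refl) simp
      also have "\<dots> = (\<Sum>j\<in>?J. real (card P))" by (rule sum.inter_filter[symmetric]) simp
      also have "\<dots> = real (card ?J) * real (card P)" by simp
      also have "\<dots> \<le> real (24 * K\<^sup>2) * real (card P)"
      proof -
        have "?J \<subseteq> {N - 24 * K\<^sup>2..<N}" by auto
        then have "card ?J \<le> card {N - 24 * K\<^sup>2..<N}" by (intro card_mono) auto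
        then have "card ?J \<le> 24 * K\<^sup>2" by simp
        then have "real (card ?J) \<le> real (24 * K\<^sup>2)" by (simp only: of_nat_le_iff)
        then show ?thesis by (rule mult_right_mono) simp
      qed
      finally have "(\<Sum>j<N. if j + 1 + 24 * K\<^sup>2 \<le> N then 0 else real (card P)) \<le> real (24 * K\<^sup>2) * real (card P)" .
      moreover have "(\<Sum>j<N. \<theta>1 * card P) = \<theta>1 * card P * N" by simp
      ultimately show ?thesis unfolding sum.distrib by simp
    qed
    also have "\<dots> \<le> \<theta>1 * card P * N + \<theta>1 * card P * N"
    proof -
      have "24 * real (K\<^sup>2) / \<theta>1 \<le> B" "real B \<le> N" using B BN by auto
      then have "24 * real (K\<^sup>2) / \<theta>1 \<le> N" by linarith
      then have "24 * real (K\<^sup>2) \<le> \<theta>1 * N" using th(2) by (simp add: field_simps)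
      then have "24 * real (K\<^sup>2) * card P \<le> \<theta>1 * N * card P" by (intro mult_right_mono) auto
      then show ?thesis by (simp add: mult_ac)
    qed
    finally have fls: "(\<Sum>p\<in>P. real (card {j. j < N \<and> fl p j})) \<le> 2 * (\<theta>1 * card P * N)" by (simp only: mult_2)
    define bad where "bad p = {j. j < N \<and> (nv p j \<or> fl p j)}" for p
    have bads: "(\<Sum>p\<in>P. real (card (bad p))) \<le> \<theta> * \<theta>2 * card P * N"
    proof -
      have "real (card (bad p)) \<le> real (card {j. j < N \<and> nv p j}) + real (card {j. j < N \<and> fl p j})" for p
      proof -
        have "bad p = {j. j < N \<and> nv p j} \<union> {j. j < N \<and> fl p j}" by (auto simp: bad_def)
        then have "card (bad p) \<le> card {j. j < N \<and> nv p j} + card {j. j < N \<and> fl p j}" by (simp add: card_Un_le)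
        then show ?thesis by linarith
      qed
      then have "(\<Sum>p\<in>P. real (card (bad p))) \<le> (\<Sum>p\<in>P. real (card {j. j < N \<and> nv p j}) + real (card {j. j < N \<and> fl p j}))"
        by (rule sum_mono)
      also have "\<dots> \<le> 3 * (\<theta>1 * card P * N)" using nvs fls by (simp add: sum.distrib)
      finally show ?thesis by (simp add: \<theta>1_def)
    qed
    \<comment> \<open>Markov's inequality: at most a fraction \<open>\<theta>\<close> of the lines
      has more than a fraction \<open>\<theta>2\<close> of bad pieces.\<close>
    define W where "W = {p \<in> P. \<theta>2 * N < real (card (bad p))}"
    have "(\<Sum>p\<in>W. \<theta>2 * N) \<le> (\<Sum>p\<in>W. real (card (bad p)))" by (intro sum_mono) (auto simp: W_def)
    also have "\<dots> \<le> (\<Sum>p\<in>P. real (card (bad p)))" using finP by (intro sum_mono2) (auto simp: W_def)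
    finally have "real (card W) * (\<theta>2 * N) \<le> \<theta> * \<theta>2 * card P * N" using bads by simp
    then have "real (card W) * (\<theta>2 * N) \<le> (\<theta> * card P) * (\<theta>2 * N)" by (simp add: mult_ac)
    then have cW: "real (card W) \<le> \<theta> * card P" using th(1) Npos by (simp only: mult_le_cancel_right_pos mult_pos_pos of_nat_0_less_iff)
    have good: "upright (\<eta> * L) (\<phi> (x0, fst p)) (\<phi> (snd p, y0))" if p: "p \<in> P" "p \<notin> W" for p
    proof -
      define z where "z j = \<phi> (\<gamma> p (j * r))" for j
      have zX: "z j \<in> X" if "j \<le> N" for j using gX[OF p(1) jr[OF that]] qiD(2)[OF q] by (simp add: z_def)
      have z0: "z 0 = \<phi> (x0, fst p)" and zN: "z N = \<phi> (snd p, y0)"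
        using bl(3,4)[OF p(1), of 0 0] NL by (auto simp: z_def \<gamma>_def)
      have step: "rho (z j) (z (Suc j)) \<le> 2 * (h (z (Suc j)) - h (z j)) + 2 * int (16 * t) + (if j \<in> bad p then 2 * (int K * (2 * int r + 1)) else 0)"
        if j: "j < N" for j
      proof (cases "j \<in> bad p")
        case False
        then have v: "vert (int (16 * t)) (z j) (z (Suc j))" and nf: "\<not> flip (int (16 * t)) (z j) (z (Suc j))"
          using j by (auto simp: bad_def nv_def fl_def z_def)
        then have "h (z j) < h (z (Suc j))" by (auto simp: flip_def)
        then show ?thesis using vert_rho[OF v] False by simp
      next
        case True
        have "rho (z j) (z (Suc j)) \<le> int K * (rho (\<gamma> p (j * r)) (\<gamma> p (Suc j * r)) + 1)"
          unfolding z_def using gX[OF p(1)] jr[of j] jr[of "Suc j"] j by (intro qiD(4)[OF q]) auto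
        also have "rho (\<gamma> p (j * r)) (\<gamma> p (Suc j * r)) = 2 * int r"
          using geo[OF p(1), of "j * r" "Suc j * r"] jr[of j] jr[of "Suc j"] j by simp
        finally have "rho (z j) (z (Suc j)) \<le> int K * (2 * int r + 1)" .
        moreover have "2 * \<bar>h (z j) - h (z (Suc j))\<bar> \<le> rho (z j) (z (Suc j))" using zX j by (intro rho_ge_h) auto
        moreover have "x \<le> 2 * (b - a) + 2 * int (16 * t) + 2 * A" if "x \<le> A" "2 * \<bar>a - b\<bar> \<le> x" for x a b A :: int
          using that by arith
        ultimately show ?thesis unfolding if_P[OF True] by blast
      qed
      have "rho (z 0) (z N) \<le> (\<Sum>j<N. rho (z j) (z (Suc j)))" using zX by (rule rho_chain)
      also have "\<dots> \<le> (\<Sum>j<N. 2 * (h (z (Suc j)) - h (z j)) + 2 * int (16 * t) + (if j \<in> bad p then 2 * (int K * (2 * int r + 1)) else 0))"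
        using step by (intro sum_mono) auto
      also have "\<dots> = 2 * (h (z N) - h (z 0)) + int N * (2 * int (16 * t)) + int (card (bad p)) * (2 * (int K * (2 * int r + 1)))"
      proof -
        have "bad p = {j \<in> {..<N}. j \<in> bad p}" by (auto simp: bad_def)
        then have "(\<Sum>j<N. if j \<in> bad p then 2 * (int K * (2 * int r + 1)) else 0) = (\<Sum>j\<in>bad p. 2 * (int K * (2 * int r + 1)))"
          using sum.inter_filter[of "{..<N}" "\<lambda>_. 2 * (int K * (2 * int r + 1))" "\<lambda>j. j \<in> bad p"] by simp
        then have "(\<Sum>j<N. if j \<in> bad p then 2 * (int K * (2 * int r + 1)) else 0) = int (card (bad p)) * (2 * (int K * (2 * int r + 1)))"
          by simp
        moreover have "(\<Sum>j<N. 2 * (h (z (Suc j)) - h (z j))) = 2 * (h (z N) - h (z 0))"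
          unfolding sum_distrib_left[symmetric] by (simp only: sum_lessThan_telescope[of "\<lambda>j. h (z j)"])
        ultimately show ?thesis by (simp add: sum.distrib)
      qed
      finally have A: "rho (z 0) (z N) \<le> 2 * (h (z N) - h (z 0)) + int N * (2 * int (16 * t)) + int (card (bad p)) * (2 * (int K * (2 * int r + 1)))" .
      then have "real_of_int (rho (z 0) (z N)) \<le> real_of_int (2 * (h (z N) - h (z 0)) + int N * (2 * int (16 * t)) + int (card (bad p)) * (2 * (int K * (2 * int r + 1))))"
        by (simp only: of_int_le_iff)
      then have A: "real_of_int (rho (z 0) (z N)) \<le> 2 * real_of_int (h (z N) - h (z 0)) + N * (32 * real t) + real (card (bad p)) * (2 * (K * (2 * real r + 1)))"
        by simp
      have e1: "N * (32 * real t) \<le> \<eta> / 2 * L"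
      proof -
        have Lr: "real L = real N * (4 * real E * real t)" using NL rt by (metis of_nat_mult of_nat_numeral)
        have "8 \<le> \<eta> / 2 * E" using Eeta \<eta> by (simp add: field_simps)
        then have "8 * (real N * (4 * real t)) \<le> \<eta> / 2 * E * (real N * (4 * real t))" by (intro mult_right_mono) auto
        then show ?thesis unfolding Lr by (simp add: mult_ac)
      qed
      have e2: "real (card (bad p)) * (2 * (K * (2 * real r + 1))) \<le> \<eta> / 2 * L"
      proof -
        have "real (card (bad p)) \<le> \<theta>2 * N" using p by (simp add: W_def)
        moreover have "1 \<le> real r" using rpos by simp
        then have "2 * (K * (2 * real r + 1)) \<le> 2 * (K * (3 * real r))" by (intro mult_left_mono) auto
        ultimately have "real (card (bad p)) * (2 * (K * (2 * real r + 1))) \<le> \<theta>2 * N * (2 * (K * (3 * real r)))"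
          using th by (rule_tac mult_mono) auto
        also have "\<dots> = \<eta> / 2 * (real N * real r)" using K by (simp add: \<theta>2_def)
        also have "real N * real r = real L" using NL by (metis of_nat_mult)
        finally show ?thesis .
      qed
      show ?thesis using A e1 e2 unfolding upright_def z0 zN by linarith
    qed
    have "{p \<in> P. \<not> upright (\<eta> * L) (\<phi> (x0, fst p)) (\<phi> (snd p, y0))} \<subseteq> W" using good by blast
    then have "card {p \<in> P. \<not> upright (\<eta> * L) (\<phi> (x0, fst p)) (\<phi> (snd p, y0))} \<le> card W"
      using finP by (intro card_mono) (auto simp: W_def)
    then have "real (card {p \<in> P. \<not> upright (\<eta> * L) (\<phi> (x0, fst p)) (\<phi> (snd p, y0))}) \<le> \<theta> * card P"
      using cW by linarith
    then show "real (card {p \<in> T2.desc L y0 \<times> T1.desc L x0. \<not> upright (\<eta> * L) (\<phi> (x0, fst p)) (\<phi> (snd p, y0))})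
       \<le> \<theta> * (real m ^ L * real n ^ L)" unfolding P_def cP[symmetric, unfolded P_def] by simp
  qed
qed

text \<open>Fix a top point \<open>b\<close> such that the images of most \<open>a\<close> are upright below that of \<open>b\<close>. If
  such an image is also vertically above \<open>\<phi> z\<close>, then it is close to the vertical segment from
  \<open>\<phi> z\<close> to \<open>\<phi> b\<close>, which leaves exponentially fewer than \<open>n ^ r\<close> choices.\<close>

lemma up_pairs_rare:
  fixes K E Q :: nat and \<delta> :: real
  assumes K: "1 \<le> K" and \<delta>: "0 < \<delta>" and Q: "real gam ^ (2 * K) \<le> (3 / 2) ^ Q" "K \<le> Q" "1 \<le> Q" and E: "8 * Q \<le> E"
  shows "\<exists>N0>0. \<exists>r0. \<forall>\<phi> \<psi> z r. qi (int K) \<phi> \<psi> \<longrightarrow> z \<in> X \<longrightarrow> N0 dvd r \<longrightarrow> r0 \<le> r \<longrightarrow>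
    real (card {a \<in> T2.desc r (snd z). vert (4 * int (r div E)) (\<phi> z) (\<phi> (T1.anc (h z - int r) (fst z), a))
       \<and> h (\<phi> z) \<le> h (\<phi> (T1.anc (h z - int r) (fst z), a))}) \<le> \<delta> * real n ^ r"
proof -
  \<comment> \<open>\<open>Q\<close> is the precision at which counting wins: a fibre of
    \<open>\<phi>\<close> over a ball of radius \<open>r div Q\<close> has at most a constant times
    \<open>(3/2) ^ r\<close> points, against \<open>n ^ r \<ge> 2 ^ r\<close> candidates. Half of
    \<open>r / Q\<close> is granted to uprightness by \<open>\<eta>\<close>, half to verticality by
    \<open>E \<ge> 8 * Q\<close>.\<close>
  define \<eta> where "\<eta> = 1 / (2 * real Q)"
  have \<eta>: "0 < \<eta>" using Q by (simp add: \<eta>_def)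
  have Epos: "0 < E" using E Q by simp
  have \<delta>2: "0 < \<delta> / 2" using \<delta> by simp
  from upright_boxes[OF K \<eta> \<delta>2] obtain N0 where N0: "0 < N0"
    and box0: "\<forall>\<phi> \<psi> x0 y0 L. qi (int K) \<phi> \<psi> \<longrightarrow> x0 \<in> V1 \<longrightarrow> y0 \<in> V2 \<longrightarrow>
     ht2 y0 = - (ht1 x0 + int L) \<longrightarrow> 0 < L \<longrightarrow> N0 dvd L \<longrightarrow>
     real (card {p \<in> T2.desc L y0 \<times> T1.desc L x0. \<not> upright (\<eta> * L) (\<phi> (x0, fst p)) (\<phi> (snd p, y0))})
       \<le> \<delta> / 2 * (real m ^ L * real n ^ L)" by (elim exE conjE) assumption
  note box = box0[rule_format]
  define C where "C = 4 * real K * real gam ^ (3 * K)"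
  have "(\<lambda>r. C * (real r * (3 / 4) ^ r)) \<longlonglongrightarrow> C * 0"
    by (intro tendsto_intros powser_times_n_limit_0) simp
  then have "\<forall>\<^sub>F r in sequentially. C * (real r * (3 / 4) ^ r) < \<delta> / 2"
    using \<delta> by (intro order_tendstoD(2)) auto
  then obtain r1 where r1: "\<And>r. r1 \<le> r \<Longrightarrow> C * (real r * (3 / 4) ^ r) < \<delta> / 2"
    by (auto simp: eventually_sequentially)
  show ?thesis
  proof (rule exI[of _ N0], intro conjI exI[of _ "max r1 (4 * K)"] allI impI)
    fix \<phi> \<psi> z and r :: nat
    assume q: "qi (int K) \<phi> \<psi>" and z: "z \<in> X" and dv: "N0 dvd r" and r: "max r1 (4 * K) \<le> r"
    have rpos: "0 < r" and r4: "4 * K \<le> r" using r K by auto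
    define e where "e = 4 * int (r div E)"
    define x0 where "x0 = T1.anc (h z - int r) (fst z)"
    define y0 where "y0 = snd z"
    have x0: "x0 \<in> V1" "ht1 x0 = h z - int r" and y0: "y0 \<in> V2" "ht2 y0 = - h z"
      using XD[OF z] by (auto simp: x0_def y0_def)
    have zx: "fst z \<in> T1.desc r x0"
      using T1.mem_desc_anc[OF XD(1)[OF z], of r r] XD(3)[OF z] by (simp add: x0_def)
    have lev: "ht2 y0 = - (ht1 x0 + int r)" using x0 y0 by simp
    let ?A = "T2.desc r y0" and ?B = "T1.desc r x0"
    define G where "G b = {a \<in> ?A. \<not> upright (\<eta> * r) (\<phi> (x0, a)) (\<phi> (b, y0))}" for b
    have finA: "finite ?A" and finB: "finite ?B" using x0 y0 by auto
    have "\<exists>b\<in>?B. real (card (G b)) \<le> \<delta> / 2 * real n ^ r"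
    proof (rule ccontr)
      assume "\<not> ?thesis"
      then have "(\<Sum>b\<in>?B. \<delta> / 2 * real n ^ r) < (\<Sum>b\<in>?B. real (card (G b)))"
        using finB T1.desc_ne[OF x0(1)] by (intro sum_strict_mono) (auto simp: not_le)
      also have "\<dots> = real (card (SIGMA b:?B. G b))"
        using finB finA by (subst card_SigmaI) (auto simp: G_def)
      also have "card (SIGMA b:?B. G b) \<le> card {p \<in> ?A \<times> ?B. \<not> upright (\<eta> * r) (\<phi> (x0, fst p)) (\<phi> (snd p, y0))}"
        using finA finB by (intro card_inj_on_le[of prod.swap]) (auto simp: G_def inj_on_def)
      also have "real (card {p \<in> ?A \<times> ?B. \<not> upright (\<eta> * r) (\<phi> (x0, fst p)) (\<phi> (snd p, y0))}) \<le> \<delta> / 2 * (real m ^ r * real n ^ r)"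
        by (rule box[OF q x0(1) y0(1) lev rpos dv])
      finally show False using x0(1) by (simp add: mult_ac)
    qed
    then obtain b where b: "b \<in> ?B" "real (card (G b)) \<le> \<delta> / 2 * real n ^ r" by blast
    have bX: "(b, y0) \<in> X" using T1.descD[OF b(1)] lev y0 by (simp add: X_def)
    have aX: "(x0, a) \<in> X" if "a \<in> ?A" for a using T2.descD[OF that] lev x0 by (simp add: X_def)
    have zy: "z = (fst z, y0)" by (simp add: y0_def)
    have phX: "\<phi> z \<in> X" "\<phi> (b, y0) \<in> X" using qiD(2)[OF q] z bX by auto
    define U where "U = {a \<in> ?A. vert e (\<phi> z) (\<phi> (x0, a)) \<and> h (\<phi> z) \<le> h (\<phi> (x0, a))}"
    \<comment> \<open>Being upright below \<open>\<phi> (b, y0)\<close> fixes the first coordinate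
      of the image up to a small error, being vertically above \<open>\<phi> z\<close> fixes the
      second. Only the height \<open>c\<close> remains free, with at most \<open>4 * K * r\<close>
      values.\<close>
    define pt where "pt c = line (fst (\<phi> (b, y0))) (snd (\<phi> z)) c" for c
    have key: "h (\<phi> (x0, a)) \<le> h (\<phi> (b, y0)) \<and> rho (\<phi> (x0, a)) (pt (h (\<phi> (x0, a)))) \<le> int (r div Q)"
      if a: "a \<in> U - G b" for a
    proof -
      have aA: "a \<in> ?A" and v: "vert e (\<phi> z) (\<phi> (x0, a))" and hz: "h (\<phi> z) \<le> h (\<phi> (x0, a))"
        and up: "upright (\<eta> * r) (\<phi> (x0, a)) (\<phi> (b, y0))" using a by (auto simp: U_def G_def)
      let ?a = "\<phi> (x0, a)" and ?b = "\<phi> (b, y0)"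
      have paX: "?a \<in> X" using qiD(2)[OF q aX[OF aA]] .
      have rab: "rho (x0, a) (b, y0) = 2 * int r"
        using T1.td_anc[of b "ht1 x0"] T1.descD[OF b(1)] T2.td_anc[of a "ht2 y0"] T2.descD[OF aA] x0 y0
        by (simp add: rho_def T1.td_commute)
      have "2 * int r \<le> int K * (rho ?a ?b + 3)" using qi_lower[OF q aX[OF aA] bX] rab by simp
      then have "real_of_int (2 * int r) \<le> real_of_int (int K * (rho ?a ?b + 3))" by (simp only: of_int_le_iff)
      then have lo: "2 * real r \<le> K * (real_of_int (rho ?a ?b) + 3)" by simp
      have up': "real_of_int (rho ?a ?b) \<le> 2 * real_of_int (h ?b - h ?a) + \<eta> * r" using up by (simp add: upright_def)
      \<comment> \<open>Otherwise uprightness would bring the two images within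
        \<open>\<eta> * r\<close>, too close for points at distance \<open>2 * r\<close>.\<close>
      have hab: "h ?a \<le> h ?b"
      proof (rule ccontr)
        assume "\<not> h ?a \<le> h ?b"
        then have "2 * real_of_int (h ?b - h ?a) + \<eta> * r \<le> \<eta> * r" by simp
        with up' have "real_of_int (rho ?a ?b) \<le> \<eta> * r" by (rule order_trans)
        then have "2 * real r \<le> K * (\<eta> * r + 3)" using lo mult_left_mono[of "real_of_int (rho ?a ?b) + 3" "\<eta> * r + 3" "real K"] by simp
        moreover have "K * (\<eta> * r) \<le> r / 2"
        proof -
          have "K * \<eta> \<le> 1 / 2" using Q by (simp add: \<eta>_def field_simps)
          then have "K * \<eta> * r \<le> 1 / 2 * r" by (intro mult_right_mono) auto
          then show ?thesis by (simp add: mult_ac)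
        qed
        moreover have "3 * real K < 3 / 2 * real r" using r4 K by linarith
        moreover have "K * (\<eta> * r + 3) = K * (\<eta> * r) + 3 * real K" by (simp add: distrib_left)
        ultimately show False by linarith
      qed
      define t where "t = h ?a"
      note F = XD[OF paX] XD[OF phX(1)] XD[OF phX(2)]
      have p1: "fst (pt t) \<in> V1" "snd (pt t) \<in> V2" "ht1 (fst (pt t)) = t" "ht2 (snd (pt t)) = - t"
        using F hab hz by (auto simp: pt_def line_def t_def)
      have m1: "T1.mt (fst ?b) (fst (pt t)) = t"
        using T1.td_anc[of "fst ?b" t] F hab p1 by (simp add: pt_def line_def T1.td_def t_def)
      have m2: "T2.mt (snd (\<phi> z)) (snd (pt t)) = - t"
        using T2.td_anc[of "snd (\<phi> z)" "- t"] F hz p1 by (simp add: pt_def line_def T2.td_def t_def)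
      define w1 where "w1 = T1.mt (fst ?a) (fst ?b)"
      define w2 where "w2 = T2.mt (snd ?a) (snd (\<phi> z))"
      have "T1.td (fst ?a) (fst ?b) = t + h ?b - 2 * w1" using F by (simp add: T1.td_def w1_def t_def)
      moreover have "h ?b - t \<le> T2.td (snd ?a) (snd ?b)" using td2_ge_h[OF paX phX(2)] by (simp add: t_def)
      ultimately have "t + h ?b - 2 * w1 + (h ?b - t) \<le> rho ?a ?b" by (simp add: rho_def)
      then have "real_of_int (t + h ?b - 2 * w1 + (h ?b - t)) \<le> real_of_int (rho ?a ?b)" by (simp only: of_int_le_iff)
      then have W1: "2 * real_of_int t - 2 * real_of_int w1 \<le> \<eta> * r" using up' by (simp add: t_def)
      have "T2.td (snd (\<phi> z)) (snd ?a) = - h (\<phi> z) - t - 2 * w2"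
        using F T2.mt_commute[of "snd (\<phi> z)" "snd ?a"] by (simp add: T2.td_def w2_def t_def)
      then have W2: "- 2 * t - 2 * w2 \<le> e" using v hz unfolding vert_def t_def by linarith
      have "w1 \<le> t" using T1.mt_le1[OF F(1) F(9)] F(3) by (simp add: w1_def t_def)
      then have "w1 \<le> T1.mt (fst ?b) (fst (pt t))" using m1 by simp
      then have "w1 \<le> T1.mt (fst ?a) (fst (pt t))"
        by (rule T1.mt_ultra[OF F(1) F(9) p1(1), rotated]) (simp add: w1_def)
      then have "T1.td (fst ?a) (fst (pt t)) \<le> 2 * t - 2 * w1" using F p1 by (simp add: T1.td_def t_def)
      moreover have "w2 \<le> T2.mt (snd (\<phi> z)) (snd (pt t))"
        using T2.mt_le1[OF F(2) F(6)] F(4) m2 by (simp add: w2_def t_def)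
      then have "w2 \<le> T2.mt (snd ?a) (snd (pt t))"
        by (rule T2.mt_ultra[OF F(2) F(6) p1(2), rotated]) (simp add: w2_def)
      then have "T2.td (snd ?a) (snd (pt t)) \<le> - 2 * t - 2 * w2" using F p1 by (simp add: T2.td_def t_def)
      ultimately have "rho ?a (pt t) \<le> 2 * t - 2 * w1 + e" using W2 by (simp add: rho_def)
      then have "real_of_int (rho ?a (pt t)) \<le> real_of_int (2 * t - 2 * w1 + e)" by (simp only: of_int_le_iff)
      also have "\<dots> \<le> \<eta> * r + real_of_int e" using W1 by simp
      also have "\<dots> \<le> real r / real Q"
      proof -
        have "e \<le> 4 * int (r div (8 * Q))" unfolding e_def using div_le_mono2[OF _ E, of r] Q by simp
        then have "real_of_int e \<le> 4 * real (r div (8 * Q))" by linarith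
        also have "real (r div (8 * Q)) \<le> real r / real (8 * Q)" by (rule of_nat_div_le_of_nat)
        finally have "real_of_int e \<le> real r / (2 * real Q)" by simp
        then show ?thesis using Q by (simp add: \<eta>_def field_simps)
      qed
      finally have "rho ?a (pt t) \<le> \<lfloor>real r / real Q\<rfloor>" by (simp add: le_floor_iff)
      also have "\<dots> = int (r div Q)" by (rule floor_divide_of_nat_eq)
      finally show ?thesis using hab by (simp add: t_def)
    qed
    define lo where "lo = h (\<phi> z)"
    define hi where "hi = h (\<phi> (b, y0))"
    have card_lohi: "real (card {lo..hi}) \<le> 4 * real K * real r"
    proof -
      have "T1.td (fst z) b \<le> 2 * int r"
        using T1.td_triangle[of "fst z" x0 b] T1.td_anc[of "fst z" "ht1 x0"] T1.td_anc[of b "ht1 x0"]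
          T1.descD[OF zx] T1.descD[OF b(1)] x0 by (simp add: T1.td_commute[of x0 b])
      then have "rho z (b, y0) \<le> 2 * int r" using y0 by (simp add: rho_def y0_def)
      then have "int K * (rho z (b, y0) + 1) \<le> int K * (2 * int r + 1)" by (intro mult_left_mono) auto
      then have "2 * \<bar>lo - hi\<bar> \<le> int K * (2 * int r + 1)"
        using rho_ge_h[OF phX] qiD(4)[OF q z bX] by (simp add: lo_def hi_def)
      moreover have "int K * (2 * int r + 1) \<le> int K * (3 * int r)" using rpos by (intro mult_left_mono) auto
      ultimately have A: "2 * \<bar>lo - hi\<bar> \<le> 3 * (int K * int r)" by simp
      have "1 * 1 \<le> int K * int r" using K rpos by (intro mult_mono) auto
      moreover have "u + 1 \<le> 4 * x" if "2 * \<bar>- u\<bar> \<le> 3 * x" "1 * 1 \<le> x" for u x :: int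
        using that by arith
      ultimately have "hi - lo + 1 \<le> 4 * (int K * int r)" using A by (metis minus_diff_eq)
      moreover have "0 \<le> 4 * (int K * int r)" by simp
      ultimately have "int (card {lo..hi}) \<le> 4 * (int K * int r)" by simp
      then have "real_of_int (int (card {lo..hi})) \<le> real_of_int (4 * (int K * int r))" by (simp only: of_int_le_iff)
      then show ?thesis by (simp only: of_int_of_nat_eq of_int_mult of_int_numeral mult.assoc)
    qed
    let ?Fib = "\<lambda>c. {p \<in> X. rho (\<phi> p) (pt c) \<le> int (r div Q)}"
    have ptX: "pt c \<in> X" if "c \<in> {lo..hi}" for c
      unfolding pt_def
      using that XD[OF phX(1)] XD[OF phX(2)] by (intro line_in) (simp_all add: lo_def hi_def)
    have "(\<lambda>a. (x0, a)) ` (U - G b) \<subseteq> (\<Union>c\<in>{lo..hi}. ?Fib c)"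
    proof
      fix p assume "p \<in> (\<lambda>a. (x0, a)) ` (U - G b)"
      then obtain a where a: "a \<in> U - G b" "p = (x0, a)" by blast
      have "h (\<phi> p) \<in> {lo..hi}" "p \<in> ?Fib (h (\<phi> p))"
        using key[OF a(1)] a aX by (auto simp: U_def lo_def hi_def)
      then show "p \<in> (\<Union>c\<in>{lo..hi}. ?Fib c)" by blast
    qed
    then have "card ((\<lambda>a. (x0, a)) ` (U - G b)) \<le> card (\<Union>c\<in>{lo..hi}. ?Fib c)"
      using qi_fibre(1)[OF q ptX] by (intro card_mono finite_UN_I) auto
    also have "\<dots> \<le> card {lo..hi} * gam ^ (K * (2 * (r div Q) + 3))"
      using qi_fibre(2)[OF q ptX, of _ "r div Q"] by (intro card_UN_le_const) auto
    also have "card ((\<lambda>a. (x0, a)) ` (U - G b)) = card (U - G b)" by (intro card_image inj_onI) simp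
    finally have "real (card (U - G b)) \<le> real (card {lo..hi} * gam ^ (K * (2 * (r div Q) + 3)))" by (simp only: of_nat_le_iff)
    also have "\<dots> = real (card {lo..hi}) * real gam ^ (K * (2 * (r div Q) + 3))" by simp
    also have "\<dots> \<le> (4 * real K * real r) * (real gam ^ (3 * K) * (3 / 2) ^ r)"
    proof (rule mult_mono[OF card_lohi])
      have "real gam ^ (K * (2 * (r div Q) + 3)) = real gam ^ (3 * K) * (real gam ^ (2 * K)) ^ (r div Q)"
        by (simp add: algebra_simps flip: power_add power_mult)
      also have "(real gam ^ (2 * K)) ^ (r div Q) \<le> ((3 / 2) ^ Q) ^ (r div Q)" using Q by (intro power_mono) auto
      also have "\<dots> = (3 / 2) ^ (Q * (r div Q))" by (simp add: power_mult)
      also have "\<dots> \<le> (3 / 2) ^ r" by (intro power_increasing) auto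
      finally show "real gam ^ (K * (2 * (r div Q) + 3)) \<le> real gam ^ (3 * K) * (3 / 2) ^ r"
        by (simp add: mult_left_mono)
    qed auto
    also have "\<dots> = C * (real r * (3 / 4) ^ r) * 2 ^ r"
      by (simp add: C_def flip: power_mult_distrib)
    also have "\<dots> \<le> \<delta> / 2 * 2 ^ r" using r1[of r] r by (intro mult_right_mono) auto
    also have "\<dots> \<le> \<delta> / 2 * real n ^ r" using n_pos \<delta> by (intro mult_left_mono power_mono) auto
    finally have UG: "real (card (U - G b)) \<le> \<delta> / 2 * real n ^ r" .
    have "card U \<le> card ((U - G b) \<union> G b)" using finA by (intro card_mono) (auto simp: U_def G_def)
    also have "\<dots> \<le> card (U - G b) + card (G b)" by (rule card_Un_le)
    finally have "real (card U) \<le> real (card (U - G b)) + real (card (G b))" by linarith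
    then have "real (card U) \<le> \<delta> * real n ^ r" using UG b(2) by simp
    then show "real (card {a \<in> T2.desc r (snd z). vert (4 * int (r div E)) (\<phi> z) (\<phi> (T1.anc (h z - int r) (fst z), a))
       \<and> h (\<phi> z) \<le> h (\<phi> (T1.anc (h z - int r) (fst z), a))}) \<le> \<delta> * real n ^ r"
      by (simp only: U_def e_def x0_def y0_def)
  qed (rule N0)
qed

text \<open>The piece between depths \<open>s\<close> and \<open>s + r\<close> starts at one of
  \<open>n ^ s\<close> points. For each of them \<open>S\<close> bounds the bad lower ends, and
  every lower end has \<open>n ^ (T - (s + r))\<close> continuations.\<close>

lemma up_pieces_le:
  fixes r s T :: nat and \<delta> :: real
  assumes y: "y \<in> X" and sr: "s + r \<le> T"
    and S: "\<And>z. z \<in> X \<Longrightarrow> real (card {a \<in> T2.desc r (snd z). S z (T1.anc (h z - int r) (fst z), a)}) \<le> \<delta> * real n ^ r"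
  shows "real (card {a \<in> T2.desc T (snd y). S (line (fst y) a (h y - int s)) (line (fst y) a (h y - int (s + r)))})
    \<le> \<delta> * real n ^ T"
proof -
  define Z where "Z v = (T1.anc (h y - int s) (fst y), v)" for v :: 'b
  define U where "U v = {a \<in> T2.desc r v. S (Z v) (T1.anc (h (Z v) - int r) (fst (Z v)), a)}" for v
  have y2: "snd y \<in> V2" "ht2 (snd y) = - h y" and y1: "fst y \<in> V1" "ht1 (fst y) = h y" using XD[OF y] by auto
  have Z: "Z v \<in> X" "h (Z v) = h y - int s" if "v \<in> T2.desc s (snd y)" for v
    using T2.descD(1,2)[OF that] y1 y2 unfolding h_def[of "Z v"] by (simp_all add: Z_def X_def)
  have finL: "finite (T2.desc s (snd y))" "card (T2.desc s (snd y)) = n ^ s" using y2 by auto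
  have V: "v \<in> V2" if "v \<in> T2.desc s (snd y)" for v using T2.descD(1)[OF that] .
  have UV: "w \<in> V2" if "w \<in> U v" for v w using that T2.descD(1)[of w r v] by (simp add: U_def)
  have finU: "finite (U v)" if "v \<in> V2" for v using that by (simp add: U_def)
  let ?W = "{a \<in> T2.desc T (snd y). S (line (fst y) a (h y - int s)) (line (fst y) a (h y - int (s + r)))}"
  let ?C = "\<lambda>v. \<Union>w\<in>U v. T2.desc (T - (s + r)) w"
  have sub: "?W \<subseteq> (\<Union>v\<in>T2.desc s (snd y). ?C v)"
  proof
    fix a assume "a \<in> ?W"
    then have a: "a \<in> T2.desc T (snd y)" and Sa: "S (line (fst y) a (h y - int s)) (line (fst y) a (h y - int (s + r)))" by auto
    have hv: "- (h y - int s) = ht2 (snd y) + int s" "- (h y - int (s + r)) = ht2 (snd y) + int (s + r)" using y2 by auto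
    define v where "v = T2.anc (- (h y - int s)) a"
    define w where "w = T2.anc (- (h y - int (s + r))) a"
    have v: "v \<in> T2.desc s (snd y)" unfolding v_def hv using sr by (intro T2.anc_mem_desc[OF a]) simp
    have w0: "w \<in> T2.desc (s + r) (snd y)" unfolding w_def hv using sr by (intro T2.anc_mem_desc[OF a]) simp
    have aV: "a \<in> V2" "ht2 a = - h y + int T" using T2.descD(1,2)[OF a] y2 by auto
    have wv: "T2.anc (- (h y - int s)) w = v" unfolding v_def w_def using aV sr by (intro T2.anc_anc) auto
    have wr: "w \<in> T2.desc r v"
      using T2.mem_desc_anc[OF T2.descD(1)[OF w0] order_refl, of r] T2.descD(2)[OF w0] wv y2 by simp
    have "a \<in> T2.desc (T - (s + r)) w"
      using T2.mem_desc_anc[OF aV(1) order_refl, of "T - (s + r)"] aV(2) sr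
      by (simp add: w_def of_nat_diff)
    moreover have "w \<in> U v"
    proof -
      have l1: "line (fst y) a (h y - int s) = Z v" by (simp add: line_def Z_def v_def)
      have "T1.anc (h (Z v) - int r) (fst (Z v)) = T1.anc (h y - int (s + r)) (fst y)"
        unfolding Z(2)[OF v] using y1 T1.anc_anc[OF y1(1), of "h y - int (s + r)" "h y - int s"]
        by (simp add: Z_def diff_diff_eq)
      then have "line (fst y) a (h y - int (s + r)) = (T1.anc (h (Z v) - int r) (fst (Z v)), w)"
        by (simp add: line_def w_def)
      then show ?thesis using wr Sa l1 by (simp add: U_def)
    qed
    ultimately show "a \<in> (\<Union>v\<in>T2.desc s (snd y). ?C v)" using v by blast
  qed
  have finC: "finite (?C v)" if "v \<in> T2.desc s (snd y)" for v
    using finU[OF V[OF that]] UV by (intro finite_UN_I) auto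
  have cC: "real (card (?C v)) \<le> \<delta> * real n ^ r * real n ^ (T - (s + r))" if "v \<in> T2.desc s (snd y)" for v
  proof -
    have "card (?C v) \<le> card (U v) * n ^ (T - (s + r))"
      using finU[OF V[OF that]] UV by (intro card_UN_le_const) auto
    then have "real (card (?C v)) \<le> real (card (U v) * n ^ (T - (s + r)))" by (simp only: of_nat_le_iff)
    also have "\<dots> = real (card (U v)) * real n ^ (T - (s + r))" by simp
    also have "\<dots> \<le> \<delta> * real n ^ r * real n ^ (T - (s + r))"
      using S[OF Z(1)[OF that]] by (intro mult_right_mono) (auto simp: U_def Z_def)
    finally show ?thesis .
  qed
  have "card ?W \<le> card (\<Union>v\<in>T2.desc s (snd y). ?C v)"
    by (rule card_mono[OF finite_UN_I[OF finL(1) finC] sub])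
  also have "\<dots> \<le> (\<Sum>v\<in>T2.desc s (snd y). card (?C v))" by (rule card_UN_le[OF finL(1)])
  finally have "real (card ?W) \<le> real (\<Sum>v\<in>T2.desc s (snd y). card (?C v))" by (simp only: of_nat_le_iff)
  also have "\<dots> \<le> (\<Sum>v\<in>T2.desc s (snd y). \<delta> * real n ^ r * real n ^ (T - (s + r)))"
    unfolding of_nat_sum by (intro sum_mono cC)
  also have "\<dots> = \<delta> * (real n ^ s * real n ^ r * real n ^ (T - (s + r)))" using finL by simp
  also have "real n ^ s * real n ^ r * real n ^ (T - (s + r)) = real n ^ T" using sr by (simp flip: power_add)
  finally show ?thesis .
qed

text \<open>Most pieces of most downward paths have vertical images that descend, so the height drops
  linearly along most paths.\<close>

lemma heights_descend:
  fixes K :: nat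
  assumes K: "1 \<le> K"
  shows "\<exists>T. \<forall>\<phi> \<psi> y. qi (int K) \<phi> \<psi> \<longrightarrow> y \<in> X \<longrightarrow>
    2 * real n ^ T \<le> (\<Sum>a\<in>T2.desc T (snd y).
      (real m / real n) powi (h (\<phi> y) - h (\<phi> (T1.anc (h y - int T) (fst y), a))))"
proof -
  \<comment> \<open>A good piece descends by at least \<open>r / (2 * K)\<close>, and a bad one
    loses at most \<open>4 * K * r\<close> against this. A fraction \<open>\<theta>2\<close> of bad
    pieces thus destroys at most half of the descent, and \<open>\<delta>\<close> makes that
    fraction be exceeded on at most half of the paths.\<close>
  define \<theta>2 where "\<theta>2 = 1 / (16 * (real K)\<^sup>2)"
  define \<delta> where "\<delta> = \<theta>2 / 4"
  have th: "0 < \<theta>2" "0 < \<delta>" using K by (auto simp: \<theta>2_def \<delta>_def)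
  obtain Q0 where Q0: "real gam ^ (2 * K) < (3 / 2) ^ Q0" using real_arch_pow[of "3 / 2 :: real"] by auto
  define Q where "Q = max Q0 K"
  have "(3 / 2 :: real) ^ Q0 \<le> (3 / 2) ^ Q" by (intro power_increasing) (auto simp: Q_def)
  then have Q1: "real gam ^ (2 * K) \<le> (3 / 2) ^ Q" using Q0 by linarith
  have Q23: "K \<le> Q" "1 \<le> Q" using K by (auto simp: Q_def)
  note Q = Q1 Q23
  define E where "E = 16 * Q"
  have E8: "8 * Q \<le> E" and E16: "16 * K \<le> E" using Q by (auto simp: E_def)
  from up_pairs_rare[OF K th(2) Q E8] obtain N0 r0 where N0: "0 < N0"
    and up0: "\<forall>\<phi> \<psi> z r. qi (int K) \<phi> \<psi> \<longrightarrow> z \<in> X \<longrightarrow> N0 dvd r \<longrightarrow> r0 \<le> r \<longrightarrow>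
    real (card {a \<in> T2.desc r (snd z). vert (4 * int (r div E)) (\<phi> z) (\<phi> (T1.anc (h z - int r) (fst z), a))
       \<and> h (\<phi> z) \<le> h (\<phi> (T1.anc (h z - int r) (fst z), a))}) \<le> \<delta> * real n ^ r"
    by (elim exE conjE) assumption
  note up = up0[rule_format]
  obtain R :: nat where R: "6 / \<delta> \<le> R" using real_arch_simple by blast
  obtain M :: nat where M: "6 * real K * R * E / \<delta> \<le> M" using real_arch_simple by blast
  have "1 < real m / real n" using n_less_m n_pos by simp
  \<comment> \<open>A descent by \<open>N1\<close> multiplies the weight by more than 4. Half of the
    paths descend at least that far, so the average is at least 2.\<close>
  then obtain N1 where N1: "4 < (real m / real n) ^ N1" using real_arch_pow by blast
  have Rpos: "0 < R" using R th by (cases "R = 0") (auto simp: field_simps)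
  define r1 where "r1 = N0 * (r0 + 6 * K + 4 * K * N1 + 1)"
  have r1ge: "r0 + 6 * K + 4 * K * N1 + 1 \<le> r1"
    using mult_le_mono1[of 1 N0 "r0 + 6 * K + 4 * K * N1 + 1"] N0 unfolding r1_def by simp
  \<comment> \<open>A common multiple of all scales in question, so that one \<open>T\<close> serves
    every map.\<close>
  define T where "T = r1 * R ^ M"
  have Tge: "r1 \<le> T" using Rpos by (simp add: T_def)
  show ?thesis
  proof (rule exI[of _ T], intro allI impI)
    fix \<phi> \<psi> y assume q: "qi (int K) \<phi> \<psi>" and y: "y \<in> X"
    note yy = XD[OF y]
    define P where "P = T2.desc T (snd y)"
    define \<gamma> where "\<gamma> a t = line (fst y) a (h y - int t)" for a :: 'b and t :: nat
    have finP: "finite P" and cP: "card P = n ^ T" using yy by (auto simp: P_def)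
    have PV: "a \<in> V2" "ht2 a = - h y + int T" "T2.anc (- h y) a = snd y" if "a \<in> P" for a
      using T2.descD[of a T "snd y"] that yy by (auto simp: P_def)
    have gX: "\<gamma> a t \<in> X" if "a \<in> P" "t \<le> T" for a t
      using that PV[OF that(1)] yy by (auto simp: \<gamma>_def intro!: line_in)
    have geo: "rho (\<gamma> a s) (\<gamma> a t) = 2 * \<bar>int s - int t\<bar>" if "a \<in> P" "s \<le> T" "t \<le> T" for a s t
      unfolding \<gamma>_def using that PV[OF that(1)] yy by (subst rho_line) auto
    have g0: "\<gamma> a 0 = y" if "a \<in> P" for a
      using PV(3)[OF that] yy T1.anc_self[of "fst y"] by (simp add: \<gamma>_def line_def)
    have gT: "\<gamma> a T = (T1.anc (h y - int T) (fst y), a)" if "a \<in> P" for a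
      using PV(2)[OF that] T2.anc_self[of a] by (simp add: \<gamma>_def line_def)
    have "\<exists>k<M. let r = r1 * R ^ k in
      real (\<Sum>i\<in>P. card {j. j < T div r \<and> \<not> vert (4 * int (r div E)) (\<phi> (\<gamma> i (j * r))) (\<phi> (\<gamma> i (Suc j * r)))})
      \<le> \<delta> * card P * (T div r)"
    proof (rule coarse_differentiation[OF q _ _ _ _ th(2) finP gX geo])
      show "6 \<le> \<delta> * real R" using R th by (simp add: field_simps)
      show "6 * real_of_int (int K) * real R * real E \<le> \<delta> * real M" using M th by (simp add: field_simps)
      show "4 * int K \<le> int E" using E16 by simp
      show "3 * int K < int r1" using r1ge K by simp
      show "r1 * R ^ M dvd T" by (simp add: T_def)
    qed auto
    then obtain k where k: "k < M" "real (\<Sum>i\<in>P. card {j. j < T div (r1 * R ^ k) \<and> \<not> vert (4 * int ((r1 * R ^ k) div E)) (\<phi> (\<gamma> i (j * (r1 * R ^ k)))) (\<phi> (\<gamma> i (Suc j * (r1 * R ^ k))))})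
      \<le> \<delta> * card P * (T div (r1 * R ^ k))" unfolding Let_def by blast
    define r where "r = r1 * R ^ k"
    define e where "e = 4 * int (r div E)"
    define N where "N = T div r"
    have rge: "r1 \<le> r" using Rpos by (simp add: r_def)
    have N0r: "N0 dvd r" by (simp add: r_def r1_def mult.assoc)
    have r0r: "r0 \<le> r" and r6: "6 * K \<le> r" and rpos: "0 < r" using rge r1ge by auto
    have "R ^ k dvd R ^ M" using k(1) by (intro le_imp_power_dvd) simp
    then have "r dvd T" unfolding r_def T_def by (rule mult_dvd_mono[OF dvd_refl])
    then have NT: "N * r = T" by (simp add: N_def)
    define nv where "nv a j \<longleftrightarrow> \<not> vert e (\<phi> (\<gamma> a (j * r))) (\<phi> (\<gamma> a (Suc j * r)))" for a j
    define ups where "ups a j \<longleftrightarrow> vert e (\<phi> (\<gamma> a (j * r))) (\<phi> (\<gamma> a (Suc j * r))) \<and> h (\<phi> (\<gamma> a (j * r))) \<le> h (\<phi> (\<gamma> a (Suc j * r)))" for a j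
    have nvs: "(\<Sum>a\<in>P. real (card {j. j < N \<and> nv a j})) \<le> \<delta> * card P * N"
      using k(2) unfolding r_def[symmetric] nv_def N_def e_def by simp
    have jr: "j * r \<le> T" if "j \<le> N" for j using mult_right_mono[OF that, of r] NT by simp
    have up1: "real (card {a \<in> P. ups a j}) \<le> \<delta> * card P" if "j < N" for j
    proof -
      have "j * r + r \<le> T" using jr[of "Suc j"] that by simp
      from up_pieces_le[OF y this, of "\<lambda>p q. vert e (\<phi> p) (\<phi> q) \<and> h (\<phi> p) \<le> h (\<phi> q)" \<delta>] up[OF q _ N0r r0r, folded e_def]
      have "real (card {a \<in> P. vert e (\<phi> (line (fst y) a (h y - int (j * r)))) (\<phi> (line (fst y) a (h y - int (j * r + r)))) \<and>
          h (\<phi> (line (fst y) a (h y - int (j * r)))) \<le> h (\<phi> (line (fst y) a (h y - int (j * r + r))))}) \<le> \<delta> * real n ^ T"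
        unfolding P_def by blast
      moreover have "j * r + r = Suc j * r" by simp
      ultimately show ?thesis unfolding ups_def \<gamma>_def cP by simp
    qed
    have "(\<Sum>a\<in>P. real (card {j. j < N \<and> ups a j})) = (\<Sum>j<N. real (card {a \<in> P. ups a j}))"
    proof -
      have "(\<Sum>a\<in>P. card {j. j < N \<and> ups a j}) = (\<Sum>a\<in>P. \<Sum>j<N. of_bool (ups a j))"
        by (simp only: card_filter_lessThan)
      also have "\<dots> = (\<Sum>j<N. \<Sum>a\<in>P. of_bool (ups a j))" by (rule sum.swap)
      also have "\<dots> = (\<Sum>j<N. card {a \<in> P. ups a j})"
        using finP by (intro sum.cong) (auto simp: of_bool_def sum.If_cases Int_def)
      finally show ?thesis by (simp only: of_nat_sum[symmetric])
    qed
    also have "\<dots> \<le> (\<Sum>j<N. \<delta> * card P)" using up1 by (intro sum_mono) auto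
    also have "\<dots> = \<delta> * card P * N" by simp
    finally have upsum: "(\<Sum>a\<in>P. real (card {j. j < N \<and> ups a j})) \<le> \<delta> * card P * N" .
    define bad where "bad a = {j. j < N \<and> (nv a j \<or> ups a j)}" for a
    have bads: "(\<Sum>a\<in>P. real (card (bad a))) \<le> 2 * (\<delta> * card P * N)"
    proof -
      have "real (card (bad a)) \<le> real (card {j. j < N \<and> nv a j}) + real (card {j. j < N \<and> ups a j})" for a
      proof -
        have "bad a = {j. j < N \<and> nv a j} \<union> {j. j < N \<and> ups a j}" by (auto simp: bad_def)
        then have "card (bad a) \<le> card {j. j < N \<and> nv a j} + card {j. j < N \<and> ups a j}" by (simp add: card_Un_le)
        then show ?thesis by linarith
      qed
      then have "(\<Sum>a\<in>P. real (card (bad a))) \<le> (\<Sum>a\<in>P. real (card {j. j < N \<and> nv a j}) + real (card {j. j < N \<and> ups a j}))"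
        by (rule sum_mono)
      also have "\<dots> \<le> 2 * (\<delta> * card P * N)" using nvs upsum by (simp add: sum.distrib)
      finally show ?thesis .
    qed
    have Npos: "0 < N" using NT Tge r1ge by (cases "N = 0") auto
    define W where "W = {a \<in> P. \<theta>2 * N < real (card (bad a))}"
    have "(\<Sum>a\<in>W. \<theta>2 * N) \<le> (\<Sum>a\<in>W. real (card (bad a)))" by (intro sum_mono) (auto simp: W_def)
    also have "\<dots> \<le> (\<Sum>a\<in>P. real (card (bad a)))" using finP by (intro sum_mono2) (auto simp: W_def)
    finally have "real (card W) * (\<theta>2 * N) \<le> (card P / 2) * (\<theta>2 * N)" using bads by (simp add: \<delta>_def mult_ac)
    then have cW: "real (card W) \<le> card P / 2"
      using th(1) Npos by (simp only: mult_le_cancel_right_pos mult_pos_pos of_nat_0_less_iff)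
    have good: "int (T div (4 * K)) \<le> h (\<phi> y) - h (\<phi> (T1.anc (h y - int T) (fst y), a))" if a: "a \<in> P" "a \<notin> W" for a
    proof -
      define z where "z j = \<phi> (\<gamma> a (j * r))" for j
      have zX: "z j \<in> X" if "j \<le> N" for j using gX[OF a(1) jr[OF that]] qiD(2)[OF q] by (simp add: z_def)
      have z0: "z 0 = \<phi> y" and zN: "z N = \<phi> (T1.anc (h y - int T) (fst y), a)"
        using g0[OF a(1)] gT[OF a(1)] NT by (auto simp: z_def)
      have step: "real r / (2 * K) - (if j \<in> bad a then 4 * (real K * real r) else 0) \<le> real_of_int (h (z j) - h (z (Suc j)))"
        if j: "j < N" for j
      proof -
        have jN: "j \<le> N" "Suc j \<le> N" using j by auto
        have gXj: "\<gamma> a (j * r) \<in> X" "\<gamma> a (Suc j * r) \<in> X" using gX[OF a(1) jr[OF jN(1)]] gX[OF a(1) jr[OF jN(2)]] by blast+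
        have rg: "rho (\<gamma> a (j * r)) (\<gamma> a (Suc j * r)) = 2 * int r"
          using geo[OF a(1) jr[OF jN(1)] jr[OF jN(2)]] by simp
        show ?thesis
        proof (cases "j \<in> bad a")
          case False
          then have v: "vert e (z j) (z (Suc j))" and nf: "h (z (Suc j)) < h (z j)"
            using j by (auto simp: bad_def nv_def ups_def z_def)
          have "2 * int r \<le> int K * (rho (z j) (z (Suc j)) + 3)" using qi_lower[OF q gXj] rg by (simp add: z_def)
          also have "\<dots> \<le> int K * (2 * (h (z j) - h (z (Suc j))) + 2 * e + 3)"
            using vert_rho[OF v] nf by (intro mult_left_mono) auto
          finally have "real_of_int (2 * int r) \<le> real_of_int (int K * (2 * (h (z j) - h (z (Suc j))) + 2 * e + 3))"
            by (simp only: of_int_le_iff)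
          then have A: "2 * real r \<le> K * (2 * real_of_int (h (z j) - h (z (Suc j))) + 2 * real_of_int e + 3)" by simp
          have "K * (2 * real_of_int e) \<le> real r / 2"
          proof -
            have "e \<le> 4 * int (r div (16 * K))" unfolding e_def using div_le_mono2[OF _ E16, of r] K by simp
            then have "real_of_int e \<le> 4 * real (r div (16 * K))" by linarith
            also have "real (r div (16 * K)) \<le> real r / real (16 * K)" by (rule of_nat_div_le_of_nat)
            finally have "real_of_int e \<le> real r / (4 * K)" by simp
            then have "K * (2 * real_of_int e) \<le> K * (2 * (real r / (4 * K)))" by (intro mult_left_mono) auto
            then show ?thesis using K by simp
          qed
          moreover have "3 * real K \<le> real r / 2" using r6 by simp
          moreover have "K * (2 * real_of_int (h (z j) - h (z (Suc j))) + 2 * real_of_int e + 3)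
             = K * (2 * real_of_int (h (z j) - h (z (Suc j)))) + K * (2 * real_of_int e) + 3 * real K" by (simp add: distrib_left)
          ultimately have "real r \<le> K * (2 * real_of_int (h (z j) - h (z (Suc j))))" using A by linarith
          then have "real r / (2 * K) \<le> real_of_int (h (z j) - h (z (Suc j)))" using K by (simp add: field_simps)
          then show ?thesis using False by simp
        next
          case True
          have "2 * \<bar>h (z j) - h (z (Suc j))\<bar> \<le> rho (z j) (z (Suc j))" using zX jN by (intro rho_ge_h) auto
          also have "\<dots> \<le> int K * (2 * int r + 1)" using qiD(4)[OF q gXj] rg by (simp add: z_def)
          also have "\<dots> \<le> int K * (3 * int r)" using rpos by (intro mult_left_mono) auto
          finally have "2 * \<bar>h (z j) - h (z (Suc j))\<bar> \<le> 3 * (int K * int r)" by simp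
          then have "- (3 * (int K * int r)) \<le> 2 * (h (z j) - h (z (Suc j)))" by arith
          then have "real_of_int (- (3 * (int K * int r))) \<le> real_of_int (2 * (h (z j) - h (z (Suc j))))" by (simp only: of_int_le_iff)
          then have "- (3 * (real K * real r)) \<le> 2 * real_of_int (h (z j) - h (z (Suc j)))" by simp
          moreover have "real r / (2 * K) \<le> real K * real r"
          proof -
            have "real r / (2 * K) \<le> real r / 1" using K by (intro divide_left_mono) auto
            also have "\<dots> \<le> real K * real r" using mult_right_mono[of 1 "real K" "real r"] K by simp
            finally show ?thesis .
          qed
          moreover have "0 \<le> real K * real r" by simp
          moreover have "c - 4 * x \<le> d" if "- (3 * x) \<le> 2 * d" "c \<le> x" "0 \<le> x" for c d x :: real
            using that by linarith
          ultimately have "real r / (2 * K) - 4 * (real K * real r) \<le> real_of_int (h (z j) - h (z (Suc j)))" by blast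
          then show ?thesis using True by simp
        qed
      qed
      have "(\<Sum>j<N. real r / (2 * K) - (if j \<in> bad a then 4 * (real K * real r) else 0)) \<le> (\<Sum>j<N. real_of_int (h (z j) - h (z (Suc j))))"
        using step by (intro sum_mono) auto
      also have "\<dots> = real_of_int (h (z 0) - h (z N))"
        unfolding of_int_sum[symmetric] by (simp only: sum_lessThan_telescope'[of "\<lambda>j. h (z j)"])
      finally have A: "(\<Sum>j<N. real r / (2 * K)) - (\<Sum>j<N. if j \<in> bad a then 4 * (real K * real r) else 0) \<le> real_of_int (h (z 0) - h (z N))"
        by (simp only: sum_subtractf)
      have "bad a = {j \<in> {..<N}. j \<in> bad a}" by (auto simp: bad_def)
      then have "(\<Sum>j<N. if j \<in> bad a then 4 * (real K * real r) else 0) = (\<Sum>j\<in>bad a. 4 * (real K * real r))"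
        using sum.inter_filter[of "{..<N}" "\<lambda>_. 4 * (real K * real r)" "\<lambda>j. j \<in> bad a"] by simp
      also have "\<dots> = real (card (bad a)) * (4 * (real K * real r))" by simp
      also have "\<dots> \<le> \<theta>2 * N * (4 * (real K * real r))" using a by (intro mult_right_mono) (auto simp: W_def)
      also have "\<dots> = (real N * real r) / (4 * K)" using K by (simp add: \<theta>2_def power2_eq_square)
      also have NT': "real N * real r = real T" using NT by (metis of_nat_mult)
      finally have B: "(\<Sum>j<N. if j \<in> bad a then 4 * (real K * real r) else 0) \<le> real T / (4 * K)" .
      have "(\<Sum>j<N. real r / (2 * K)) = (real N * real r) / (2 * K)" by simp
      then have "(\<Sum>j<N. real r / (2 * K)) = 2 * (real T / (4 * K))" unfolding NT' by simp
      then have "real T / (4 * K) \<le> real_of_int (h (z 0) - h (z N))" using A B by linarith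
      moreover have "real (T div (4 * K)) \<le> real T / real (4 * K)" by (rule of_nat_div_le_of_nat)
      ultimately have "real (T div (4 * K)) \<le> real_of_int (h (z 0) - h (z N))" by simp
      then show ?thesis unfolding z0 zN by linarith
    qed
    let ?al = "real m / real n"
    have al: "1 \<le> ?al" using n_less_m n_pos by simp
    have four: "4 \<le> ?al powi (h (\<phi> y) - h (\<phi> (T1.anc (h y - int T) (fst y), a)))" if "a \<in> P - W" for a
    proof -
      have "4 * K * N1 \<le> T" using Tge r1ge by simp
      then have "N1 \<le> T div (4 * K)" using K div_le_mono[of "4 * K * N1" T "4 * K"] by simp
      then have le: "int N1 \<le> h (\<phi> y) - h (\<phi> (T1.anc (h y - int T) (fst y), a))" using good[of a] that by simp
      have "4 \<le> ?al powi (int N1)" using N1 by simp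
      also have "\<dots> \<le> ?al powi (h (\<phi> y) - h (\<phi> (T1.anc (h y - int T) (fst y), a)))"
        by (rule power_int_increasing[OF le al])
      finally show ?thesis .
    qed
    have "card (P - W) = card P - card W" using finP by (intro card_Diff_subset) (auto simp: W_def)
    then have "real (card P) / 2 \<le> real (card (P - W))" using cW by linarith
    then have "2 * real n ^ T \<le> (\<Sum>a\<in>P - W. 4)" using cP by simp
    also have "\<dots> \<le> (\<Sum>a\<in>P - W. ?al powi (h (\<phi> y) - h (\<phi> (T1.anc (h y - int T) (fst y), a))))"
      using four by (intro sum_mono) auto
    also have "\<dots> \<le> (\<Sum>a\<in>P. ?al powi (h (\<phi> y) - h (\<phi> (T1.anc (h y - int T) (fst y), a))))"
      using finP al by (intro sum_mono2) (auto intro: zero_le_power_int)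
    finally show "2 * real n ^ T \<le> (\<Sum>a\<in>T2.desc T (snd y). ?al powi (h (\<phi> y) - h (\<phi> (T1.anc (h y - int T) (fst y), a))))"
      unfolding P_def .
  qed
qed

end

section \<open>Groups\<close>

lemma sum_le_fibre:
  fixes g :: "'x \<Rightarrow> real" and k :: "'y \<Rightarrow> real"
  assumes "finite A" "finite B" "\<And>x. x \<in> A \<Longrightarrow> f x \<in> B" "\<And>x. x \<in> A \<Longrightarrow> g x \<le> k (f x)"
    and "\<And>y. y \<in> B \<Longrightarrow> 0 \<le> k y" "\<And>y. y \<in> B \<Longrightarrow> card {x \<in> A. f x = y} \<le> c"
  shows "sum g A \<le> real c * sum k B"
proof -
  have "sum g A \<le> (\<Sum>x\<in>A. k (f x))" using assms(4) by (rule sum_mono)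
  also have "\<dots> = (\<Sum>y\<in>B. \<Sum>x\<in>{x \<in> A. f x = y}. k (f x))"
    using assms(1-3) by (intro sum.group[symmetric]) auto
  also have "\<dots> = (\<Sum>y\<in>B. real (card {x \<in> A. f x = y}) * k y)"
    by (intro sum.cong refl) simp
  also have "\<dots> \<le> (\<Sum>y\<in>B. real c * k y)"
    using assms(5,6) by (intro sum_mono mult_right_mono) auto
  finally show ?thesis by (simp add: sum_distrib_left)
qed

lemma (in group) foldr_mult_closed:
  "set w \<subseteq> carrier G \<Longrightarrow> foldr (\<otimes>) w \<one> \<in> carrier G"
  by (induction w) auto

lemma (in group) foldr_mult_append:
  "set u \<subseteq> carrier G \<Longrightarrow> set w \<subseteq> carrier G \<Longrightarrow> foldr (\<otimes>) (u @ w) \<one> = foldr (\<otimes>) u \<one> \<otimes> foldr (\<otimes>) w \<one>"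
proof (induction u)
  case (Cons a u)
  then show ?case using foldr_mult_closed[of u] foldr_mult_closed[of w] by (simp add: m_assoc)
qed (simp add: foldr_mult_closed)

lemma (in group) ex_word:
  assumes "S \<subseteq> carrier G" "g \<in> generate G S"
  shows "\<exists>w. set w \<subseteq> S \<union> m_inv G ` S \<and> foldr (\<otimes>) w \<one> = g"
  using assms(2)
proof (induction rule: generate.induct)
  case one
  show ?case by (rule exI[of _ "[]"]) simp
next
  case (incl g)
  then show ?case using assms(1) by (intro exI[of _ "[g]"]) auto
next
  case (inv g)
  then show ?case using assms(1) by (intro exI[of _ "[inv g]"]) auto
next
  case (eng g h)
  then obtain u w where "set u \<subseteq> S \<union> m_inv G ` S" "foldr (\<otimes>) u \<one> = g"
    "set w \<subseteq> S \<union> m_inv G ` S" "foldr (\<otimes>) w \<one> = h" by blast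
  moreover have "S \<union> m_inv G ` S \<subseteq> carrier G" using assms(1) by auto
  ultimately show ?case using foldr_mult_append[of u w] by (intro exI[of _ "u @ w"]) auto
qed

text \<open>Every element is the value of some word, so the \<open>LEAST\<close> in
  \<open>word_length\<close> is attained; words of bounded length over a finite alphabet are finite
  in number.\<close>

lemma (in group) finite_word_ball:
  assumes "finite_generating_set G S"
  shows "finite {g \<in> carrier G. word_length G S g \<le> R}"
proof -
  let ?A = "S \<union> m_inv G ` S"
  have S: "finite S" "S \<subseteq> carrier G" "generate G S = carrier G"
    using assms by (auto simp: finite_generating_set_def)
  have "{g \<in> carrier G. word_length G S g \<le> R} \<subseteq> (\<lambda>w. foldr (\<otimes>) w \<one>) ` {w. set w \<subseteq> ?A \<and> length w \<le> R}"
  proof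
    fix g assume g: "g \<in> {g \<in> carrier G. word_length G S g \<le> R}"
    then obtain w where "set w \<subseteq> ?A" "foldr (\<otimes>) w \<one> = g" using ex_word[OF S(2)] S(3) by blast
    then have "\<exists>k w. length w = k \<and> set w \<subseteq> ?A \<and> foldr (\<otimes>) w \<one> = g" by blast
    then have "\<exists>w. length w = word_length G S g \<and> set w \<subseteq> ?A \<and> foldr (\<otimes>) w \<one> = g"
      unfolding word_length_def by (rule LeastI_ex)
    then show "g \<in> (\<lambda>w. foldr (\<otimes>) w \<one>) ` {w. set w \<subseteq> ?A \<and> length w \<le> R}" using g by auto
  qed
  moreover have "finite {w. set w \<subseteq> ?A \<and> length w \<le> R}"
    using S(1) by (intro finite_lists_length_le) auto
  ultimately show ?thesis using finite_subset by blast
qed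

section \<open>Weighted boxes and the contradiction\<close>

context dl_space begin

lemma ex_point_over: assumes "x \<in> V1" shows "\<exists>y. (x, y) \<in> X"
proof -
  obtain v where v: "v \<in> V2" using T2.V_ne by blast
  show ?thesis
  proof (cases "- ht1 x \<le> ht2 v")
    case True
    then show ?thesis using assms v by (intro exI[of _ "T2.anc (- ht1 x) v"]) (simp add: X_def)
  next
    case False
    obtain w where "w \<in> T2.desc (nat (- ht1 x - ht2 v)) v" using T2.desc_ne[OF v] by blast
    then have "w \<in> V2" "ht2 w = - ht1 x" using T2.descD(1,2)[of w] False by auto
    then show ?thesis using assms by (auto simp: X_def)
  qed
qed

text \<open>The set of levels is a parameter: \<open>{..L}\<close> gives the full box, while its
  collar and its interior are instances too.\<close>

definition box :: "'a \<Rightarrow> 'b \<Rightarrow> nat \<Rightarrow> nat set \<Rightarrow> ('a \<times> 'b) set" where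
  "box x0 y0 L I = (\<Union>t\<in>I. T1.desc t x0 \<times> T2.desc (L - t) y0)"

lemma boxD:
  assumes "ht2 y0 = - (ht1 x0 + int L)" "p \<in> box x0 y0 L I" "I \<subseteq> {..L}"
  shows "p \<in> X" "\<exists>t\<in>I. h p = ht1 x0 + int t" "T1.anc (ht1 x0) (fst p) = x0" "T2.anc (ht2 y0) (snd p) = y0"
proof -
  obtain t where t: "t \<in> I" "fst p \<in> T1.desc t x0" "snd p \<in> T2.desc (L - t) y0"
    using assms(2) by (auto simp: box_def)
  then have tL: "t \<le> L" using assms(3) by auto
  note D = T1.descD[OF t(2)] T2.descD[OF t(3)]
  show "p \<in> X" using D assms(1) tL by (simp add: X_def of_nat_diff)
  show "\<exists>t\<in>I. h p = ht1 x0 + int t" using D t(1) by (auto simp: h_def)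
  show "T1.anc (ht1 x0) (fst p) = x0" "T2.anc (ht2 y0) (snd p) = y0" using D by auto
qed

lemma boxI:
  assumes "ht2 y0 = - (ht1 x0 + int L)" "p \<in> X" "h p = ht1 x0 + int t" "t \<in> I" "t \<le> L"
    "T1.anc (ht1 x0) (fst p) = x0" "T2.anc (ht2 y0) (snd p) = y0"
  shows "p \<in> box x0 y0 L I"
proof -
  have "fst p \<in> T1.desc t x0" using assms XD[OF assms(2)] by (simp add: T1.desc_def)
  moreover have "snd p \<in> T2.desc (L - t) y0" using assms XD[OF assms(2)] by (simp add: T2.desc_def of_nat_diff)
  ultimately show ?thesis using assms(4) by (auto simp: box_def mem_Times_iff)
qed

text \<open>From a level more than \<open>R\<close> away from both ends, a move of length
  \<open>R\<close> passes neither the bottom vertex \<open>x0\<close> in the first tree nor the top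
  vertex \<open>y0\<close> in the second.\<close>

lemma box_absorb:
  assumes lev: "ht2 y0 = - (ht1 x0 + int L)" and p: "p \<in> box x0 y0 L {..L}" and q: "q \<in> X" "rho p q \<le> int R"
    and mid: "h p = ht1 x0 + int t" "R < t" "t + R < L"
  shows "q \<in> box x0 y0 L {..L}"
proof -
  have pX: "p \<in> X" and a: "T1.anc (ht1 x0) (fst p) = x0" "T2.anc (ht2 y0) (snd p) = y0"
    using boxD[OF lev p] by auto
  have "ht1 x0 \<le> T1.mt (fst p) (fst q)" using mt1_ge[OF pX q(1)] q(2) mid by linarith
  then have 1: "ht1 x0 \<le> ht1 (fst q)" "T1.anc (ht1 x0) (fst q) = x0"
    using T1.le_mt_iff[OF XD(1)[OF pX] XD(1)[OF q(1)]] a by auto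
  have "ht2 y0 \<le> T2.mt (snd p) (snd q)" using mt2_ge[OF pX q(1)] q(2) mid lev by linarith
  then have 2: "ht2 y0 \<le> ht2 (snd q)" "T2.anc (ht2 y0) (snd q) = y0"
    using T2.le_mt_iff[OF XD(2)[OF pX] XD(2)[OF q(1)]] a by auto
  define s where "s = nat (h q - ht1 x0)"
  have "h q = ht1 x0 + int s" "s \<le> L" using 1(1) 2(1) lev XD(3,4)[OF q(1)] by (auto simp: s_def)
  then show ?thesis using 1 2 by (intro boxI[OF lev q(1), of s]) auto
qed

definition al :: real where "al = real m / real n"

lemma al_gt: "1 < al" using n_less_m n_pos by (simp add: al_def)

definition wt :: "'a \<times> 'b \<Rightarrow> real" where "wt p = al powi (- h p)"

lemma wt_pos: "0 < wt p" using al_gt by (simp add: wt_def zero_less_power_int)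

lemma wt_close:
  assumes "p \<in> X" "q \<in> X" "rho p q \<le> int R" shows "wt p \<le> al ^ R * wt q"
proof -
  have "- h p \<le> int R + (- h q)" using rho_ge_h[OF assms(1,2)] assms(3) by arith
  then have "wt p \<le> al powi (int R + (- h q))" unfolding wt_def using al_gt by (intro power_int_increasing) auto
  also have "\<dots> = al powi (int R) * wt q" using al_gt unfolding wt_def by (subst power_int_add) auto
  finally show ?thesis by simp
qed

lemma sum_wt_box:
  assumes x0: "x0 \<in> V1" and y0: "y0 \<in> V2" and lev: "ht2 y0 = - (ht1 x0 + int L)" and I: "I \<subseteq> {..L}"
  shows "finite (box x0 y0 L I)" "sum wt (box x0 y0 L I) = card I * (real n ^ L * al powi (- ht1 x0))"
proof -
  have finI: "finite I" using I finite_subset by blast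
  show "finite (box x0 y0 L I)" using finI x0 y0 by (auto simp: box_def)
  have sl: "sum wt (T1.desc t x0 \<times> T2.desc (L - t) y0) = real n ^ L * al powi (- ht1 x0)" if "t \<in> I" for t
  proof -
    have tL: "t \<le> L" using that I by auto
    have "wt p = al powi (- ht1 x0 - int t)" if "p \<in> T1.desc t x0 \<times> T2.desc (L - t) y0" for p
    proof -
      have "ht1 (fst p) = ht1 x0 + int t" using T1.descD(2)[of "fst p" t x0] that by (auto simp: mem_Times_iff)
      then have "- h p = - ht1 x0 - int t" by (simp add: h_def)
      then show ?thesis by (simp only: wt_def)
    qed
    then have "sum wt (T1.desc t x0 \<times> T2.desc (L - t) y0) = (\<Sum>p\<in>T1.desc t x0 \<times> T2.desc (L - t) y0. al powi (- ht1 x0 - int t))"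
      by (rule sum.cong[OF refl])
    also have "\<dots> = real m ^ t * real n ^ (L - t) * al powi (- ht1 x0 - int t)"
      using x0 y0 by (simp add: card_cartesian_product)
    also have "al powi (- ht1 x0 - int t) = al powi (- ht1 x0) / al ^ t"
      using al_gt by (subst power_int_diff) auto
    also have "real m ^ t * real n ^ (L - t) * (al powi (- ht1 x0) / al ^ t) = real n ^ t * real n ^ (L - t) * al powi (- ht1 x0)"
      using n_pos m_pos by (simp add: al_def power_divide)
    also have "real n ^ t * real n ^ (L - t) = real n ^ L" using tL by (simp flip: power_add)
    finally show ?thesis .
  qed
  have dis: "(T1.desc t x0 \<times> T2.desc (L - t) y0) \<inter> (T1.desc t' x0 \<times> T2.desc (L - t') y0) = {}" if "t \<noteq> t'" for t t'
    using that by (auto dest!: T1.descD(2))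
  have "sum wt (box x0 y0 L I) = (\<Sum>t\<in>I. sum wt (T1.desc t x0 \<times> T2.desc (L - t) y0))"
    unfolding box_def using finI x0 y0 dis by (intro sum.UNION_disjoint) auto
  then show "sum wt (box x0 y0 L I) = card I * (real n ^ L * al powi (- ht1 x0))" using sl by simp
qed

lemma no_group_quasi_isometry:
  fixes G (structure) and K :: nat and f :: "'g \<Rightarrow> 'a \<times> 'b"
  assumes G: "group G" and S: "finite_generating_set G S"
    and K: "1 \<le> K" and fX: "\<And>g. g \<in> carrier G \<Longrightarrow> f g \<in> X"
    and up: "\<And>g g'. g \<in> carrier G \<Longrightarrow> g' \<in> carrier G \<Longrightarrow>
      rho (f g) (f g') \<le> int K * (int (word_length G S (inv\<^bsub>G\<^esub> g \<otimes>\<^bsub>G\<^esub> g')) + 1)"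
    and lo: "\<And>g g'. g \<in> carrier G \<Longrightarrow> g' \<in> carrier G \<Longrightarrow>
      int (word_length G S (inv\<^bsub>G\<^esub> g \<otimes>\<^bsub>G\<^esub> g')) \<le> int K * (rho (f g) (f g') + 1)"
    and onto: "\<And>p. p \<in> X \<Longrightarrow> \<exists>g\<in>carrier G. rho (f g) p \<le> int K"
  shows False
proof -
  interpret group G by (rule G)
  define wl where "wl g g' = int (word_length G S (inv g \<otimes> g'))" for g g'
  have left: "wl (z \<otimes> g) (z \<otimes> g') = wl g g'" if "z \<in> carrier G" "g \<in> carrier G" "g' \<in> carrier G" for z g g'
  proof -
    have "inv (z \<otimes> g) \<otimes> (z \<otimes> g') = inv g \<otimes> (inv z \<otimes> (z \<otimes> g'))" using that by (simp add: inv_mult_group m_assoc)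
    also have "inv z \<otimes> (z \<otimes> g') = g'" using that by (simp flip: m_assoc)
    finally show ?thesis by (simp add: wl_def)
  qed
  define \<psi> where "\<psi> p = (SOME g. g \<in> carrier G \<and> rho (f g) p \<le> int K)" for p
  have psi: "\<psi> p \<in> carrier G" "rho (f (\<psi> p)) p \<le> int K" if "p \<in> X" for p
  proof -
    have "\<exists>g. g \<in> carrier G \<and> rho (f g) p \<le> int K" using onto[OF that] by blast
    then have "\<psi> p \<in> carrier G \<and> rho (f (\<psi> p)) p \<le> int K" unfolding \<psi>_def by (rule someI_ex)
    then show "\<psi> p \<in> carrier G" "rho (f (\<psi> p)) p \<le> int K" by auto
  qed
  have psi_lip: "wl (\<psi> p) (\<psi> q) \<le> int K * (rho p q + 2 * int K + 1)" if "p \<in> X" "q \<in> X" for p q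
  proof -
    note F = fX[OF psi(1)[OF that(1)]] fX[OF psi(1)[OF that(2)]]
    have "rho (f (\<psi> p)) (f (\<psi> q)) \<le> rho (f (\<psi> p)) p + (rho p q + rho q (f (\<psi> q)))"
      using rho_triangle[OF F(1) that(1) F(2)] rho_triangle[OF that F(2)] by linarith
    also have "rho q (f (\<psi> q)) = rho (f (\<psi> q)) q" by (rule rho_commute[OF that(2) F(2)])
    finally have "rho (f (\<psi> p)) (f (\<psi> q)) + 1 \<le> rho p q + 2 * int K + 1"
      using psi(2)[OF that(1)] psi(2)[OF that(2)] by linarith
    then have "int K * (rho (f (\<psi> p)) (f (\<psi> q)) + 1) \<le> int K * (rho p q + 2 * int K + 1)" by (intro mult_left_mono) auto
    then show ?thesis using lo[OF psi(1)[OF that(1)] psi(1)[OF that(2)]] unfolding wl_def by linarith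
  qed
  have psi_f: "wl (\<psi> (f g)) g \<le> int K * (int K + 1)" if "g \<in> carrier G" for g
  proof -
    have "wl (\<psi> (f g)) g \<le> int K * (rho (f (\<psi> (f g))) (f g) + 1)"
      unfolding wl_def by (rule lo[OF psi(1)[OF fX[OF that]] that])
    also have "\<dots> \<le> int K * (int K + 1)" using psi(2)[OF fX[OF that]] by (intro mult_left_mono) auto
    finally show ?thesis .
  qed
  define K' where "K' = K * (K * (2 * K + 1) + 1)"
  \<comment> \<open>Left translation by \<open>z\<close>, transported to \<open>X\<close>. It
    preserves word distances, hence the constant \<open>K'\<close> is the same for all
    \<open>z\<close>.\<close>
  define \<phi> where "\<phi> z p = f (z \<otimes> \<psi> p)" for z p
  have phX: "\<phi> z p \<in> X" if "z \<in> carrier G" "p \<in> X" for z p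
    unfolding \<phi>_def using that psi(1) by (intro fX) auto
  have ph_lip: "rho (\<phi> z p) (\<phi> z p') \<le> int K' * (rho p p' + 1)" if "z \<in> carrier G" "p \<in> X" "p' \<in> X" for z p p'
  proof -
    have "rho (\<phi> z p) (\<phi> z p') \<le> int K * (wl (z \<otimes> \<psi> p) (z \<otimes> \<psi> p') + 1)"
      unfolding \<phi>_def wl_def using that psi(1) by (intro up) auto
    also have "wl (z \<otimes> \<psi> p) (z \<otimes> \<psi> p') = wl (\<psi> p) (\<psi> p')" using that psi(1) by (intro left) auto
    also have "int K * (wl (\<psi> p) (\<psi> p') + 1) \<le> int K * (int K * (rho p p' + 2 * int K + 1) + 1)"
      using psi_lip[OF that(2,3)] by (intro mult_left_mono) auto
    also have "\<dots> \<le> int K' * (rho p p' + 1)"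
    proof -
      have "int K * int K * 1 * rho p p' \<le> int K * int K * (2 * int K + 1) * rho p p'"
        using rho_nonneg[OF that(2,3)] by (intro mult_right_mono mult_left_mono) auto
      moreover have "0 \<le> int K * rho p p'" using rho_nonneg[OF that(2,3)] by simp
      ultimately show ?thesis by (simp add: K'_def algebra_simps)
    qed
    finally show ?thesis .
  qed
  have ph_inv: "rho (\<phi> z (\<phi> (inv z) p)) p \<le> int K'" if z: "z \<in> carrier G" and p: "p \<in> X" for z p
  proof -
    define g where "g = inv z \<otimes> \<psi> p"
    have g: "g \<in> carrier G" using z psi(1)[OF p] by (simp add: g_def)
    have zg: "z \<otimes> g = \<psi> p" using z psi(1)[OF p] by (simp add: g_def flip: m_assoc)
    have "rho (f (z \<otimes> \<psi> (f g))) (f (z \<otimes> g)) \<le> int K * (wl (z \<otimes> \<psi> (f g)) (z \<otimes> g) + 1)"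
      unfolding wl_def using z g psi(1)[OF fX[OF g]] by (intro up) auto
    also have "wl (z \<otimes> \<psi> (f g)) (z \<otimes> g) = wl (\<psi> (f g)) g" using z g psi(1)[OF fX[OF g]] by (intro left) auto
    also have "int K * (wl (\<psi> (f g)) g + 1) \<le> int K * (int K * (int K + 1) + 1)"
      using psi_f[OF g] by (intro mult_left_mono) auto
    finally have A: "rho (\<phi> z (\<phi> (inv z) p)) (f (\<psi> p)) \<le> int K * (int K * (int K + 1) + 1)"
      unfolding \<phi>_def g_def[symmetric] zg .
    have "rho (\<phi> z (\<phi> (inv z) p)) p \<le> rho (\<phi> z (\<phi> (inv z) p)) (f (\<psi> p)) + rho (f (\<psi> p)) p"
      using z p phX fX[OF psi(1)[OF p]] by (intro rho_triangle) auto
    then have B: "rho (\<phi> z (\<phi> (inv z) p)) p \<le> int K * (int K * (int K + 1) + 1) + int K" using A psi(2)[OF p] by linarith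
    have "K * 1 * 1 \<le> K * K * K" using K by (intro mult_mono) auto
    then have "K * (K * (K + 1) + 1) + K \<le> K'" by (simp add: K'_def algebra_simps)
    then have "int (K * (K * (K + 1) + 1) + K) \<le> int K'" by (simp only: of_nat_le_iff)
    then show ?thesis using B by (simp add: algebra_simps)
  qed
  have K'1: "1 \<le> K'" using K by (simp add: K'_def)
  have qi: "qi (int K') (\<phi> z) (\<phi> (inv z))" if z: "z \<in> carrier G" for z
    unfolding qi_def
  proof (intro conjI ballI)
    show "1 \<le> int K'" using K'1 by simp
    show "\<phi> z ` X \<subseteq> X" "\<phi> (inv z) ` X \<subseteq> X" using phX z by auto
  qed (use z ph_lip ph_inv[OF z] ph_inv[OF inv_closed[OF z]] in \<open>auto simp: inv_inv[OF z]\<close>)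
  from heights_descend[OF K'1] obtain T where T: "\<forall>\<phi> \<psi> y. qi (int K') \<phi> \<psi> \<longrightarrow> y \<in> X \<longrightarrow>
    2 * real n ^ T \<le> (\<Sum>a\<in>T2.desc T (snd y). (real m / real n) powi (h (\<phi> y) - h (\<phi> (T1.anc (h y - int T) (fst y), a))))"
    by (elim exE)
  obtain x0 where x0: "x0 \<in> V1" using T1.V_ne by blast
  obtain y where y: "(x0, y) \<in> X" using ex_point_over[OF x0] by blast
  have yV: "y \<in> V2" "ht2 y = - ht1 x0" using XD[OF y] by (auto simp: h_def)
  define A where "A = T2.desc T y"
  have finA: "finite A" and cardA: "card A = n ^ T" using yV by (auto simp: A_def)
  define low where "low a = (T1.anc (ht1 x0 - int T) x0, a)" for a :: 'b
  have lowX: "low a \<in> X" if "a \<in> A" for a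
    using T2.descD(1,2)[of a T y] that yV x0 by (auto simp: low_def A_def X_def)
  \<comment> \<open>Right multiplication by \<open>s a\<close> takes the element over
    \<open>(x0, y)\<close> to the one over the point \<open>low a\<close> below it. The
    \<open>s a\<close> are fixed before \<open>z\<close> is chosen.\<close>
  define s where "s a = inv (\<psi> (x0, y)) \<otimes> \<psi> (low a)" for a
  have sG: "s a \<in> carrier G" if "a \<in> A" for a using psi(1)[OF y] psi(1)[OF lowX[OF that]] by (simp add: s_def)
  define w where "w z = wt (f z)" for z
  have wpos: "0 < w z" for z by (simp add: w_def wt_pos)
  have double: "2 * real n ^ T * w z \<le> (\<Sum>a\<in>A. w (z \<otimes> s a))" if z: "z \<in> carrier G" for z
  proof -
    \<comment> \<open>The left translation taking the element over \<open>(x0, y)\<close> to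
      \<open>z\<close>; the associated map sends \<open>(x0, y)\<close> exactly to
      \<open>f z\<close>.\<close>
    let ?z = "z \<otimes> inv (\<psi> (x0, y))"
    have zG: "?z \<in> carrier G" using z psi(1)[OF y] by simp
    have p0: "\<phi> ?z (x0, y) = f z" using z psi(1)[OF y] by (simp add: \<phi>_def m_assoc)
    have pa: "\<phi> ?z (low a) = f (z \<otimes> s a)" if "a \<in> A" for a
      using z psi(1)[OF y] psi(1)[OF lowX[OF that]] by (simp add: \<phi>_def s_def m_assoc)
    have "2 * real n ^ T \<le> (\<Sum>a\<in>A. al powi (h (\<phi> ?z (x0, y)) - h (\<phi> ?z (low a))))"
      using T[rule_format, OF qi[OF zG] y] unfolding al_def[symmetric] A_def low_def by (simp add: h_def)
    also have "\<dots> = (\<Sum>a\<in>A. al powi (h (f z) - h (f (z \<otimes> s a))))"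
      using p0 pa by (intro sum.cong) auto
    finally have "2 * real n ^ T * w z \<le> (\<Sum>a\<in>A. al powi (h (f z) - h (f (z \<otimes> s a)))) * w z"
      using wpos[of z] by (intro mult_right_mono) auto
    also have "\<dots> = (\<Sum>a\<in>A. w (z \<otimes> s a))"
      unfolding sum_distrib_right w_def wt_def using al_gt
      by (intro sum.cong refl) (simp flip: power_int_add)
    finally show ?thesis .
  qed
  define B0 where "B0 = Max (insert 0 ((\<lambda>a. word_length G S (s a)) ` A))"
  have B0: "word_length G S (s a) \<le> B0" if "a \<in> A" for a unfolding B0_def using finA that by (intro Max_ge) auto
  define R where "R = K * (B0 + 1)"
  have move: "rho (f z) (f (z \<otimes> s a)) \<le> int R" if z: "z \<in> carrier G" and a: "a \<in> A" for z a
  proof -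
    have "inv z \<otimes> (z \<otimes> s a) = s a" using z sG[OF a] by (simp flip: m_assoc)
    then have "rho (f z) (f (z \<otimes> s a)) \<le> int K * (int (word_length G S (s a)) + 1)"
      using up[of z "z \<otimes> s a"] z sG[OF a] by simp
    also have "\<dots> \<le> int K * (int B0 + 1)" using B0[OF a] by (intro mult_left_mono) auto
    finally show ?thesis by (simp add: R_def algebra_simps)
  qed
  define Mf where "Mf = card {g \<in> carrier G. word_length G S g \<le> K * (2 * R + 1)}"
  have fib: "finite {z \<in> carrier G. rho (f z) p \<le> int R} \<and> card {z \<in> carrier G. rho (f z) p \<le> int R} \<le> Mf" if p: "p \<in> X" for p
  proof (cases "{z \<in> carrier G. rho (f z) p \<le> int R} = {}")
    case True then show ?thesis by (simp only: True) simp
  next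
    case False
    then obtain z0 where z0: "z0 \<in> carrier G" "rho (f z0) p \<le> int R" by blast
    let ?B = "{g \<in> carrier G. word_length G S g \<le> K * (2 * R + 1)}"
    have sub: "{z \<in> carrier G. rho (f z) p \<le> int R} \<subseteq> (\<lambda>g. z0 \<otimes> g) ` ?B"
    proof
      fix z assume "z \<in> {z \<in> carrier G. rho (f z) p \<le> int R}"
      then have z: "z \<in> carrier G" "rho (f z) p \<le> int R" by auto
      have "rho (f z0) (f z) \<le> rho (f z0) p + rho p (f z)" using z z0 p fX by (intro rho_triangle) auto
      also have "rho p (f z) = rho (f z) p" using z p fX by (intro rho_commute) auto
      finally have "rho (f z0) (f z) + 1 \<le> 2 * int R + 1" using z z0 by simp
      then have "int K * (rho (f z0) (f z) + 1) \<le> int K * (2 * int R + 1)" by (intro mult_left_mono) auto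
      with lo[OF z0(1) z(1)] have "int (word_length G S (inv z0 \<otimes> z)) \<le> int K * (2 * int R + 1)" by (rule order_trans)
      also have "\<dots> = int (K * (2 * R + 1))" by (simp add: distrib_left)
      finally have "int (word_length G S (inv z0 \<otimes> z)) \<le> int (K * (2 * R + 1))" .
      then have "word_length G S (inv z0 \<otimes> z) \<le> K * (2 * R + 1)" by (simp only: of_nat_le_iff)
      then have "inv z0 \<otimes> z \<in> ?B" using z z0 by simp
      moreover have "z = z0 \<otimes> (inv z0 \<otimes> z)" using z z0 by (simp flip: m_assoc)
      ultimately show "z \<in> (\<lambda>g. z0 \<otimes> g) ` ?B" by blast
    qed
    have finB: "finite ?B" by (rule finite_word_ball[OF S])
    show ?thesis
      using finite_subset[OF sub finite_imageI[OF finB]] card_mono[OF finite_imageI[OF finB] sub]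
        card_image_le[OF finB, of "\<lambda>g. z0 \<otimes> g"] unfolding Mf_def by linarith
  qed
  \<comment> \<open>\<open>2 * (R + 1)\<close> boundary levels, at most \<open>Mf\<close> group
    elements near each point, and a change of weight by at most \<open>al ^ R\<close> over distance
    \<open>R\<close>.\<close>
  define C1 where "C1 = 2 * (real R + 1) * (real Mf * al ^ R)"
  obtain L0 :: nat where L0: "C1 * (al ^ K * real gam ^ K) < real L0" using reals_Archimedean2 by blast
  define L where "L = L0 + 2 * R + 2 * K + 2"
  define y0 where "y0 = T2.anc (- (ht1 x0 + int L)) y"
  have y0: "y0 \<in> V2" and lev: "ht2 y0 = - (ht1 x0 + int L)" using yV by (auto simp: y0_def)
  define \<sigma> where "\<sigma> = real n ^ L * al powi (- ht1 x0)"
  have \<sigma>: "0 < \<sigma>" using n_pos al_gt by (simp add: \<sigma>_def zero_less_power_int)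
  let ?box = "box x0 y0 L"
  note bx = boxD[OF lev]
  have finbox: "finite (?box I)" and sumbox: "sum wt (?box I) = card I * \<sigma>" if "I \<subseteq> {..L}" for I
    using sum_wt_box[OF x0 y0 lev that] by (auto simp: \<sigma>_def)
  define F where "F = {z \<in> carrier G. f z \<in> ?box {..L}}"
  define F' where "F' = {z \<in> carrier G. \<exists>p\<in>?box {..L}. rho (f z) p \<le> int R}"
  have FF': "F \<subseteq> F'"
  proof
    fix z assume "z \<in> F"
    then have "z \<in> carrier G" "f z \<in> ?box {..L}" "rho (f z) (f z) \<le> int R" using fX by (auto simp: F_def)
    then show "z \<in> F'" by (auto simp: F'_def)
  qed
  have finF': "finite F'"
  proof -
    have "F' = (\<Union>p\<in>?box {..L}. {z \<in> carrier G. rho (f z) p \<le> int R})" by (auto simp: F'_def)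
    then show ?thesis using finbox[OF order_refl] fib bx(1) by auto
  qed
  have finF: "finite F" using FF' finF' finite_subset by blast
  have "2 * real n ^ T * sum w F \<le> (\<Sum>z\<in>F. \<Sum>a\<in>A. w (z \<otimes> s a))"
    unfolding sum_distrib_left using double by (intro sum_mono) (auto simp: F_def)
  also have "\<dots> = (\<Sum>a\<in>A. \<Sum>z\<in>F. w (z \<otimes> s a))" by (rule sum.swap)
  also have "\<dots> \<le> (\<Sum>a\<in>A. sum w F')"
  proof (intro sum_mono)
    fix a assume a: "a \<in> A"
    \<comment> \<open>Right multiplication is injective and moves \<open>F\<close> into
      \<open>F'\<close>, so each of the \<open>n ^ T\<close> translates weighs at most as much as
      \<open>F'\<close>.\<close>
    have inj: "inj_on (\<lambda>z. z \<otimes> s a) F" using sG[OF a] by (auto simp: F_def inj_on_def)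
    have "(\<Sum>z\<in>F. w (z \<otimes> s a)) = sum w ((\<lambda>z. z \<otimes> s a) ` F)" using inj by (simp add: sum.reindex)
    also have "\<dots> \<le> sum w F'"
    proof (rule sum_mono2[OF finF'])
      show "(\<lambda>z. z \<otimes> s a) ` F \<subseteq> F'"
      proof
        fix g assume "g \<in> (\<lambda>z. z \<otimes> s a) ` F"
        then obtain z where z: "z \<in> carrier G" "f z \<in> ?box {..L}" "g = z \<otimes> s a" by (auto simp: F_def)
        have "rho (f g) (f z) \<le> int R"
          using move[OF z(1) a] rho_commute[of "f z" "f g"] fX z sG[OF a] by simp
        then show "g \<in> F'" using z sG[OF a] by (auto simp: F'_def)
      qed
    qed (use wpos in \<open>auto intro: less_imp_le\<close>)
    finally show "(\<Sum>z\<in>F. w (z \<otimes> s a)) \<le> sum w F'" .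
  qed
  also have "\<dots> = real n ^ T * sum w F'" by (simp add: cardA)
  finally have "real n ^ T * (2 * sum w F) \<le> real n ^ T * sum w F'" by simp
  then have "2 * sum w F \<le> sum w F'" using n_pos by simp
  also have "sum w F' = sum w F + sum w (F' - F)" using sum.subset_diff[OF FF' finF', of w] by simp
  finally have main: "sum w F \<le> sum w (F' - F)" by simp
  \<comment> \<open>The collar: \<open>R + 1\<close> levels at the bottom and \<open>R + 1\<close>
    at the top. By \<open>box_absorb\<close> every element of \<open>F' - F\<close> is near
    it.\<close>
  define N where "N = ?box ({..R} \<union> {L - R..L})"
  have Nsub: "{..R} \<union> {L - R..L} \<subseteq> {..L}" by (auto simp: L_def)
  have near: "\<exists>p. p \<in> N \<and> rho (f z) p \<le> int R" if z: "z \<in> F' - F" for z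
  proof -
    obtain p where p: "p \<in> ?box {..L}" "rho (f z) p \<le> int R" and zG: "z \<in> carrier G" and nz: "f z \<notin> ?box {..L}"
      using z by (auto simp: F_def F'_def)
    have pX: "p \<in> X" and pa: "T1.anc (ht1 x0) (fst p) = x0" "T2.anc (ht2 y0) (snd p) = y0" using bx(1,3,4)[OF p(1)] by auto
    obtain t where t: "t \<le> L" "h p = ht1 x0 + int t" using bx(2)[OF p(1)] by auto
    have r: "rho p (f z) \<le> int R" using p(2) rho_commute[OF pX fX[OF zG]] by simp
    have "\<not> (R < t \<and> t + R < L)" using box_absorb[OF lev p(1) fX[OF zG] r t(2)] nz by blast
    then have "t \<in> {..R} \<union> {L - R..L}" using t by auto
    then have "p \<in> N" unfolding N_def by (intro boxI[OF lev pX t(2) _ t(1) pa])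
    then show ?thesis using p(2) by blast
  qed
  define ne where "ne z = (SOME p. p \<in> N \<and> rho (f z) p \<le> int R)" for z
  have ne: "ne z \<in> N" "rho (f z) (ne z) \<le> int R" if "z \<in> F' - F" for z
    using someI_ex[OF near[OF that]] unfolding ne_def by auto
  have NX: "p \<in> X" if "p \<in> N" for p using bx(1)[OF that[unfolded N_def] Nsub] .
  have "sum w (F' - F) \<le> real Mf * (\<Sum>p\<in>N. al ^ R * wt p)"
  proof (rule sum_le_fibre[of _ _ ne])
    show "w z \<le> al ^ R * wt (ne z)" if "z \<in> F' - F" for z
      unfolding w_def using that ne[OF that] NX fX by (intro wt_close) (auto simp: F'_def)
    show "card {z \<in> F' - F. ne z = p} \<le> Mf" if p: "p \<in> N" for p
    proof -
      have "{z \<in> F' - F. ne z = p} \<subseteq> {z \<in> carrier G. rho (f z) p \<le> int R}" using ne by (auto simp: F'_def)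
      then have "card {z \<in> F' - F. ne z = p} \<le> card {z \<in> carrier G. rho (f z) p \<le> int R}"
        using fib[OF NX[OF p]] by (intro card_mono) auto
      then show ?thesis using fib[OF NX[OF p]] by linarith
    qed
  qed (use finF' finbox[OF Nsub] ne wt_pos al_gt in \<open>auto simp: N_def intro: less_imp_le\<close>)
  also have "\<dots> = real Mf * al ^ R * sum wt N" unfolding sum_distrib_left[symmetric] by simp
  also have "sum wt N = card ({..R} \<union> {L - R..L}) * \<sigma>" unfolding N_def by (rule sumbox[OF Nsub])
  also have "real Mf * al ^ R * (card ({..R} \<union> {L - R..L}) * \<sigma>) \<le> C1 * \<sigma>"
  proof -
    have "card ({..R} \<union> {L - R..L}) \<le> card {..R} + card {L - R..L}" by (rule card_Un_le)
    also have "\<dots> = 2 * (R + 1)" by (simp add: L_def)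
    finally have "real (card ({..R} \<union> {L - R..L})) \<le> real (2 * (R + 1))" by (simp only: of_nat_le_iff)
    then have "real Mf * al ^ R * (card ({..R} \<union> {L - R..L}) * \<sigma>) \<le> real Mf * al ^ R * (real (2 * (R + 1)) * \<sigma>)"
      using \<sigma> al_gt by (intro mult_left_mono mult_right_mono) auto
    then show ?thesis by (simp add: C1_def algebra_simps)
  qed
  finally have upper: "sum w F \<le> C1 * \<sigma>" using main by linarith
  \<comment> \<open>On levels more than \<open>K\<close> away from both ends \<open>\<psi>\<close>
    takes values in \<open>F\<close>. This bounds the weight of \<open>F\<close> from below by a
    multiple of the number of levels, which outgrows the collar.\<close>
  define I where "I = {K<..<L - K}"
  have Isub: "I \<subseteq> {..L}" by (auto simp: I_def)
  have cI: "L0 \<le> card I" by (simp add: I_def L_def)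
  have MX: "p \<in> X" if "p \<in> ?box I" for p using bx(1)[OF that Isub] .
  have psiF: "\<psi> p \<in> F" if p: "p \<in> ?box I" for p
  proof -
    obtain t where t: "t \<in> I" "h p = ht1 x0 + int t" using bx(2)[OF p Isub] by auto
    have pL: "p \<in> ?box {..L}" using p Isub by (auto simp: box_def)
    have "rho p (f (\<psi> p)) \<le> int K" using psi[OF MX[OF p]] rho_commute[OF MX[OF p] fX[OF psi(1)[OF MX[OF p]]]] by simp
    then have "f (\<psi> p) \<in> ?box {..L}"
      using t(1) by (intro box_absorb[OF lev pL fX[OF psi(1)[OF MX[OF p]]] _ t(2)]) (auto simp: I_def)
    then show ?thesis using psi(1)[OF MX[OF p]] by (simp add: F_def)
  qed
  have "sum wt (?box I) \<le> real (gam ^ K) * (\<Sum>z\<in>F. al ^ K * w z)"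
  proof (rule sum_le_fibre[of _ _ \<psi>])
    show "wt p \<le> al ^ K * w (\<psi> p)" if p: "p \<in> ?box I" for p
      unfolding w_def using psi[OF MX[OF p]] rho_commute[OF MX[OF p] fX[OF psi(1)[OF MX[OF p]]]] fX MX[OF p]
      by (intro wt_close) auto
    show "card {p \<in> ?box I. \<psi> p = z} \<le> gam ^ K" if z: "z \<in> F" for z
    proof -
      have fz: "f z \<in> X" using z fX by (auto simp: F_def)
      have "{p \<in> ?box I. \<psi> p = z} \<subseteq> {p \<in> X. rho (f z) p \<le> int K}" using MX psi(2) by auto
      then have "card {p \<in> ?box I. \<psi> p = z} \<le> card {p \<in> X. rho (f z) p \<le> int K}"
        using finite_card_ball(1)[OF fz] by (intro card_mono) auto
      then show ?thesis using finite_card_ball(2)[OF fz, of K] by linarith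
    qed
  qed (use finF finbox[OF Isub] psiF wpos al_gt in \<open>auto intro: less_imp_le\<close>)
  also have "\<dots> = al ^ K * real gam ^ K * sum w F" unfolding sum_distrib_left[symmetric] by simp
  also have "\<dots> \<le> al ^ K * real gam ^ K * (C1 * \<sigma>)" using upper al_gt by (intro mult_left_mono) auto
  finally have "card I * \<sigma> \<le> C1 * (al ^ K * real gam ^ K) * \<sigma>" using sumbox[OF Isub] by (simp add: mult_ac)
  then have "real (card I) \<le> C1 * (al ^ K * real gam ^ K)" using \<sigma> by simp
  then show False using L0 cI by linarith
qed

end

section \<open>Diestel-Leader graphs as horocyclic products\<close>

text \<open>Graph distance by powers of the arc relation, meaningful only when some power relates
  \<open>u\<close> to \<open>v\<close>; \<open>path_dist_eq_rdist\<close> identifies it with the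
  path metric.\<close>

definition rdist :: "('a \<times> 'a) set \<Rightarrow> 'a \<Rightarrow> 'a \<Rightarrow> nat" where
  "rdist E u v = (LEAST k. (u, v) \<in> E ^^ k)"

lemma rdist_le: "(u, v) \<in> E ^^ k \<Longrightarrow> rdist E u v \<le> k"
  unfolding rdist_def by (rule Least_le)

lemma rdist_in: "(u, v) \<in> E ^^ k \<Longrightarrow> (u, v) \<in> E ^^ rdist E u v"
  unfolding rdist_def by (rule LeastI)

lemma rdist_Suc_step:
  assumes "(u, v) \<in> E ^^ k" "rdist E u v = Suc j"
  obtains w where "(u, w) \<in> E" "(w, v) \<in> E ^^ j" "rdist E w v = j"
proof -
  have "(u, v) \<in> E ^^ Suc j" using rdist_in assms by metis
  then obtain w where w: "(u, w) \<in> E" "(w, v) \<in> E ^^ j" by (meson relpow_Suc_D2)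
  have "(u, v) \<in> E ^^ Suc (rdist E w v)" using relpow_Suc_I2[OF w(1) rdist_in[OF w(2)]] .
  then have "Suc j \<le> Suc (rdist E w v)" using rdist_le assms(2) by metis
  then show ?thesis using that w rdist_le[OF w(2)] by simp
qed

text \<open>Along a geodesic to \<open>x\<close> the distance to \<open>x\<close> decreases
  strictly, so past its start it is smaller than that of \<open>v\<close>, and \<open>v\<close>
  cannot occur.\<close>

lemma rdist_avoid:
  assumes "(w, x) \<in> E ^^ k" "rdist E w x \<le> rdist E v x" "w \<noteq> v" "(v, x) \<in> E ^^ k'"
  shows "(w, x) \<in> (Restr E (- {v}))\<^sup>*"
  using assms
proof (induction "rdist E w x" arbitrary: w k)
  case 0
  then show ?case using rdist_in[OF 0(2)] by simp
next
  case (Suc j)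
  from rdist_Suc_step[OF Suc(3)] Suc(2) obtain w1
    where w1: "(w, w1) \<in> E" "(w1, x) \<in> E ^^ j" "rdist E w1 x = j" by metis
  have "w1 \<noteq> v" using w1 Suc by auto
  then have "(w1, x) \<in> (Restr E (- {v}))\<^sup>*" using Suc w1 by (intro Suc(1)) auto
  moreover have "(w, w1) \<in> Restr E (- {v})" using w1 \<open>w1 \<noteq> v\<close> Suc by auto
  ultimately show ?case by (rule converse_rtrancl_into_rtrancl[rotated])
qed

section \<open>Walks, distances and cycles in symmetric graphs\<close>

context pair_wf_digraph begin

lemma ex_awalk_iff_relpow:
  "u \<in> pverts G \<Longrightarrow> (\<exists>p. awalk u p v \<and> length p = k) \<longleftrightarrow> (u, v) \<in> parcs G ^^ k"
proof (induction k arbitrary: u)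
  case 0
  then show ?case by (auto simp: awalk_Nil_iff)
next
  case (Suc k)
  have "(\<exists>p. awalk u p v \<and> length p = Suc k) \<longleftrightarrow>
      (\<exists>w. (u, w) \<in> parcs G \<and> (\<exists>p. awalk w p v \<and> length p = k))"
  proof
    assume "\<exists>p. awalk u p v \<and> length p = Suc k"
    then obtain e p where "awalk u (e # p) v" "length p = k" by (metis length_Suc_conv)
    then show "\<exists>w. (u, w) \<in> parcs G \<and> (\<exists>p. awalk w p v \<and> length p = k)"
      by (cases e) (auto simp: awalk_Cons_iff)
  next
    assume "\<exists>w. (u, w) \<in> parcs G \<and> (\<exists>p. awalk w p v \<and> length p = k)"
    then obtain w p where "(u, w) \<in> parcs G" "awalk w p v" "length p = k" by blast
    then show "\<exists>p. awalk u p v \<and> length p = Suc k"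
      by (intro exI[of _ "(u, w) # p"]) (auto simp: awalk_Cons_iff)
  qed
  also have "\<dots> \<longleftrightarrow> (\<exists>w. (u, w) \<in> parcs G \<and> (w, v) \<in> parcs G ^^ k)"
    using Suc.IH in_arcsD2 by (metis (no_types, lifting))
  also have "\<dots> \<longleftrightarrow> (u, v) \<in> parcs G ^^ Suc k"
    by (meson relpow_Suc_D2 relpow_Suc_I2)
  finally show ?case .
qed

lemma path_dist_eq_rdist:
  assumes "u \<in> pverts G" "(u, v) \<in> parcs G ^^ k"
  shows "path_dist G u v = real (rdist (parcs G) u v)"
proof -
  have cost: "awalk_cost (\<lambda>_. 1) p = length p" for p :: "('a \<times> 'a) list"
    by (induction p) auto
  obtain p where p: "awalk u p v" "length p = rdist (parcs G) u v"
    using ex_awalk_iff_relpow[OF assms(1)] rdist_in[OF assms(2)] by blast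
  have "\<mu> (\<lambda>_. 1) u v = ereal (real (rdist (parcs G) u v))"
    unfolding \<mu>_def
  proof (rule antisym)
    show "(INF p\<in>{p. awalk u p v}. ereal (awalk_cost (\<lambda>_. 1) p)) \<le> ereal (real (rdist (parcs G) u v))"
      using p by (intro INF_lower2[of p]) (auto simp: cost)
    show "ereal (real (rdist (parcs G) u v)) \<le> (INF p\<in>{p. awalk u p v}. ereal (awalk_cost (\<lambda>_. 1) p))"
      using ex_awalk_iff_relpow[OF assms(1)] by (intro INF_greatest) (auto simp: cost intro!: rdist_le)
  qed
  then show ?thesis by (simp add: path_dist_def)
qed

end

context pair_bidirected_digraph begin

lemma parcs_sym: "(u, v) \<in> parcs G \<Longrightarrow> (v, u) \<in> parcs G"
  using arcs_symmetric by blast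

text \<open>Shorten the connection to a simple path and close it up at \<open>v\<close>. Since
  \<open>w\<close> and \<open>w'\<close> differ, it has at least one arc, and the two arcs at
  \<open>v\<close> make three.\<close>

lemma cycle_through:
  assumes vw: "(v, w) \<in> parcs G" "(v, w') \<in> parcs G" "w \<noteq> w'"
    and reach: "(w, w') \<in> (Restr (parcs G) (- {v}))\<^sup>*"
  shows "\<exists>p. pre_digraph.cycle (with_proj G) p \<and> 3 \<le> length p"
proof -
  have V: "v \<in> pverts G" "w \<in> pverts G" using vw in_arcsD1 in_arcsD2 by blast+
  have wv: "w \<noteq> v" using vw(1) no_loops' by blast
  from reach have "\<exists>p. awalk w p w' \<and> v \<notin> set (awalk_verts w p)"
  proof (induction rule: rtrancl_induct)
    case base
    show ?case using V wv by (intro exI[of _ "[]"]) (auto simp: awalk_Nil_iff)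
  next
    case (step y z)
    then obtain p where p: "awalk w p y" "v \<notin> set (awalk_verts w p)" by blast
    have yz: "awalk y [(y, z)] z" using step in_arcsD2 by (auto simp: awalk_Cons_iff awalk_Nil_iff)
    have "set (awalk_verts w (p @ [(y, z)])) = set (awalk_verts w p) \<union> {y, z}"
      using set_awalk_verts_append[OF p(1) yz] by simp
    moreover have "awalk w (p @ [(y, z)]) z" using p(1) yz by (rule awalk_appendI)
    ultimately show ?case using p(2) step by (intro exI[of _ "p @ [(y, z)]"]) auto
  qed
  then obtain p0 where p0: "awalk w p0 w'" "v \<notin> set (awalk_verts w p0)" by blast
  define p where "p = awalk_to_apath p0"
  have ap: "awalk w p w'" "distinct (awalk_verts w p)"
    using apath_awalk_to_apath[OF p0(1)] by (auto simp: p_def apath_def)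
  have "set (awalk_verts w p) \<subseteq> set (awalk_verts w p0)"
    using set_awalk_verts[OF ap(1)] set_awalk_verts[OF p0(1)] awalk_to_apath_subset[OF p0(1)]
    unfolding p_def by auto
  then have nv: "v \<notin> set (awalk_verts w p)" using p0 by blast
  have w'v: "awalk w' [(w', v)] v" using parcs_sym[OF vw(2)] V by (auto simp: awalk_Cons_iff awalk_Nil_iff)
  have aw: "awalk w (p @ [(w', v)]) v" using ap(1) w'v by (rule awalk_appendI)
  have verts: "awalk_verts w (p @ [(w', v)]) = awalk_verts w p @ [v]"
    using awalk_verts_append[OF aw] by simp
  have c: "awalk v ((v, w) # p @ [(w', v)]) v" using aw vw(1) by (auto simp: awalk_Cons_iff)
  have "p \<noteq> []" using ap(1) vw(3) by (auto simp: awalk_Nil_iff)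
  then have "3 \<le> length ((v, w) # p @ [(w', v)])" by (cases p) auto
  moreover have "pre_digraph.cycle (with_proj G) ((v, w) # p @ [(w', v)])"
    unfolding cycle_def using c verts ap(2) nv by (intro exI[of _ v]) auto
  ultimately show ?thesis by blast
qed

end


locale busemann_tree = pair_bidirected_digraph T
  for T :: "'a pair_pre_digraph" +
  fixes d :: nat and f :: "'a \<Rightarrow> int" and r :: "nat \<Rightarrow> 'a"
  assumes tree: "regular_tree (d + 1) T" and ray: "ray T r" and d2: "2 \<le> d"
    and busemann: "\<And>v. v \<in> pverts T \<Longrightarrow> (\<lambda>k. path_dist T v (r k) - real k) \<longlonglongrightarrow> real_of_int (f v)"
begin

abbreviation V where "V \<equiv> pverts T"
abbreviation E where "E \<equiv> parcs T"

lemma r_in: "r i \<in> V"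
  using ray in_arcsD1 by (auto simp: ray_def)

lemma relpow_connected: "u \<in> V \<Longrightarrow> v \<in> V \<Longrightarrow> \<exists>k. (u, v) \<in> E ^^ k"
proof -
  assume uv: "u \<in> V" "v \<in> V"
  have sym: "(\<Union>e\<in>E. {e, (snd e, fst e)}) = E"
    using parcs_sym by fastforce
  have "mk_symmetric (with_proj T) = T"
    by (simp add: mk_symmetric_def sym)
  then have "u \<rightarrow>\<^sup>*\<^bsub>with_proj T\<^esub> v"
    using tree uv by (auto simp: regular_tree_def Digraph_Component.connected_def strongly_connected_def)
  then obtain p where "awalk u p v" using reachable_awalk by blast
  then show ?thesis using ex_awalk_iff_relpow[OF uv(1)] by blast
qed

text \<open>The converging terms and their limit are integers, so the limit is eventually
  attained.\<close>

lemma eventually_dist: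
  assumes v: "v \<in> V"
  shows "\<forall>\<^sub>F k in sequentially. int (rdist E v (r k)) = int k + f v"
proof -
  have "\<forall>\<^sub>F k in sequentially. dist (path_dist T v (r k) - real k) (real_of_int (f v)) < 1"
    using busemann[OF v] by (rule tendstoD) simp
  then show ?thesis
  proof (rule eventually_mono)
    fix k assume a: "dist (path_dist T v (r k) - real k) (real_of_int (f v)) < 1"
    obtain j where "(v, r k) \<in> E ^^ j" using relpow_connected[OF v r_in] by blast
    then have "path_dist T v (r k) = real (rdist E v (r k))" by (rule path_dist_eq_rdist[OF v])
    then have "\<bar>real_of_int (int (rdist E v (r k)) - int k - f v)\<bar> < 1" using a by (simp add: dist_real_def)
    then have "\<bar>int (rdist E v (r k)) - int k - f v\<bar> < 1" by linarith
    then show "int (rdist E v (r k)) = int k + f v" by linarith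
  qed
qed

text \<open>One far point of the ray measures the heights of finitely many vertices at once. The
  positive distance guarantees a first step towards it.\<close>

lemma obtain_dist:
  assumes "finite F" "F \<subseteq> V"
  obtains k where "\<And>v. v \<in> F \<Longrightarrow> int (rdist E v (r k)) = int k + f v" "\<And>v. v \<in> F \<Longrightarrow> 0 < int k + f v"
proof -
  have "\<forall>\<^sub>F k in sequentially. \<forall>v\<in>F. int (rdist E v (r k)) = int k + f v \<and> 0 < int k + f v"
  proof (rule eventually_ball_finite[OF assms(1)], intro ballI eventually_conj)
    fix v assume "v \<in> F"
    then show "\<forall>\<^sub>F k in sequentially. int (rdist E v (r k)) = int k + f v"
      using eventually_dist assms by blast
    show "\<forall>\<^sub>F k in sequentially. 0 < int k + f v"
      unfolding eventually_sequentially by (intro exI[of _ "nat (1 - f v)"]) auto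
  qed
  then obtain k where "\<forall>v\<in>F. int (rdist E v (r k)) = int k + f v \<and> 0 < int k + f v"
    by (auto simp: eventually_sequentially)
  then show thesis using that by blast
qed

lemma finite_nbrs: "v \<in> V \<Longrightarrow> finite {w. (v, w) \<in> E}"
  and card_nbrs: "v \<in> V \<Longrightarrow> card {w. (v, w) \<in> E} = d + 1"
proof -
  assume v: "v \<in> V"
  have eq: "{w. (v, w) \<in> E} = snd ` out_arcs (with_proj T) v"
    by (force simp: out_arcs_def)
  have inj: "inj_on snd (out_arcs (with_proj T) v)" by (auto simp: out_arcs_def inj_on_def)
  show "finite {w. (v, w) \<in> E}" "card {w. (v, w) \<in> E} = d + 1"
    using tree v unfolding eq card_image[OF inj] by (auto simp: regular_tree_def out_degree_def)
qed

text \<open>The first vertex of a geodesic from \<open>v\<close> to a far point of the ray.\<close>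

lemma ex_lower_nbr:
  assumes v: "v \<in> V"
  shows "\<exists>w. (v, w) \<in> E \<and> f w = f v - 1"
proof -
  let ?N = "{w. (v, w) \<in> E}"
  have "finite (insert v ?N)" "insert v ?N \<subseteq> V" using finite_nbrs v in_arcsD2 by auto
  then obtain k where k: "\<And>w. w \<in> insert v ?N \<Longrightarrow> int (rdist E w (r k)) = int k + f w"
      "\<And>w. w \<in> insert v ?N \<Longrightarrow> 0 < int k + f w"
    by (rule obtain_dist) blast
  obtain i where i: "(v, r k) \<in> E ^^ i" using relpow_connected[OF v r_in] by blast
  obtain j where j: "rdist E v (r k) = Suc j" using k[of v] by (cases "rdist E v (r k)") auto
  obtain w where w: "(v, w) \<in> E" "rdist E w (r k) = j" using rdist_Suc_step[OF i j] by blast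
  then show ?thesis using k(1)[of v] k(1)[of w] j by auto
qed

text \<open>Geodesics towards \<open>r k\<close> from two such neighbours avoid \<open>v\<close>, and would close up to a cycle.\<close>

lemma le_nbr_unique:
  assumes vw: "(v, w) \<in> E" "(v, w') \<in> E" and le: "f w \<le> f v" "f w' \<le> f v"
  shows "w = w'"
proof (rule ccontr)
  assume ne: "w \<noteq> w'"
  have V: "v \<in> V" "w \<in> V" "w' \<in> V" using vw in_arcsD1 in_arcsD2 by blast+
  then obtain k where k: "\<And>x. x \<in> {v, w, w'} \<Longrightarrow> int (rdist E x (r k)) = int k + f x"
    using obtain_dist[of "{v, w, w'}"] by blast
  obtain i where i: "(v, r k) \<in> E ^^ i" using relpow_connected[OF V(1) r_in] by blast
  have avoid: "(x, r k) \<in> (Restr E (- {v}))\<^sup>*" if "x = w \<or> x = w'" for x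
  proof -
    have "x \<in> V" "x \<noteq> v" using that V vw no_loops' by auto
    moreover obtain j where "(x, r k) \<in> E ^^ j" using relpow_connected[OF \<open>x \<in> V\<close> r_in] by blast
    moreover have "rdist E x (r k) \<le> rdist E v (r k)" using k[of x] k[of v] that le by auto
    ultimately show ?thesis using rdist_avoid i by metis
  qed
  have "sym (Restr E (- {v}))" using parcs_sym by (auto simp: sym_def)
  then have "sym ((Restr E (- {v}))\<^sup>*)" by (rule sym_rtrancl)
  then have "(r k, w') \<in> (Restr E (- {v}))\<^sup>*" using avoid[of w'] by (auto dest: symD)
  with avoid[of w] have "(w, w') \<in> (Restr E (- {v}))\<^sup>*" by auto
  from cycle_through[OF vw ne this] show False using tree by (auto simp: regular_tree_def)
qed

definition par :: "'a \<Rightarrow> 'a" where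
  "par v = (SOME w. (v, w) \<in> E \<and> f w = f v - 1)"

lemma par: "v \<in> V \<Longrightarrow> (v, par v) \<in> E" "v \<in> V \<Longrightarrow> f (par v) = f v - 1"
  using someI_ex[OF ex_lower_nbr] unfolding par_def by blast+

text \<open>At the end of the arc that is not lower, the other end is a neighbour of no greater
  height, hence the parent by \<open>le_nbr_unique\<close>. In particular no arc joins vertices of
  equal height.\<close>

lemma arc_iff_par: "(v, w) \<in> E \<longleftrightarrow> v \<in> V \<and> w \<in> V \<and> (w = par v \<or> v = par w)"
proof
  assume e: "(v, w) \<in> E"
  then have V: "v \<in> V" "w \<in> V" using in_arcsD1 in_arcsD2 by blast+
  have "w = par v" if "f w \<le> f v" using le_nbr_unique[OF e par(1) that] par(2) V by simp
  moreover have "v = par w" if "f v \<le> f w" using le_nbr_unique[OF parcs_sym[OF e] par(1) that] par(2) V by simp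
  ultimately show "v \<in> V \<and> w \<in> V \<and> (w = par v \<or> v = par w)" using V by linarith
qed (use par(1) parcs_sym in blast)

sublocale horo_tree V par f d
proof
  show "V \<noteq> {}" using r_in by blast
  show "2 \<le> d" by (rule d2)
  show in': "par x \<in> V" if "x \<in> V" for x using par(1)[OF that] in_arcsD2 by blast
  show f': "f (par x) = f x - 1" if "x \<in> V" for x using par(2)[OF that] .
  show "card {c \<in> V. par c = x} = d" if x: "x \<in> V" for x
  proof -
    have "par (par x) \<noteq> x" using f'[OF x] f'[OF in'[OF x]] by auto
    then have "{c \<in> V. par c = x} = {w. (x, w) \<in> E} - {par x}"
      using x arc_iff_par f' by auto
    then show ?thesis using card_nbrs[OF x] finite_nbrs[OF x] par(1)[OF x] by simp
  qed
  show "\<exists>i j. (par ^^ i) x = (par ^^ j) y" if xy: "x \<in> V" "y \<in> V" for x y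
  proof -
    obtain k where "(x, y) \<in> E ^^ k" using relpow_connected xy by blast
    then show ?thesis
    proof (induction k arbitrary: x)
      case 0
      then show ?case by auto
    next
      case (Suc k)
      then obtain z where z: "(x, z) \<in> E" "(z, y) \<in> E ^^ k" by (meson relpow_Suc_D2)
      from Suc.IH[OF z(2)] obtain i j where ij: "(par ^^ i) z = (par ^^ j) y" by blast
      from z(1) have "z = par x \<or> x = par z" using arc_iff_par by blast
      then show ?case
      proof
        assume "z = par x"
        then have "(par ^^ Suc i) x = (par ^^ i) z" by (simp add: funpow_swap1)
        then have "(par ^^ Suc i) x = (par ^^ j) y" using ij by metis
        then show ?thesis by blast
      next
        assume "x = par z"
        then have "(par ^^ i) x = par ((par ^^ i) z)" by (simp add: funpow_swap1)
        then have "(par ^^ i) x = (par ^^ Suc j) y" using ij by simp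
        then show ?thesis by blast
      qed
    qed
  qed
qed

end

lemma regular_tree_horo_tree:
  assumes "regular_tree (d + 1) T" "\<xi> \<in> tree_ends T" "busemann_function T \<xi> f" "2 \<le> d"
  obtains par where "horo_tree (pverts T) par f d"
    "\<And>v w. (v, w) \<in> parcs T \<longleftrightarrow> v \<in> pverts T \<and> w \<in> pverts T \<and> (w = par v \<or> v = par w)"
proof -
  obtain r where r: "r \<in> \<xi>" "\<And>v. v \<in> pverts T \<Longrightarrow> (\<lambda>k. path_dist T v (r k) - real k) \<longlonglongrightarrow> real_of_int (f v)"
    using assms(3) by (auto simp: busemann_function_def)
  have "ray T r" using r(1) assms(2) by (auto simp: tree_ends_def quotient_def same_end_def)
  then interpret busemann_tree T d f r
    using assms r(2) by (simp add: busemann_tree_def busemann_tree_axioms_def regular_tree_def)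
  show thesis using that[of par] horo_tree_axioms arc_iff_par by blast
qed

text \<open>Vertex and arc sets of the graph itself, with \<open>m\<close> and \<open>n\<close> not
  ordered, so that both orders can be reduced to \<open>dl_space\<close>.\<close>

locale horo_product = T1: horo_tree V1 par1 ht1 m + T2: horo_tree V2 par2 ht2 n
  for V1 :: "'a set" and par1 ht1 m and V2 :: "'b set" and par2 ht2 n +
  fixes P :: "('a \<times> 'b) set" and E :: "(('a \<times> 'b) \<times> ('a \<times> 'b)) set"
  assumes P_iff: "(x, y) \<in> P \<longleftrightarrow> x \<in> V1 \<and> y \<in> V2 \<and> ht1 x + ht2 y = 0"
    and E_iff: "((x, y), (x', y')) \<in> E \<longleftrightarrow> (x, y) \<in> P \<and> (x', y') \<in> P \<and>
      (x' = par1 x \<or> x = par1 x') \<and> (y' = par2 y \<or> y = par2 y')"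
begin

lemma sym_relpow: "(p, q) \<in> E ^^ k \<Longrightarrow> (q, p) \<in> E ^^ k"
proof (induction k arbitrary: q)
  case (Suc k)
  then obtain z where z: "(p, z) \<in> E ^^ k" "(z, q) \<in> E" by auto
  then have "(q, z) \<in> E" by (cases z, cases q) (auto simp: E_iff)
  then show ?case using Suc.IH[OF z(1)] by (rule relpow_Suc_I2)
qed simp

lemma vertical_walk:
  assumes "a \<in> V1" "b \<in> V2" "ht1 a + ht2 b = int k"
  shows "(((par1 ^^ k) a, b), (a, (par2 ^^ k) b)) \<in> E ^^ k"
  using assms
proof (induction k arbitrary: a)
  case (Suc k)
  have "(((par1 ^^ k) (par1 a), b), (par1 a, (par2 ^^ k) b)) \<in> E ^^ k"
    using Suc.prems by (intro Suc.IH) auto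
  moreover have "((par1 a, (par2 ^^ k) b), (a, (par2 ^^ Suc k) b)) \<in> E"
    using Suc.prems by (simp add: E_iff P_iff T2.funpow_par_in T2.ht_funpow_par)
  ultimately show ?case by (auto simp: funpow_swap1)
qed simp

lemma vertical_anc:
  assumes "a \<in> V1" "b \<in> V2" "c \<le> ht1 a" "d \<le> ht2 b" "ht1 a + d = 0" "ht2 b + c = 0"
  shows "((T1.anc c a, b), (a, T2.anc d b)) \<in> E ^^ nat (ht1 a - c)"
proof -
  have "T2.anc d b = (par2 ^^ nat (ht1 a - c)) b"
    unfolding T2.anc_def using assms(5,6) by (simp add: add_eq_0_iff2 algebra_simps)
  then show ?thesis
    using vertical_walk[OF assms(1,2), of "nat (ht1 a - c)"] assms by (simp add: T1.anc_def)
qed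

definition pd :: "'a \<times> 'b \<Rightarrow> 'a \<times> 'b \<Rightarrow> int" where
  "pd p q = T1.td (fst p) (fst q) + T2.td (snd p) (snd q)"

text \<open>Rise until the second coordinate is the common ancestor of \<open>y\<close> and
  \<open>y'\<close>, fall until the first coordinate is that of \<open>x\<close> and
  \<open>x'\<close>, then rise to \<open>(x', y')\<close>. In the first two runs the other
  coordinate follows auxiliary branches ending at \<open>x1\<close> and \<open>y1\<close>.\<close>

lemma ex_walk:
  assumes "(x, y) \<in> P" "(x', y') \<in> P"
  shows "\<exists>k. ((x, y), (x', y')) \<in> E ^^ k \<and> int k \<le> 2 * pd (x, y) (x', y')"
proof -
  have V: "x \<in> V1" "y \<in> V2" "ht1 x + ht2 y = 0" "x' \<in> V1" "y' \<in> V2" "ht1 x' + ht2 y' = 0"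
    using assms by (auto simp: P_iff)
  define M1 where "M1 = T1.mt x x'"
  define M2 where "M2 = T2.mt y y'"
  have M: "M1 \<le> ht1 x" "M1 \<le> ht1 x'" "T1.anc M1 x = T1.anc M1 x'"
    "M2 \<le> ht2 y" "M2 \<le> ht2 y'" "T2.anc M2 y = T2.anc M2 y'"
    unfolding M1_def M2_def using V T1.mt_le1 T1.mt_le2 T1.anc_mt T2.mt_le1 T2.mt_le2 T2.anc_mt by auto
  obtain x1 where "x1 \<in> T1.desc (nat (- M2 - ht1 x)) x" using T1.desc_ne[OF V(1)] by blast
  then have x1: "x1 \<in> V1" "ht1 x1 = - M2" "T1.anc (ht1 x) x1 = x" using V M T1.descD[of x1] by auto
  obtain y1 where "y1 \<in> T2.desc (nat (- M1 - ht2 y')) y'" using T2.desc_ne[OF V(5)] by blast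
  then have y1: "y1 \<in> V2" "ht2 y1 = - M1" "T2.anc (ht2 y') y1 = y'" using V M T2.descD[of y1] by auto
  have a1: "T1.anc M1 x1 = T1.anc M1 x'" using T1.anc_anc[of x1 M1 "ht1 x"] x1 M V by auto
  have a2: "T2.anc M2 y1 = T2.anc M2 y" using T2.anc_anc[of y1 M2 "ht2 y'"] y1 M V by auto
  have "((x, y), (x1, T2.anc M2 y)) \<in> E ^^ nat (- M2 - ht1 x)"
    using vertical_anc[of x1 y "ht1 x" M2] x1 V M by simp
  moreover have "((T1.anc M1 x', y1), (x1, T2.anc M2 y)) \<in> E ^^ nat (- M2 - M1)"
    using vertical_anc[of x1 y1 M1 M2] x1 y1 V M a1 a2 by simp
  moreover have "((T1.anc M1 x', y1), (x', y')) \<in> E ^^ nat (ht1 x' - M1)"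
    using vertical_anc[of x' y1 M1 "ht2 y'"] y1 V M by simp
  ultimately have "((x, y), (x', y')) \<in> E ^^ (nat (- M2 - ht1 x) + nat (- M2 - M1) + nat (ht1 x' - M1))"
    using sym_relpow by (meson relpow_trans)
  moreover have "int (nat (- M2 - ht1 x) + nat (- M2 - M1) + nat (ht1 x' - M1)) \<le> 2 * pd (x, y) (x', y')"
    using V M by (simp add: pd_def T1.td_def T2.td_def flip: M1_def M2_def)
  ultimately show ?thesis by blast
qed

text \<open>An arc moves by exactly 1 in each of the two trees, hence the factor 2.\<close>

lemma pd_le_walk: "p \<in> P \<Longrightarrow> (p, q) \<in> E ^^ k \<Longrightarrow> q \<in> P \<and> pd p q \<le> 2 * int k"
proof (induction k arbitrary: q)
  case 0
  then show ?case by (cases p) (auto simp: pd_def P_iff)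
next
  case (Suc k)
  then obtain z where z: "(p, z) \<in> E ^^ k" "(z, q) \<in> E" by auto
  obtain x y x' y' where zq: "z = (x, y)" "q = (x', y')" by (metis prod.exhaust)
  have IH: "z \<in> P" "pd p z \<le> 2 * int k" using Suc.IH[OF Suc.prems(1) z(1)] by auto
  have V: "fst p \<in> V1" "snd p \<in> V2" "x \<in> V1" "y \<in> V2" "x' \<in> V1" "y' \<in> V2" "q \<in> P"
    using IH(1) Suc.prems(1) z(2) by (cases p; auto simp: zq P_iff E_iff)+
  have 1: "T1.td u (par1 u) = 1" if "u \<in> V1" for u
    using T1.td_anc[of u "ht1 u - 1"] T1.par_anc[of u "ht1 u"] that by simp
  have 2: "T2.td u (par2 u) = 1" if "u \<in> V2" for u
    using T2.td_anc[of u "ht2 u - 1"] T2.par_anc[of u "ht2 u"] that by simp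
  have "T1.td x x' = 1" "T2.td y y' = 1"
    using z(2) 1 2 V T1.td_commute[of x x'] T2.td_commute[of y y'] unfolding zq E_iff by metis+
  then show ?case
    using IH(2) V T1.td_triangle[of "fst p" x x'] T2.td_triangle[of "snd p" y y'] by (simp add: pd_def zq)
qed

lemma path_dist_bounds:
  assumes "p \<in> P" "q \<in> P"
  shows "real_of_int (pd p q) \<le> 2 * path_dist \<lparr>pverts = P, parcs = E\<rparr> p q"
    and "path_dist \<lparr>pverts = P, parcs = E\<rparr> p q \<le> 2 * real_of_int (pd p q)"
proof -
  interpret D: pair_wf_digraph "\<lparr>pverts = P, parcs = E\<rparr>"
    by unfold_locales (auto simp: E_iff)
  obtain k where k: "(p, q) \<in> E ^^ k" "int k \<le> 2 * pd p q"
    using ex_walk assms by (metis prod.exhaust)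
  have pd: "path_dist \<lparr>pverts = P, parcs = E\<rparr> p q = real (rdist E p q)"
    using D.path_dist_eq_rdist[of p q k] assms k by simp
  have "pd p q \<le> 2 * int (rdist E p q)" using pd_le_walk[OF assms(1) rdist_in[OF k(1)]] by blast
  then show "real_of_int (pd p q) \<le> 2 * path_dist \<lparr>pverts = P, parcs = E\<rparr> p q"
    unfolding pd by linarith
  have "int (rdist E p q) \<le> 2 * pd p q" using rdist_le[OF k(1)] k(2) by linarith
  then show "path_dist \<lparr>pverts = P, parcs = E\<rparr> p q \<le> 2 * real_of_int (pd p q)"
    unfolding pd by linarith
qed

end

section \<open>Reduction of Diestel-Leader graphs to horocyclic products\<close>

lemma is_DL_horo_product:
  assumes "is_DL m n D" "2 \<le> m" "2 \<le> n"
  obtains V1 par1 ht1 V2 par2 ht2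
  where "horo_product V1 par1 ht1 m V2 par2 ht2 n (pverts D) (parcs D)"
proof -
  obtain T1 T2 \<xi>1 \<xi>2 f1 f2 where
    1: "regular_tree (m + 1) T1" "\<xi>1 \<in> tree_ends T1" "busemann_function T1 \<xi>1 f1" and
    2: "regular_tree (n + 1) T2" "\<xi>2 \<in> tree_ends T2" "busemann_function T2 \<xi>2 f2" and
    D: "D = diestel_leader T1 f1 T2 f2"
    using assms(1) unfolding is_DL_def by (elim exE conjE) (rule that)
  obtain par1 where p1: "horo_tree (pverts T1) par1 f1 m"
    "\<And>v w. (v, w) \<in> parcs T1 \<longleftrightarrow> v \<in> pverts T1 \<and> w \<in> pverts T1 \<and> (w = par1 v \<or> v = par1 w)"
    by (rule regular_tree_horo_tree[OF 1 assms(2)]) blast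
  obtain par2 where p2: "horo_tree (pverts T2) par2 f2 n"
    "\<And>v w. (v, w) \<in> parcs T2 \<longleftrightarrow> v \<in> pverts T2 \<and> w \<in> pverts T2 \<and> (w = par2 v \<or> v = par2 w)"
    by (rule regular_tree_horo_tree[OF 2 assms(3)]) blast
  have "horo_product (pverts T1) par1 f1 m (pverts T2) par2 f2 n (pverts D) (parcs D)"
    using p1(1) p2(1) unfolding horo_product_def horo_product_axioms_def
    by (auto simp: D diestel_leader_def Let_def p1(2) p2(2))
  then show thesis by (rule that)
qed

lemma (in horo_product) no_quasi_isometry:
  fixes G :: "'g monoid" and phi :: "'g \<Rightarrow> 'a \<times> 'b"
  assumes "m \<noteq> n" "group G" "finite_generating_set G S" "1 \<le> N"
    and in_P: "\<And>g. g \<in> carrier G \<Longrightarrow> phi g \<in> P"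
    and up: "\<And>g g'. g \<in> carrier G \<Longrightarrow> g' \<in> carrier G \<Longrightarrow>
      pd (phi g) (phi g') \<le> int N * (int (word_length G S (inv\<^bsub>G\<^esub> g \<otimes>\<^bsub>G\<^esub> g')) + 1)"
    and lo: "\<And>g g'. g \<in> carrier G \<Longrightarrow> g' \<in> carrier G \<Longrightarrow>
      int (word_length G S (inv\<^bsub>G\<^esub> g \<otimes>\<^bsub>G\<^esub> g')) \<le> int N * (pd (phi g) (phi g') + 1)"
    and onto: "\<And>p. p \<in> P \<Longrightarrow> \<exists>g\<in>carrier G. pd (phi g) p \<le> int N"
  shows False
proof (cases "n < m")
  case True
  then interpret dl_space V1 par1 ht1 m V2 par2 ht2 n by unfold_locales
  have "P = X" "pd = rho" by (auto simp: X_def P_iff pd_def rho_def fun_eq_iff)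
  then show False using no_group_quasi_isometry[of G S N phi] assms(2-8) by simp
next
  case False
  with assms(1) have "m < n" by simp
  \<comment> \<open>For \<open>m < n\<close> the trees exchange roles and heights change sign;
    swapping coordinates turns \<open>pd\<close> into \<open>rho\<close>.\<close>
  then interpret dl_space V2 par2 ht2 n V1 par1 ht1 m by unfold_locales
  define phi' where "phi' = prod.swap \<circ> phi"
  have X: "p \<in> X \<longleftrightarrow> prod.swap p \<in> P" for p by (cases p) (auto simp: X_def P_iff)
  have pd: "rho (prod.swap p) (prod.swap q) = pd p q" for p q by (simp add: rho_def pd_def)
  show False
  proof (rule no_group_quasi_isometry[of G S N phi'])
    show "\<exists>g\<in>carrier G. rho (phi' g) p \<le> int N" if "p \<in> X" for p
      using onto[of "prod.swap p"] that pd[of _ "prod.swap p"] by (auto simp: X phi'_def)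
  qed (use assms(2-4) in_P up lo in \<open>auto simp: X pd phi'_def\<close>)
qed

theorem theorem1p9:
  fixes m n :: nat and D :: "('a \<times> 'b) pair_pre_digraph"
  assumes "m \<ge> 2" and "n \<ge> 2" and "m \<noteq> n"
    and "is_DL m n D"
  shows "\<not> (\<exists>(G :: 'g monoid) S. group G \<and> finite_generating_set G S \<and>
           quasi_isometric (carrier G) (word_dist G S) (pverts D) (path_dist D))"
proof
  assume "\<exists>(G :: 'g monoid) S. group G \<and> finite_generating_set G S \<and>
           quasi_isometric (carrier G) (word_dist G S) (pverts D) (path_dist D)"
  then obtain G :: "'g monoid" and S K C phi where
    G: "group G" "finite_generating_set G S" and
    qi: "quasi_isometry K C (carrier G) (word_dist G S) (pverts D) (path_dist D) phi"
    by (auto simp: quasi_isometric_def)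
  obtain V1 par1 ht1 V2 par2 ht2
    where "horo_product V1 par1 ht1 m V2 par2 ht2 n (pverts D) (parcs D)"
    using is_DL_horo_product assms by blast
  then interpret horo_product V1 par1 ht1 m V2 par2 ht2 n "pverts D" "parcs D" .
  have D: "\<lparr>pverts = pverts D, parcs = parcs D\<rparr> = D" by simp
  note bounds = path_dist_bounds[unfolded D]
  have K: "1 \<le> K" "0 \<le> C" and phi: "\<And>g. g \<in> carrier G \<Longrightarrow> phi g \<in> pverts D"
    and le: "\<And>g g'. g \<in> carrier G \<Longrightarrow> g' \<in> carrier G \<Longrightarrow> path_dist D (phi g) (phi g') \<le> K * word_dist G S g g' + C"
    and ge: "\<And>g g'. g \<in> carrier G \<Longrightarrow> g' \<in> carrier G \<Longrightarrow> word_dist G S g g' / K - C \<le> path_dist D (phi g) (phi g')"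
    and onto: "\<And>p. p \<in> pverts D \<Longrightarrow> \<exists>g\<in>carrier G. path_dist D (phi g) p \<le> C"
    using qi by (auto simp: quasi_isometry_def)
  \<comment> \<open>One natural number above every constant that occurs: \<open>2 * K\<close> and
    \<open>2 * C\<close> when \<open>pd\<close> is bounded by the path metric, \<open>2 * K\<close>
    and \<open>K * C\<close> in the opposite estimate. The factors 2 come from
    \<open>path_dist_bounds\<close>.\<close>
  define N where "N = nat \<lceil>2 * K + 2 * C + K * C\<rceil>"
  have "0 \<le> K * C" using K by simp
  then have N: "2 * K \<le> N" "2 * C \<le> N" "K * C \<le> N" "1 \<le> N"
    using K unfolding N_def by linarith+
  have N2: "2 * K + 2 * C + K * C \<le> N" unfolding N_def by linarith
  show False
  proof (rule no_quasi_isometry[OF assms(3) G \<open>1 \<le> N\<close> phi])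
    fix g g' assume g: "g \<in> carrier G" "g' \<in> carrier G"
    let ?l = "word_length G S (inv\<^bsub>G\<^esub> g \<otimes>\<^bsub>G\<^esub> g')"
    note b = bounds[OF phi[OF g(1)] phi[OF g(2)]]
    have "real_of_int (pd (phi g) (phi g')) \<le> 2 * K * ?l + 2 * C"
      using b(1) le[OF g] by (simp add: word_dist_def)
    also have "\<dots> \<le> N * real ?l + N" using N by (intro add_mono mult_right_mono) auto
    finally have "real_of_int (pd (phi g) (phi g')) \<le> real_of_int (int N * (int ?l + 1))"
      by (simp add: algebra_simps)
    then show "pd (phi g) (phi g') \<le> int N * (int ?l + 1)" unfolding of_int_le_iff .
    have pos: "0 \<le> pd (phi g) (phi g')" using b by linarith
    have "real ?l / K \<le> 2 * pd (phi g) (phi g') + C" using b(2) ge[OF g] by (simp add: word_dist_def)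
    then have "real ?l \<le> 2 * K * pd (phi g) (phi g') + K * C" using K by (simp add: field_simps)
    also have "\<dots> \<le> N * real_of_int (pd (phi g) (phi g')) + N"
      using N pos by (intro add_mono mult_right_mono) auto
    finally have "real_of_int (int ?l) \<le> real_of_int (int N * (pd (phi g) (phi g') + 1))"
      by (simp add: algebra_simps)
    then show "int ?l \<le> int N * (pd (phi g) (phi g') + 1)" unfolding of_int_le_iff .
  next
    fix p assume p: "p \<in> pverts D"
    then obtain g where g: "g \<in> carrier G" "path_dist D (phi g) p \<le> C" using onto by blast
    then have "real_of_int (pd (phi g) p) \<le> N" using bounds(1)[OF phi[OF g(1)] p] N(2) by linarith
    then show "\<exists>g\<in>carrier G. pd (phi g) p \<le> int N" using g(1) by (intro bexI[of _ g]) auto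
  qed
qed

end
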